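(* Let $k\ge 3$ be an integer and let $\gamma\subset\mathbb{R}^2$ be a $C^2$-smooth, planar, strictly convex closed curve which is invariant under an element of $\mathrm{GL}(2,\mathbb{R})$ of order $k$. Let $T$ be either the Outer billiard map of $\gamma$ or the Symplectic billiard map of $\gamma$. Suppose that $T$ admits a rotational invariant curve of rotation number $\frac{r}{k}$, with $r$ coprime to $k$. If this curve has a neighborhood $U$ such that $T$ is totally integrable in $U$, then $\gamma$ is an ellipse.
   Context: $[u,v]$ denotes the determinant of the vectors $u,v\in\mathbb{R}^2$. An element $A$ has order $k$ if $k$ is the least positive integer with $A^k=I$. Let $\gamma(t)$ be a regular, positively oriented parametrization. Outer billiard map: each point $x$ in the exterior of $\gamma$ can be uniquely written as $x=\gamma(t)+\lambda\dot\gamma(t)=\gamma(t_1)-\lambda_1\dot\gamma(t_1)$ with $\lambda,\lambda_1>0$. Using $(t,\lambda)$ as coordinates, the exterior of $\gamma$ is an (infinite) cylinder, and the Outer billiard map is $T(t,\lambda)=(t_1,\lambda_1)$; geometrically, $x$ is reflected through the right (as seen from $x$) tangency point $\gamma(t_1)$. Symplectic billiard map: three points of $\gamma$ are consecutive points $\gamma(t_1),\gamma(t_2),\gamma(t_3)$ of an orbit if and only if the tangent to $\gamma$ at $\gamma(t_2)$ is parallel to the segment connecting $\gamma(t_1)$ and $\gamma(t_3)$. This is the twist map with generating function $S(t,t_1)=[\gamma(t),\gamma(t_1)]$, i.e. $T(t,s)=(t_1,s_1)$ if and only if $s=-[\dot\gamma(t),\gamma(t_1)]$ and $s_1=[\gamma(t),\dot\gamma(t_1)]$.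 The phase space is the cylinder of ordered pairs $(t,t_1)$ for which the twist condition holds, namely $[\dot\gamma(t),\dot\gamma(t_1)]>0$; it has coordinates $(t,s)$. A rotational invariant curve is a simple closed curve in the phase cylinder, homotopically non-trivial (winding once around the cylinder), that is mapped to itself by $T$. Its rotation number is the rotation number of the circle map $T$ induces on it, where one full turn around $\gamma$ counts as $1$ and each step advances the base point $t$ by a positive amount less than one turn. $T$ is totally integrable in an open subset $U$ of the phase cylinder if $U$ admits a $C^1$ foliation by rotational invariant curves of $T$. *)

theory Defs
  imports "HOL-Analysis.Analysis"
begin

section \<open>Planar linear algebra\<close>

definition bracket :: "real^2 \<Rightarrow> real^2 \<Rightarrow> real"
  where "bracket u v = det (vector [u, v] :: real^2^2)"

text \<open>The operations \<open>*\<close> and \<open>^\<close> on the type of square matrices are componentwise, so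
  matrix powers are iterated matrix products.\<close>

definition matrix_pow :: "real^2^2 \<Rightarrow> nat \<Rightarrow> real^2^2"
  where "matrix_pow A n = (((**) A) ^^ n) (mat 1)"

definition has_matrix_order :: "real^2^2 \<Rightarrow> nat \<Rightarrow> bool"
  where "has_matrix_order A k \<longleftrightarrow>
    0 < k \<and> matrix_pow A k = mat 1 \<and> (\<forall>j. 0 < j \<and> j < k \<longrightarrow> matrix_pow A j \<noteq> mat 1)"

text \<open>An ellipse with centre \<open>c\<close>, orthonormal axis directions \<open>u\<close>, \<open>v\<close> and semi-axes \<open>a\<close>, \<open>b\<close>;
  circles are included.\<close>

definition is_ellipse :: "(real^2) set \<Rightarrow> bool"
  where "is_ellipse E \<longleftrightarrow>
    (\<exists>c u v a b. norm u = 1 \<and> norm v = 1 \<and> u \<bullet> v = 0 \<and> 0 < a \<and> 0 < b \<and>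
      E = {x. (((x - c) \<bullet> u) / a)\<^sup>2 + (((x - c) \<bullet> v) / b)\<^sup>2 = 1})"


section \<open>Strictly convex closed curves\<close>

definition strictly_convex :: "'a::real_normed_vector set \<Rightarrow> bool"
  where "strictly_convex K \<longleftrightarrow>
    (\<forall>x\<in>K. \<forall>y\<in>K. x \<noteq> y \<longrightarrow> open_segment x y \<subseteq> interior K)"

abbreviation velocity :: "(real \<Rightarrow> real^2) \<Rightarrow> real \<Rightarrow> real^2"
  where "velocity \<gamma> t \<equiv> vector_derivative \<gamma> (at t)"

text \<open>\<open>\<gamma>\<close> is a regular \<open>P\<close>-periodic parametrization, defined on the whole line, of a \<open>C\<^sup>2\<close> simple
  closed curve bounding a strictly convex region, with that region to the left of the velocity.
  No lower bound on the curvature is assumed.\<close>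

definition strictly_convex_C2_curve :: "(real \<Rightarrow> real^2) \<Rightarrow> real \<Rightarrow> bool"
  where "strictly_convex_C2_curve \<gamma> P \<longleftrightarrow>
    0 < P \<and> (\<forall>t. \<gamma> (t + P) = \<gamma> t) \<and> inj_on \<gamma> {0..<P} \<and>
    \<gamma> C1_differentiable_on UNIV \<and> velocity \<gamma> C1_differentiable_on UNIV \<and>
    (\<forall>t. velocity \<gamma> t \<noteq> 0) \<and>
    (\<exists>K. compact K \<and> interior K \<noteq> {} \<and> strictly_convex K \<and> frontier K = range \<gamma> \<and>
      (\<forall>t. \<forall>z\<in>interior K. bracket (velocity \<gamma> t) (z - \<gamma> t) > 0))"


section \<open>Outer and symplectic billiards\<close>

text \<open>The phase cylinders and the maps are given on the universal cover: a point of the cylinder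
  is represented by \<open>(t, y)\<close> with \<open>t\<close> real, up to \<open>(t, y) \<sim> (t + P, y)\<close>, and subsets of the
  cylinder by their full (\<open>P\<close>-periodic) preimages. The lift of each map is the one that moves \<open>t\<close>
  forward by a positive amount less than one turn \<open>P\<close>.\<close>

definition outer_phase :: "(real \<times> real) set"
  where "outer_phase = {(t, l). 0 < l}"

definition outer_billiard :: "(real \<Rightarrow> real^2) \<Rightarrow> real \<Rightarrow> real \<times> real \<Rightarrow> real \<times> real"
  where "outer_billiard \<gamma> P = (\<lambda>(t, l). THE (t\<^sub>1, l\<^sub>1).
    t < t\<^sub>1 \<and> t\<^sub>1 < t + P \<and> 0 < l\<^sub>1 \<and>
    \<gamma> t + l *\<^sub>R velocity \<gamma> t = \<gamma> t\<^sub>1 - l\<^sub>1 *\<^sub>R velocity \<gamma> t\<^sub>1)"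

definition symplectic_phase :: "(real \<Rightarrow> real^2) \<Rightarrow> real \<Rightarrow> (real \<times> real) set"
  where "symplectic_phase \<gamma> P = {(t, s). \<exists>t\<^sub>1. t < t\<^sub>1 \<and> t\<^sub>1 < t + P \<and>
    bracket (velocity \<gamma> t) (velocity \<gamma> t\<^sub>1) > 0 \<and> s = - bracket (velocity \<gamma> t) (\<gamma> t\<^sub>1)}"

definition symplectic_billiard :: "(real \<Rightarrow> real^2) \<Rightarrow> real \<Rightarrow> real \<times> real \<Rightarrow> real \<times> real"
  where "symplectic_billiard \<gamma> P = (\<lambda>(t, s). THE (t\<^sub>1, s\<^sub>1).
    t < t\<^sub>1 \<and> t\<^sub>1 < t + P \<and> bracket (velocity \<gamma> t) (velocity \<gamma> t\<^sub>1) > 0 \<and>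
    s = - bracket (velocity \<gamma> t) (\<gamma> t\<^sub>1) \<and> s\<^sub>1 = bracket (\<gamma> t) (velocity \<gamma> t\<^sub>1))"


section \<open>Rotational invariant curves\<close>

text \<open>Lift of a parametrization of a simple closed curve winding once around the cylinder.
  Because of the periodicity, injectivity of the lift is equivalent to the closed curve in the
  cylinder being simple. The orientation can be chosen so that it winds in the direction of
  increasing \<open>t\<close>.\<close>

definition rotational_param :: "real \<Rightarrow> (real \<Rightarrow> real \<times> real) \<Rightarrow> bool"
  where "rotational_param P c \<longleftrightarrow>
    continuous_on UNIV c \<and> inj c \<and> (\<forall>u. c (u + 1) = c u + (P, 0))"

definition rotational_invariant_curve ::
    "real \<Rightarrow> (real \<times> real) set \<Rightarrow> (real \<times> real \<Rightarrow> real \<times> real) \<Rightarrow> (real \<times> real) set \<Rightarrow> bool"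
  where "rotational_invariant_curve P M T C \<longleftrightarrow>
    C \<subseteq> M \<and> (\<exists>c. rotational_param P c \<and> range c = C) \<and> T ` C = C"

text \<open>Rotation number of the circle map induced on \<open>C\<close>: \<open>f\<close> is the lift of that circle map, of
  degree one, which is determined by the chosen lift of \<open>T\<close>. The number is thus a real number,
  not just a class modulo \<open>1\<close>.\<close>

definition has_rotation_number ::
    "real \<Rightarrow> (real \<times> real \<Rightarrow> real \<times> real) \<Rightarrow> (real \<times> real) set \<Rightarrow> real \<Rightarrow> bool"
  where "has_rotation_number P T C \<rho> \<longleftrightarrow>
    (\<exists>c f. rotational_param P c \<and> range c = C \<and>
      continuous_on UNIV f \<and> (\<forall>u. f (u + 1) = f u + 1) \<and> (\<forall>u. T (c u) = c (f u)) \<and>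
      (\<forall>u. (\<lambda>n. (f ^^ n) u / real n) \<longlonglongrightarrow> \<rho>))"


section \<open>Total integrability\<close>

definition C1_on :: "('a::real_normed_vector \<Rightarrow> 'b::real_normed_vector) \<Rightarrow> 'a set \<Rightarrow> bool"
  where "C1_on g V \<longleftrightarrow>
    (\<exists>g' :: 'a \<Rightarrow> 'a \<Rightarrow>\<^sub>L 'b.
      (\<forall>z\<in>V. (g has_derivative blinfun_apply (g' z)) (at z)) \<and> continuous_on V g')"

abbreviation unit_box :: "(real \<times> real) set"
  where "unit_box \<equiv> {-1<..<1} \<times> {-1<..<1}"

text \<open>One-dimensional \<open>C\<^sup>1\<close> foliation of an open set: a partition into leaves with \<open>C\<^sup>1\<close>
  charts onto a square in which the connected components of the leaves are the horizontal lines.\<close>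

definition C1_foliation :: "(real \<times> real) set \<Rightarrow> (real \<times> real) set set \<Rightarrow> bool"
  where "C1_foliation U \<F> \<longleftrightarrow>
    \<Union>\<F> = U \<and> pairwise disjnt \<F> \<and>
    (\<forall>z\<in>U. \<exists>V \<phi> \<psi>. z \<in> V \<and> open V \<and> V \<subseteq> U \<and>
      homeomorphism V unit_box \<phi> \<psi> \<and> C1_on \<phi> V \<and> C1_on \<psi> unit_box \<and>
      (\<forall>L\<in>\<F>. \<forall>K\<in>components (L \<inter> V). \<exists>h. \<phi> ` K = {-1<..<1} \<times> {h}))"

definition totally_integrable ::
    "real \<Rightarrow> (real \<times> real) set \<Rightarrow> (real \<times> real \<Rightarrow> real \<times> real) \<Rightarrow> (real \<times> real) set \<Rightarrow> bool"
  where "totally_integrable P M T U \<longleftrightarrow>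
    open U \<and> U \<subseteq> M \<and>
    (\<exists>\<F>. C1_foliation U \<F> \<and> (\<forall>L\<in>\<F>. rotational_invariant_curve P M T L))"

end

theory Submission
  imports Defs
begin

text \<open>Both billiards act on the same space of pairs \<open>(t, t\<^sub>1)\<close> of consecutive base points with
  \<open>[\<gamma>'(t), \<gamma>'(t\<^sub>1)] > 0\<close>. Such a pair has an outgoing coordinate \<open>\<alpha>(t, t\<^sub>1)\<close>, attached to \<open>t\<close>, and an
  incoming coordinate \<open>\<beta>(t, t\<^sub>1)\<close>, attached to \<open>t\<^sub>1\<close>; a sequence of base points is an orbit iff
  \<open>\<beta>(t\<^sub>0, t\<^sub>1) = \<alpha>(t\<^sub>1, t\<^sub>2)\<close> along it. The twist makes \<open>\<alpha>\<close> monotone in \<open>t\<^sub>1\<close> and \<open>\<beta>\<close> monotone in \<open>t\<close> in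
  the opposite sense, so two orbits that touch at one index cross there or coincide.

  The rotation number yields a point of \<open>C\<close> that returns to itself after \<open>k\<close> steps and \<open>r\<close> turns. Let
  \<open>L\<close> be the leaf of the foliation through it. The proof has three steps.

  First, every point of \<open>L\<close> returns after \<open>k\<close> steps and \<open>r\<close> turns (\<open>return_map_identity\<close>). Both
  billiards preserve an area \<open>\<rho> dt dy\<close>: \<open>\<rho> = 1\<close> in the symplectic case and \<open>\<rho> = y |[\<gamma>', \<gamma>'']|\<close> in the
  outer case, where it is the area of the plane. If some point of \<open>L\<close> did not return, an arc of
  \<open>L\<close> would be attracted to a returning point. Near that point the squared return map sends each
  plaque of the foliation into itself (\<open>square_preserves_heights\<close>), so it maps a thin strip along
  the arc to a strip of the same height along a shorter arc. As the height tends to zero, the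
  conservation of area shows that \<open>\<rho>\<close> vanishes on the arc (\<open>lost_arc_massless\<close>), and likewise on its
  image under the billiard map. A strictly convex curve is not flat along any arc, so the base
  point would be constant along both arcs, whereas the two base points determine the phase point.

  Second, the billiard map on \<open>L\<close> is a symmetry of the curve (\<open>symmetry_is_dynamics\<close>). Sliding
  along \<open>L\<close> until two periodic orbits touch shows that every orbit of period \<open>k\<close> with \<open>r\<close> turns lies
  on \<open>L\<close> and that orbits on \<open>L\<close> are ordered by their base points (\<open>periodic_orbit_on_curve\<close>); in
  particular \<open>L\<close> is a graph. A power \<open>B\<close> of \<open>A\<close> lifts to a map \<open>\<sigma>\<close> of the parameter whose \<open>k\<close>-th
  iterate makes \<open>r\<close> turns. It sends the orbit of a point of \<open>L\<close> to another orbit on \<open>L\<close>, which can be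
  neither ahead of nor behind the orbit of the next point, since both close up after \<open>k\<close> steps. Hence
  the orbit of the base point \<open>t\<close> is \<open>t, \<sigma>(t), \<sigma>(\<sigma>(t)), \<dots>\<close>.

  Third, for this orbit the equation \<open>\<beta> = \<alpha>\<close> says in both cases that \<open>[\<gamma>, B \<gamma>]\<close> has zero derivative.
  The quadratic form \<open>[x, B x]\<close> vanishes only on eigenvectors of \<open>B\<close>. There are none, because \<open>B\<close> has
  finite order and is not an involution. So the form is definite, and the closed convex curve
  \<open>\<gamma>\<close>, lying on one of its level sets, is that ellipse.\<close>

section \<open>Lifts of circle maps\<close>

lemma strict_mono_finite_order:
  fixes h :: "real \<Rightarrow> real"
  assumes h: "strict_mono h" and d: "0 < d" "(h ^^ d) t = t"
  shows "h t = t"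
proof (rule ccontr)
  assume "h t \<noteq> t"
  then consider "t < h t" | "h t < t" by linarith
  then show False
  proof cases
    case 1
    have "t < (h ^^ Suc n) t" for n
    proof (induction n)
      case (Suc n)
      have "h t < h ((h ^^ Suc n) t)" using Suc h by (simp add: strict_mono_less del: funpow.simps)
      then show ?case using 1 by simp
    qed (use 1 in simp)
    from this[of "d - 1"] show False using d by simp
  next
    case 2
    have "(h ^^ Suc n) t < t" for n
    proof (induction n)
      case (Suc n)
      have "h ((h ^^ Suc n) t) < h t" using Suc h by (simp add: strict_mono_less del: funpow.simps)
      then show ?case using 2 by simp
    qed (use 2 in simp)
    from this[of "d - 1"] show False using d by simp
  qed
qed

lemma shift_commute:
  fixes h :: "real \<Rightarrow> real" assumes "\<And>t. h (t + P) = h t + P"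
  shows "h (t + of_int n * P) = h t + of_int n * P"
proof (induction n rule: int_induct[where k=0])
  case (step1 i) then show ?case using assms[of "t + of_int i * P"] by (simp add: algebra_simps)
next
  case (step2 i) then show ?case using assms[of "t + of_int (i - 1) * P"] by (simp add: algebra_simps)
qed simp

lemma strict_mono_funpow: "strict_mono h \<Longrightarrow> strict_mono (h ^^ n)" for h :: "real \<Rightarrow> real"
  by (induction n) (auto simp: strict_mono_def)

lemma funpow_shift:
  fixes h :: "real \<Rightarrow> real" assumes "\<And>t. h (t + P) = h t + P"
  shows "(h ^^ n) (t + P) = (h ^^ n) t + P"
  by (induction n) (auto simp: assms)

lemma continuous_strict_mono_of_inj:
  fixes f :: "real \<Rightarrow> real"
  assumes "continuous_on UNIV f" "inj f" "\<And>u. f (u + 1) = f u + 1"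
  shows "strict_mono f"
proof -
  have "strict_mono_on UNIV f \<or> strict_antimono_on UNIV f"
    using injective_eq_monotone_map[of UNIV f] assms by auto
  moreover have "\<not> strict_antimono_on UNIV f"
    using assms(3)[of 0] monotone_onD[of UNIV "(<)" "(>)" f 0 1] by auto
  ultimately show ?thesis by blast
qed

lemma continuous_on_funpow:
  fixes h :: "real \<Rightarrow> real" assumes "continuous_on UNIV h" shows "continuous_on UNIV (h ^^ n)"
proof (induction n)
  case (Suc n)
  show ?case unfolding funpow.simps
    by (rule continuous_on_compose[OF Suc continuous_on_subset[OF assms]]) simp
qed (simp add: id_def)

section \<open>Change of variables in the plane\<close>

text \<open>The Jacobian determinant of a linear map of \<open>real \<times> real\<close>, the plane in which the phase cylinder
  is unrolled. The isometry \<open>to_vec\<close> onto \<open>real^2\<close> carries over the change of variables formula.\<close>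

definition jac :: "(real \<times> real \<Rightarrow> real \<times> real) \<Rightarrow> real"
  where "jac l = fst (l (1,0)) * snd (l (0,1)) - fst (l (0,1)) * snd (l (1,0))"

definition to_vec :: "real \<times> real \<Rightarrow> real^2" where "to_vec p = vector [fst p, snd p]"
definition of_vec :: "real^2 \<Rightarrow> real \<times> real" where "of_vec v = (v $ 1, v $ 2)"

lemma of_vec_to_vec [simp]: "of_vec (to_vec p) = p"
  by (simp add: of_vec_def to_vec_def)

lemma bounded_linear_of_vec: "bounded_linear of_vec"
  unfolding of_vec_def by (intro bounded_linear_Pair bounded_linear_vec_nth)

lemma linear_to_vec: "linear to_vec"
  by (rule linearI) (simp_all add: to_vec_def vec_eq_iff forall_2)

lemma bounded_linear_to_vec: "bounded_linear to_vec"
  using linear_to_vec by (simp add: linear_conv_bounded_linear)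

lemma continuous_on_to_vec [continuous_intros]:
  "continuous_on S f \<Longrightarrow> continuous_on S (\<lambda>x. to_vec (f x))"
  by (rule bounded_linear.continuous_on [OF bounded_linear_to_vec])

lemma continuous_on_of_vec [continuous_intros]:
  "continuous_on S f \<Longrightarrow> continuous_on S (\<lambda>x. of_vec (f x))"
  by (rule bounded_linear.continuous_on [OF bounded_linear_of_vec])

lemma borel_measurable_to_vec [measurable]: "to_vec \<in> borel_measurable borel"
  by (intro borel_measurable_continuous_onI continuous_on_to_vec continuous_on_id)

lemma lborel_to_vec: "(lborel :: (real^2) measure) = distr lborel borel to_vec"
proof (rule lborel_eqI)
  fix l u :: "real^2"
  assume lu: "\<And>b. b \<in> Basis \<Longrightarrow> l \<bullet> b \<le> u \<bullet> b"
  have vim: "to_vec -` box l u = box (of_vec l) (of_vec u)"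
    by (auto simp: mem_box_cart forall_2 to_vec_def of_vec_def mem_box Basis_prod_def)
  have le: "l $ i \<le> u $ i" for i
    using lu[of "axis i 1"] by (simp add: inner_axis)
  have "emeasure (distr lborel borel to_vec) (box l u) = emeasure lborel (box (of_vec l) (of_vec u))"
    by (subst emeasure_distr) (auto simp: vim)
  also have "\<dots> = ennreal (\<Prod>b\<in>Basis. (of_vec u - of_vec l) \<bullet> b)"
    by (rule emeasure_lborel_box) (auto simp: Basis_prod_def of_vec_def le)
  also have "(\<Prod>b\<in>Basis. (of_vec u - of_vec l) \<bullet> b) = (u$1 - l$1) * (u$2 - l$2)"
  proof -
     have "(Basis :: (real \<times> real) set) = {(1,0), (0,1)}" by (auto simp: Basis_prod_def)
    then have "(\<Prod>b\<in>Basis. (of_vec u - of_vec l) \<bullet> b) = (\<Prod>b\<in>{(1,0), (0,1)}. (of_vec u - of_vec l) \<bullet> b)"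
      by (rule arg_cong)
    then show ?thesis by (simp add: of_vec_def)
  qed
  also have "\<dots> = (\<Prod>b\<in>Basis. (u - l) \<bullet> b)"
  proof -
    have "(Basis :: (real^2) set) = {axis 1 1, axis 2 1}"
      by (auto simp: Basis_vec_def) (metis exhaust_2)
    then have "(\<Prod>b\<in>Basis. (u - l) \<bullet> b) = (\<Prod>b\<in>{axis 1 1, axis 2 1}. (u - l) \<bullet> b)"
      by (rule arg_cong)
    moreover have "axis 1 (1::real) \<noteq> (axis 2 1 :: real^2)" by (simp add: axis_eq_axis)
    ultimately show ?thesis by (simp add: inner_axis)
  qed
  finally show "emeasure (distr lborel borel to_vec) (box l u) = (\<Prod>b\<in>Basis. (u - l) \<bullet> b)" .
qed (simp)

lemma integral_to_vec:
  fixes f :: "real \<times> real \<Rightarrow> real"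
  assumes S: "compact S" and f: "continuous_on S f"
  shows "integral (to_vec ` S) (f \<circ> of_vec) = integral S f"
    and "(f \<circ> of_vec) absolutely_integrable_on (to_vec ` S)"
proof -
  have cS: "compact (to_vec ` S)" by (intro compact_continuous_image S continuous_intros)
  have cf: "continuous_on (to_vec ` S) (f \<circ> of_vec)"
    by (rule continuous_on_compose) (auto intro!: continuous_intros f simp: image_image)
  have i1: "set_integrable lborel S f" 
    unfolding set_integrable_def using borel_integrable_compact[OF S f] by simp
  have i2: "set_integrable lborel (to_vec ` S) (f \<circ> of_vec)" 
    unfolding set_integrable_def using borel_integrable_compact[OF cS cf] by simp
  have "integral (to_vec ` S) (f \<circ> of_vec) = (LINT v:to_vec ` S|lborel. (f \<circ> of_vec) v)"
    using set_borel_integral_eq_integral(2)[OF i2] by simp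
  also have "\<dots> = (LINT v|distr lborel borel to_vec. indicator (to_vec ` S) v *\<^sub>R (f \<circ> of_vec) v)"
    unfolding set_lebesgue_integral_def by (subst lborel_to_vec) simp
  also have "\<dots> = (LINT p|lborel. indicator (to_vec ` S) (to_vec p) *\<^sub>R (f \<circ> of_vec) (to_vec p))"
    using i2 unfolding set_integrable_def
    by (intro integral_distr) auto
  also have "\<dots> = (LINT p|lborel. indicator S p *\<^sub>R f p)"
    by (rule Bochner_Integration.integral_cong) (auto simp: indicator_def, metis of_vec_to_vec)
  also have "\<dots> = integral S f"
    using set_borel_integral_eq_integral(2)[OF i1] by (simp add: set_lebesgue_integral_def)
  finally show "integral (to_vec ` S) (f \<circ> of_vec) = integral S f" .
  show "(f \<circ> of_vec) absolutely_integrable_on (to_vec ` S)"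
    using i2 absolutely_integrable_on_iff_nonneg
    by (metis (no_types, lifting) i2 integrable_completion set_integrable_def borel_measurable_integrable lborel_def)
qed

lemma integral_image_plane:
  fixes g :: "real \<times> real \<Rightarrow> real \<times> real" and \<rho> :: "real \<times> real \<Rightarrow> real"
  assumes S: "compact S" and der: "\<And>z. z \<in> S \<Longrightarrow> (g has_derivative g' z) (at z within S)"
    and inj: "inj_on g S" and \<rho>: "continuous_on (g ` S) \<rho>"
    and j: "continuous_on S (\<lambda>z. \<bar>jac (g' z)\<bar> * \<rho> (g z))"
  shows "integral (g ` S) \<rho> = integral S (\<lambda>z. \<bar>jac (g' z)\<bar> * \<rho> (g z))"
proof -
  define S2 where "S2 = to_vec ` S"
  define G where "G = to_vec \<circ> g \<circ> of_vec"
  define G' where "G' = (\<lambda>v. to_vec \<circ> g' (of_vec v) \<circ> of_vec)"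
  have cgS: "compact (g ` S)"
    by (rule compact_continuous_image[OF has_derivative_continuous_on S]) (rule der)
  have GS: "G ` S2 = to_vec ` (g ` S)" by (auto simp: G_def S2_def image_image)
  have ofS: "of_vec ` S2 = S" by (auto simp: S2_def image_image)
  have S2c: "compact S2" unfolding S2_def by (intro compact_continuous_image S continuous_intros)
  have dG: "(G has_derivative G' v) (at v within S2)" if "v \<in> S2" for v
  proof -
    have "(of_vec has_derivative of_vec) (at v within S2)"
      by (intro bounded_linear_imp_has_derivative bounded_linear_of_vec)
    moreover have "(g has_derivative g' (of_vec v)) (at (of_vec v) within of_vec ` S2)"
      unfolding ofS using that ofS by (intro der) auto
    ultimately have 1: "((g \<circ> of_vec) has_derivative (g' (of_vec v) \<circ> of_vec)) (at v within S2)"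
      by (rule diff_chain_within)
    show ?thesis unfolding G_def G'_def 
      using bounded_linear.has_derivative[OF bounded_linear_to_vec 1] by (simp add: o_def)
  qed
  have jd: "det (matrix (G' v)) = jac (g' (of_vec v))" for v
  proof -
    have a: "of_vec (axis 1 1) = (1,0)" "of_vec (axis 2 1) = (0,1)" by (auto simp: of_vec_def axis_def)
    show ?thesis by (simp add: det_2 matrix_def G'_def a jac_def to_vec_def)
  qed
  have injG: "inj_on G S2"
    using inj by (auto simp: inj_on_def G_def S2_def) (metis of_vec_to_vec)
  have "integral (g ` S) \<rho> = integral (G ` S2) (\<rho> \<circ> of_vec)"
    unfolding GS using integral_to_vec(1)[OF cgS \<rho>] by simp
  also have "\<dots> = integral S2 (\<lambda>v. \<bar>det (matrix (G' v))\<bar> * (\<rho> \<circ> of_vec) (G v))"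
  proof -
    define F :: "real^2 \<Rightarrow> real^1" where "F = (\<lambda>v. vec ((\<rho> \<circ> of_vec) v))"
    have "F absolutely_integrable_on (G ` S2)"
      unfolding F_def absolutely_integrable_on_1_iff
      using integral_to_vec(2)[OF cgS \<rho>] by (simp add: GS o_def)
    then have e: "integral (G ` S2) F = integral S2 (\<lambda>x. \<bar>det (matrix (G' x))\<bar> *\<^sub>R F (G x))"
      using integral_change_of_variables[OF _ dG injG, of F] compact_imp_closed[OF S2c]
      by (auto simp: lmeasurable_compact S2c fmeasurableD)
    have abs2: "(\<lambda>x. \<bar>det (matrix (G' x))\<bar> *\<^sub>R F (G x)) absolutely_integrable_on S2"
      using has_absolute_integral_change_of_variables[OF _ dG injG, of F]
        \<open>F absolutely_integrable_on (G ` S2)\<close> by (auto simp: lmeasurable_compact S2c fmeasurableD)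
    have "integral (G ` S2) (\<rho> \<circ> of_vec) = integral (G ` S2) F $ 1"
      using \<open>F absolutely_integrable_on (G ` S2)\<close>
      by (simp add: F_def integral_on_1_eq o_def)
    then show ?thesis using e by (simp add: F_def integral_on_1_eq)
  qed
  also have "\<dots> = integral S2 ((\<lambda>z. \<bar>jac (g' z)\<bar> * \<rho> (g z)) \<circ> of_vec)"
    by (simp add: jd G_def o_def)
  also have "\<dots> = integral S (\<lambda>z. \<bar>jac (g' z)\<bar> * \<rho> (g z))"
    unfolding S2_def by (rule integral_to_vec(1)[OF S j])
  finally show ?thesis .
qed

section \<open>Rotational curves and flow boxes\<close>

lemma rotational_param_shift:
  assumes "rotational_param P c"
  shows "c (u + of_int n) = c u + (of_int n * P, 0)"
proof (induction n rule: int_induct[where k=0])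
  case base then show ?case by (simp add: prod_eq_iff)
next
  case (step1 i)
  have "c (u + of_int (i + 1)) = c (u + of_int i + 1)" by (simp add: algebra_simps)
  also have "\<dots> = c (u + of_int i) + (P, 0)" using assms by (simp add: rotational_param_def)
  finally show ?case using step1 by (simp add: algebra_simps prod_eq_iff)
next
  case (step2 i)
  have "c (u + of_int i) = c (u + of_int (i - 1) + 1)" by (simp add: algebra_simps)
  also have "\<dots> = c (u + of_int (i - 1)) + (P, 0)" using assms unfolding rotational_param_def by blast
  finally show ?case using step2 by (simp add: algebra_simps prod_eq_iff)
qed

lemma rotational_param_bounded:
  assumes "rotational_param P c"
  obtains B where "\<And>u. \<bar>fst (c u) - P * u\<bar> \<le> B"
proof -
  let ?h = "\<lambda>u. fst (c u) - P * u"
  have "continuous_on {0..1} ?h"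
    using assms unfolding rotational_param_def
    by (auto intro!: continuous_intros elim: continuous_on_subset)
  then have "bounded (?h ` {0..1})"
    by (intro compact_imp_bounded compact_continuous_image) auto
  then obtain B where "\<forall>u\<in>{0..1}. \<bar>?h u\<bar> \<le> B"
    by (auto simp: bounded_iff)
  then have B: "\<And>u. u \<in> {0..1} \<Longrightarrow> \<bar>?h u\<bar> \<le> B" by blast
  have "\<bar>?h u\<bar> \<le> B" for u
  proof -
    have "c u = c (frac u) + (of_int \<lfloor>u\<rfloor> * P, 0)"
      using rotational_param_shift[OF assms, of "frac u" "\<lfloor>u\<rfloor>"] by (simp add: frac_def)
    then have "?h u = ?h (frac u)" by (simp add: frac_def algebra_simps)
    then show ?thesis using B[of "frac u"] frac_lt_1[of u] by simp
  qed
  then show ?thesis by (rule that)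
qed

lemma rotational_param_preimage_bounded:
  assumes "0 < P" "rotational_param P c"
  obtains N where "\<And>v. \<bar>fst (c v) - x\<bar> \<le> 1 \<Longrightarrow> v \<in> {-N..N}"
proof -
  obtain B where B: "\<And>u. \<bar>fst (c u) - P * u\<bar> \<le> B"
    using rotational_param_bounded[OF assms(2)] by blast
  have "v \<in> {- ((B + 1 + \<bar>x\<bar>) / P)..(B + 1 + \<bar>x\<bar>) / P}" if "\<bar>fst (c v) - x\<bar> \<le> 1" for v
  proof -
    have "\<bar>P * v\<bar> \<le> B + 1 + \<bar>x\<bar>" using B[of v] that by linarith
    then have "\<bar>v\<bar> \<le> (B + 1 + \<bar>x\<bar>) / P"
      using assms(1) by (simp add: abs_mult field_simps)
    then show ?thesis by auto
  qed
  then show ?thesis by (rule that)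
qed

text \<open>A rotational curve escapes to infinity at both ends of its lift, so the lift is a closed embedding
  of the line.\<close>

lemma rotational_param_tendsto:
  fixes w :: "'i \<Rightarrow> real"
  assumes P: "0 < P" and c: "rotational_param P c" and lim: "((\<lambda>n. c (w n)) \<longlongrightarrow> c u) F"
  shows "(w \<longlongrightarrow> u) F"
proof -
  obtain N where N: "\<And>v. \<bar>fst (c v) - fst (c u)\<bar> \<le> 1 \<Longrightarrow> v \<in> {-N..N}"
    using rotational_param_preimage_bounded[OF P c] by blast
  have inj: "inj_on c {-N..N}" and con: "continuous_on {-N..N} c"
    using c unfolding rotational_param_def
    by (metis inj_on_subset subset_UNIV, metis continuous_on_subset subset_UNIV)
  have "u \<in> {-N..N}" using N[of u] by simp
  have "((\<lambda>n. fst (c (w n))) \<longlongrightarrow> fst (c u)) F" by (intro tendsto_fst lim)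
  then have "\<forall>\<^sub>F n in F. dist (fst (c (w n))) (fst (c u)) < 1"
    by (rule tendstoD) simp
  then have ev: "\<forall>\<^sub>F n in F. w n \<in> {-N..N}"
    by eventually_elim (rule N, simp add: dist_real_def)
  have cinv: "continuous_on (c ` {-N..N}) (inv_into {-N..N} c)"
    by (rule continuous_on_inv[OF con]) (auto simp: inv_into_f_f[OF inj])
  define g where "g = inv_into {-N..N} c"
  have cinv': "continuous_on (c ` {-N..N}) g" using cinv by (simp only: g_def)
  have gc: "g (c v) = v" if "v \<in> {-N..N}" for v
    unfolding g_def by (rule inv_into_f_f[OF inj that])
  have ev': "\<forall>\<^sub>F n in F. c (w n) \<in> c ` {-N..N}"
    using ev by eventually_elim (rule imageI)
  have "((\<lambda>n. g (c (w n))) \<longlongrightarrow> g (c u)) F"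
    by (rule continuous_on_tendsto_compose[OF cinv' lim imageI[OF \<open>u \<in> {-N..N}\<close>] ev'])
  then have lim': "((\<lambda>n. g (c (w n))) \<longlongrightarrow> u) F"
    by (simp only: gc[OF \<open>u \<in> {-N..N}\<close>])
  have "\<forall>\<^sub>F n in F. g (c (w n)) = w n"
    using ev by eventually_elim (rule gc)
  from tendsto_cong[OF this] lim' show ?thesis by (rule iffD1)
qed

lemma rotational_param_closed:
  assumes P: "0 < P" and c: "rotational_param P c"
  shows "closed (range c)"
  unfolding closed_sequential_limits
proof (intro allI impI, elim conjE)
  fix z l assume z: "\<forall>n. z n \<in> range c" and lim: "z \<longlonglongrightarrow> l"
  have "\<forall>n. \<exists>u. z n = c u" using z by auto
  then obtain w where w: "\<And>n. z n = c (w n)" using choice by metis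
  obtain N where N: "\<And>v. \<bar>fst (c v) - fst l\<bar> \<le> 1 \<Longrightarrow> v \<in> {-N..N}"
    using rotational_param_preimage_bounded[OF P c] by blast
  have "(\<lambda>n. fst (z n)) \<longlonglongrightarrow> fst l" by (intro tendsto_fst lim)
  then have "\<forall>\<^sub>F n in sequentially. dist (fst (z n)) (fst l) < 1"
    by (rule tendstoD) simp
  then have ev: "\<forall>\<^sub>F n in sequentially. z n \<in> c ` {-N..N}"
    by eventually_elim (auto simp: w dist_real_def intro!: imageI N)
  have "compact (c ` {-N..N})"
    using c unfolding rotational_param_def
    by (intro compact_continuous_image) (auto elim: continuous_on_subset)
  then have "l \<in> c ` {-N..N}"
    using Lim_in_closed_set[OF compact_imp_closed ev _ lim] by simp
  then show "l \<in> range c" by blast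
qed

text \<open>If \<open>\<tau>\<close> moved \<open>h\<close>, then iterating \<open>\<tau>\<close> forwards or backwards from \<open>h\<close> would give a strictly
  decreasing sequence in one class of \<open>E\<close> that is bounded by the fixed point \<open>a\<close>; its limit would
  contradict the isolation. This controls the permutation of plaques induced on a transversal.\<close>

lemma strictly_increasing_isolated_classes_identity:
  fixes \<tau> :: "real \<Rightarrow> real" and E :: "real \<Rightarrow> real \<Rightarrow> bool"
  assumes ab: "a \<le> h" and fix_a: "\<tau> a = a"
    and mono: "strict_mono_on {a..h} \<tau>" and cont: "continuous_on {a..h} \<tau>"
    and refl: "\<And>x. x \<in> {a..h} \<Longrightarrow> E x x"
    and E: "\<And>x. x \<in> {a..h} \<Longrightarrow> E x (\<tau> x)"
    and sym: "\<And>x y. E x y \<Longrightarrow> E y x" and trans: "\<And>x y z. E x y \<Longrightarrow> E y z \<Longrightarrow> E x z"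
    and isolated: "\<And>x l. (\<And>n. x n \<in> {a..h}) \<Longrightarrow> (\<And>n. E h (x n)) \<Longrightarrow> x \<longlonglongrightarrow> l \<Longrightarrow>
        \<forall>\<^sub>F n in sequentially. x n = l"
  shows "\<tau> h = h"
proof -
  have no_decreasing: False
    if x: "\<And>n. x n \<in> {a..h}" "\<And>n. E h (x n)" "\<And>n. x (Suc n) < x n" for x :: "nat \<Rightarrow> real"
  proof -
    have dec: "decseq x" using x(3) by (intro decseq_SucI) (simp add: less_imp_le)
    have lb: "\<forall>i. a \<le> x i" using x(1) by auto
    obtain l where l: "x \<longlonglongrightarrow> l"
      by (rule decseq_convergent[OF dec lb])
    have "\<forall>\<^sub>F n in sequentially. x n = l" by (rule isolated[OF x(1,2) l])
    then obtain n where n: "\<And>m. n \<le> m \<Longrightarrow> x m = l" unfolding eventually_sequentially by blast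
    have "x n = l" "x (Suc n) = l" by (rule n, simp)+
    then show False using x(3)[of n] by simp
  qed
  show ?thesis
  proof (rule antisym; rule ccontr)
    assume "\<not> \<tau> h \<le> h" then have gt: "h < \<tau> h" by simp
    have "\<exists>x. \<forall>n. (x n \<in> {a..h} \<and> E h (x n) \<and> x n < \<tau> (x n)) \<and> x (Suc n) < x n"
    proof (rule dependent_nat_choice)
      show "\<exists>x. x \<in> {a..h} \<and> E h x \<and> x < \<tau> x" using ab gt refl by auto
    next
      fix x n assume x: "x \<in> {a..h} \<and> E h x \<and> x < \<tau> x"
      have "\<exists>y\<ge>a. y \<le> x \<and> \<tau> y = x"
        by (rule IVT') (use x fix_a in \<open>auto intro: continuous_on_subset[OF cont]\<close>)
      then obtain y where y: "a \<le> y" "y \<le> x" "\<tau> y = x" by blast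
      have "y \<noteq> x" using x y(3) by auto
      then have "y < x" using y(2) by simp
      moreover have "E y x" using E[of y] y x by auto
      then have "E h y" using x sym trans by blast
      ultimately show "\<exists>y. (y \<in> {a..h} \<and> E h y \<and> y < \<tau> y) \<and> y < x" using y x by auto
    qed
    then obtain x where "\<forall>n. (x n \<in> {a..h} \<and> E h (x n) \<and> x n < \<tau> (x n)) \<and> x (Suc n) < x n" by blast
    then show False using no_decreasing[of x] by blast
  next
    assume "\<not> h \<le> \<tau> h" then have lt: "\<tau> h < h" by simp
    have "\<exists>x. \<forall>n. (x n \<in> {a..h} \<and> E h (x n) \<and> \<tau> (x n) < x n) \<and> x (Suc n) < x n"
    proof (rule dependent_nat_choice)
      show "\<exists>x. x \<in> {a..h} \<and> E h x \<and> \<tau> x < x" using ab lt refl by auto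
    next
      fix x n assume x: "x \<in> {a..h} \<and> E h x \<and> \<tau> x < x"
      have "a \<le> \<tau> x" using strict_mono_on_leD[OF mono, of a x] x fix_a by (simp del: strict_mono_on_leD)
      moreover have "\<tau> (\<tau> x) < \<tau> x"
        using strict_mono_onD[OF mono, of "\<tau> x" x] x \<open>a \<le> \<tau> x\<close> by auto
      moreover have "E x (\<tau> x)" using E[of x] x by blast
      then have "E h (\<tau> x)" using x trans by blast
      ultimately show "\<exists>y. (y \<in> {a..h} \<and> E h y \<and> \<tau> y < y) \<and> y < x" using x by auto
    qed
    then obtain x where "\<forall>n. (x n \<in> {a..h} \<and> E h (x n) \<and> \<tau> (x n) < x n) \<and> x (Suc n) < x n" by blast
    then show False using no_decreasing[of x] by blast
  qed
qed

text \<open>A chart \<open>\<phi>\<close>, with inverse \<open>\<psi>\<close>, in which the components of the leaves are horizontal. The second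
  coordinate of a plaque in the chart is called its height. Distinct heights may belong to the same leaf.\<close>

locale flow_box =
  fixes P :: real and U V :: "(real \<times> real) set" and \<F> :: "(real \<times> real) set set"
    and \<phi> \<psi> :: "real \<times> real \<Rightarrow> real \<times> real"
  assumes P: "0 < P"
    and Un: "\<Union>\<F> = U" and disj: "pairwise disjnt \<F>"
    and leaf: "\<And>L. L \<in> \<F> \<Longrightarrow> \<exists>c. rotational_param P c \<and> range c = L"
    and oU: "open U" and V: "open V" "V \<subseteq> U"
    and hom: "homeomorphism V unit_box \<phi> \<psi>"
    and comp: "\<And>L K. L \<in> \<F> \<Longrightarrow> K \<in> components (L \<inter> V) \<Longrightarrow> \<exists>h. \<phi> ` K = {-1<..<1} \<times> {h}"
begin

lemma psi_V: "p \<in> unit_box \<Longrightarrow> \<psi> p \<in> V" and phi_psi: "p \<in> unit_box \<Longrightarrow> \<phi> (\<psi> p) = p"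
  and phi_box: "z \<in> V \<Longrightarrow> \<phi> z \<in> unit_box" and psi_phi: "z \<in> V \<Longrightarrow> \<psi> (\<phi> z) = z"
  using hom unfolding homeomorphism_def by blast+

lemma cont_psi: "continuous_on unit_box \<psi>" and cont_phi: "continuous_on V \<phi>"
  using hom unfolding homeomorphism_def by blast+

lemma open_box: "open unit_box"
  by (intro open_Times) auto

lemma same_leaf:
  assumes "L \<in> \<F>" "L' \<in> \<F>" "z \<in> L" "z \<in> L'" shows "L = L'"
  using assms disj unfolding pairwise_def disjnt_def by blast

lemma leaf_exists: "z \<in> U \<Longrightarrow> \<exists>L\<in>\<F>. z \<in> L"
  using Un by blast

lemma connected_height:
  assumes L: "L \<in> \<F>" and S: "connected S" "S \<subseteq> L \<inter> V" and xy: "x \<in> S" "y \<in> S"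
  shows "snd (\<phi> x) = snd (\<phi> y)"
proof -
  let ?K = "connected_component_set (L \<inter> V) x"
  have "?K \<in> components (L \<inter> V)" using S xy by (auto simp: components_def)
  then obtain h where h: "\<phi> ` ?K = {-1<..<1} \<times> {h}" using comp[OF L] by blast
  have "S \<subseteq> ?K" by (rule connected_component_maximal) (use S xy in auto)
  then have "\<phi> x \<in> {-1<..<1} \<times> {h}" "\<phi> y \<in> {-1<..<1} \<times> {h}" using h xy by blast+
  then show ?thesis by auto
qed

lemma plaque_in_leaf:
  assumes L: "L \<in> \<F>" and "\<psi> (s, h) \<in> L" "(s, h) \<in> unit_box" "(s', h) \<in> unit_box"
  shows "\<psi> (s', h) \<in> L"
proof -
  let ?x = "\<psi> (s, h)"
  let ?K = "connected_component_set (L \<inter> V) ?x"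
  have x: "?x \<in> L \<inter> V" using assms psi_V by auto
  then have "?K \<in> components (L \<inter> V)" by (auto simp: components_def)
  then obtain h' where h: "\<phi> ` ?K = {-1<..<1} \<times> {h'}" using comp[OF L] by blast
  have "?x \<in> ?K" using x by auto
  then have "\<phi> ?x \<in> {-1<..<1} \<times> {h'}" using h by blast
  then have "h' = h" using assms phi_psi by auto
  then have "(s', h) \<in> \<phi> ` ?K" using h assms by auto
  then obtain y where y: "y \<in> ?K" "\<phi> y = (s', h)" by (auto elim!: imageE)
  then have "y \<in> L \<inter> V" using connected_component_subset by blast
  then show ?thesis by (metis IntD1 IntD2 psi_phi y(2))
qed

text \<open>Because a leaf is embedded, the plaques in which it meets a flow box do not accumulate.\<close>

lemma leaf_heights_isolated:
  assumes L: "L \<in> \<F>" and hL: "\<And>n. \<psi> (s, x n) \<in> L" and box: "\<And>n. (s, x n) \<in> unit_box"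
    and lim: "x \<longlonglongrightarrow> l" and l: "(s, l) \<in> unit_box"
  shows "\<forall>\<^sub>F n in sequentially. x n = l"
proof -
  obtain c where c: "rotational_param P c" "range c = L" using leaf[OF L] by blast
  have lim2: "(\<lambda>n. \<psi> (s, x n)) \<longlonglongrightarrow> \<psi> (s, l)"
    by (rule continuous_on_tendsto_compose[OF cont_psi]) (use box l lim in \<open>auto intro!: tendsto_intros\<close>)
  have "\<psi> (s, l) \<in> L"
    using closed_sequentially[OF rotational_param_closed[OF P c(1)], of "\<lambda>n. \<psi> (s, x n)"] hL lim2 c(2) by blast
  then obtain u where u: "c u = \<psi> (s, l)" using c(2) by (metis imageE)
  have "\<forall>n. \<exists>u. \<psi> (s, x n) = c u" using hL c(2) by (metis imageE)
  then obtain w where w: "\<And>n. \<psi> (s, x n) = c (w n)" using choice by metis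
  have wu: "w \<longlonglongrightarrow> u"
    by (rule rotational_param_tendsto[OF P c(1)]) (use lim2 u w in simp)
  have cc: "continuous_on UNIV c" using c(1) by (simp add: rotational_param_def)
  have "open (c -` V)" using cc V(1) by (simp add: open_vimage continuous_on_eq_continuous_at)
  moreover have "u \<in> c -` V" using u l psi_V by simp
  ultimately obtain d where d: "0 < d" "ball u d \<subseteq> c -` V" by (meson openE)
  have "\<forall>\<^sub>F n in sequentially. dist (w n) u < d" using wu d(1) by (rule tendstoD)
  then show ?thesis
  proof eventually_elim
    case (elim n)
    have "snd (\<phi> (c (w n))) = snd (\<phi> (c u))"
      by (rule connected_height[OF L, of "c ` ball u d"])
         (use d elim c(2) cc in \<open>auto intro!: connected_continuous_image elim: continuous_on_subset simp: dist_commute\<close>)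
    then show ?case using phi_psi[OF box[of n]] phi_psi[OF l] u w[of n] by simp
  qed
qed

end

definition leaf_map :: "'a::topological_space set \<Rightarrow> 'a set set \<Rightarrow> ('a \<Rightarrow> 'a) \<Rightarrow> bool"
  where "leaf_map U \<F> F \<longleftrightarrow> continuous_on U F \<and> (\<forall>L\<in>\<F>. F ` L \<subseteq> L)"

lemma leaf_mapD: "leaf_map U \<F> F \<Longrightarrow> L \<in> \<F> \<Longrightarrow> z \<in> L \<Longrightarrow> F z \<in> L"
  unfolding leaf_map_def by blast

context flow_box begin

lemma small_box:
  assumes F: "leaf_map U \<F> F" and W: "open W" and z0: "(s0, h0) \<in> unit_box" "F (\<psi> (s0, h0)) \<in> W"
    and d: "0 < d"
  shows "\<exists>e. 0 < e \<and> e \<le> d \<and> {s0-e<..<s0+e} \<times> {h0-e<..<h0+e} \<subseteq> unit_box \<and>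
    (\<forall>p \<in> {s0-e<..<s0+e} \<times> {h0-e<..<h0+e}. F (\<psi> p) \<in> W)"
proof -
  have "continuous_on unit_box (F \<circ> \<psi>)"
    using F V(2) psi_V unfolding leaf_map_def
    by (intro continuous_on_compose cont_psi) (auto elim!: continuous_on_subset)
  then have "open (unit_box \<inter> (F \<circ> \<psi>) -` W)"
    using open_box W by (rule continuous_open_preimage)
  moreover have "(s0, h0) \<in> unit_box \<inter> (F \<circ> \<psi>) -` W" using z0 by auto
  ultimately obtain A B where AB: "open A" "open B" "(s0, h0) \<in> A \<times> B" "A \<times> B \<subseteq> unit_box \<inter> (F \<circ> \<psi>) -` W"
    by (rule open_prod_elim)
  obtain e1 where e1: "0 < e1" "ball s0 e1 \<subseteq> A" using AB by (meson openE SigmaE2)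
  obtain e2 where e2: "0 < e2" "ball h0 e2 \<subseteq> B" using AB by (meson openE SigmaE2)
  define e where "e = Min {e1, e2, d}"
  have e: "0 < e" "e \<le> e1" "e \<le> e2" "e \<le> d" using e1 e2 d by (auto simp: e_def)
  have "{s0-e<..<s0+e} \<subseteq> A" using e1(2) e by (auto simp: subset_iff dist_real_def)
  moreover have "{h0-e<..<h0+e} \<subseteq> B" using e2(2) e by (auto simp: subset_iff dist_real_def)
  ultimately have sub: "{s0-e<..<s0+e} \<times> {h0-e<..<h0+e} \<subseteq> unit_box \<inter> (F \<circ> \<psi>) -` W"
    using AB(4) by blast
  show ?thesis using e(1,4) sub by (intro exI[of _ e]) auto
qed

text \<open>The image of a piece of plaque is connected and lies in one leaf, hence in one plaque.\<close>

lemma image_height: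
  assumes F: "leaf_map U \<F> F" and box: "{s0-e<..<s0+e} \<times> {h0-e<..<h0+e} \<subseteq> unit_box"
    and inV: "\<And>p. p \<in> {s0-e<..<s0+e} \<times> {h0-e<..<h0+e} \<Longrightarrow> F (\<psi> p) \<in> V"
    and s: "s \<in> {s0-e<..<s0+e}" "s' \<in> {s0-e<..<s0+e}" "h \<in> {h0-e<..<h0+e}"
  shows "snd (\<phi> (F (\<psi> (s, h)))) = snd (\<phi> (F (\<psi> (s', h))))"
proof -
  let ?I = "{s0-e<..<s0+e} \<times> {h}"
  have I: "?I \<subseteq> unit_box" using box s by blast
  have "\<psi> (s, h) \<in> U" using I s psi_V V(2) by blast
  then obtain L where L: "L \<in> \<F>" "\<psi> (s, h) \<in> L" using leaf_exists by blast
  have inL: "\<psi> (x, h) \<in> L" if "x \<in> {s0-e<..<s0+e}" for x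
    by (rule plaque_in_leaf[OF L]) (use that s subsetD[OF I] in blast)+
  have IU: "\<psi> ` ?I \<subseteq> U" using I psi_V V(2) by blast
  have "continuous_on (\<psi> ` ?I) F"
    using F IU unfolding leaf_map_def by (blast intro: continuous_on_subset)
  then have "continuous_on ?I (F \<circ> \<psi>)"
    by (intro continuous_on_compose continuous_on_subset[OF cont_psi I])
  then have con: "connected ((F \<circ> \<psi>) ` ?I)"
    by (intro connected_continuous_image connected_Times) auto
  have FL: "F z \<in> L" if "z \<in> L" for z using F L(1) that unfolding leaf_map_def by blast
  have "(F \<circ> \<psi>) ` ?I \<subseteq> L \<inter> V"
  proof
    fix z assume "z \<in> (F \<circ> \<psi>) ` ?I"
    then obtain x where x: "x \<in> {s0-e<..<s0+e}" "z = F (\<psi> (x, h))" by auto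
    show "z \<in> L \<inter> V" using FL[OF inL[OF x(1)]] inV[of "(x, h)"] x s by simp
  qed
  from connected_height[OF L(1) con this] show ?thesis using s by auto
qed

text \<open>Near a fixed point, a homeomorphism that preserves every leaf permutes the plaques through a
  monotone map \<open>\<tau>\<close> of heights. It may exchange the two sides of the fixed plaque, but \<open>\<tau> \<circ> \<tau>\<close> is
  increasing and moves each height within its leaf, so it is the identity, the heights of a leaf
  being isolated.\<close>

lemma square_preserves_heights:
  assumes G: "leaf_map U \<F> G" and G': "leaf_map U \<F> G'" and inv: "\<And>z. z \<in> U \<Longrightarrow> G' (G z) = z"
    and z0: "(s0, h0) \<in> unit_box" "G (\<psi> (s0, h0)) = \<psi> (s0, h0)"
  obtains e where "0 < e" "{s0-e<..<s0+e} \<times> {h0-e<..<h0+e} \<subseteq> unit_box"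
    "\<And>s h. s \<in> {s0-e<..<s0+e} \<Longrightarrow> h \<in> {h0-e<..<h0+e} \<Longrightarrow>
       G (G (\<psi> (s, h))) \<in> V \<and> snd (\<phi> (G (G (\<psi> (s, h))))) = h"
proof -
  define N where "N e = {s0-e<..<s0+e} \<times> {h0-e<..<h0+e}" for e
  have oN: "open (\<psi> ` N e)" if "N e \<subseteq> unit_box" for e
  proof -
    have "\<psi> ` N e = V \<inter> \<phi> -` N e"
    proof (intro equalityI subsetI)
      fix z assume "z \<in> \<psi> ` N e" then show "z \<in> V \<inter> \<phi> -` N e"
        using that psi_V phi_psi by (metis (no_types, lifting) IntI imageE subsetD vimageI)
    next
      fix z assume "z \<in> V \<inter> \<phi> -` N e" then show "z \<in> \<psi> ` N e" 
        using psi_phi by (metis IntD1 IntD2 image_eqI vimageD)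
    qed
    moreover have "open (N e)" unfolding N_def by (intro open_Times) auto
    ultimately show ?thesis using continuous_open_preimage[OF cont_phi V(1)] by simp
  qed
  have N0: "0 < e \<Longrightarrow> (s0, h0) \<in> N e" for e by (simp add: N_def)
  have V0: "\<psi> (s0, h0) \<in> V" using z0 psi_V by blast
  have z0': "G' (\<psi> (s0, h0)) = \<psi> (s0, h0)" using inv[of "\<psi> (s0, h0)"] z0 V0 V(2) by auto
  \<comment> \<open>On \<open>N d1\<close> the inverse stays in the chart; \<open>N d2\<close> is mapped into \<open>N d1\<close>, and \<open>N d3\<close> into \<open>N d2\<close>.\<close>
  obtain d1 where d1: "0 < d1" "N d1 \<subseteq> unit_box" "\<And>p. p \<in> N d1 \<Longrightarrow> G' (\<psi> p) \<in> V"
    using small_box[OF G' V(1) z0(1) _ zero_less_one, folded N_def] z0' V0 by metis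
  have g1: "G (\<psi> (s0, h0)) \<in> \<psi> ` N d1" using z0(2) N0[OF d1(1)] by (simp only: imageI)
  obtain d2 where d2: "0 < d2" "d2 \<le> d1" "N d2 \<subseteq> unit_box" "\<And>p. p \<in> N d2 \<Longrightarrow> G (\<psi> p) \<in> \<psi> ` N d1"
    using small_box[OF G oN[OF d1(2)] z0(1) g1 d1(1), folded N_def] by blast
  have g2: "G (\<psi> (s0, h0)) \<in> \<psi> ` N d2" using z0(2) N0[OF d2(1)] by (simp only: imageI)
  obtain d3 where d3: "0 < d3" "d3 \<le> d2" "N d3 \<subseteq> unit_box" "\<And>p. p \<in> N d3 \<Longrightarrow> G (\<psi> p) \<in> \<psi> ` N d2"
    using small_box[OF G oN[OF d2(3)] z0(1) g2 d2(1), folded N_def] by blast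
  have mN: "(s0, x) \<in> N d2" if "x \<in> {h0-d2<..<h0+d2}" for x using that d2(1) by (auto simp: N_def)
  have mB: "(s0, x) \<in> unit_box" if "x \<in> {h0-d2<..<h0+d2}" for x by (rule subsetD[OF d2(3) mN[OF that]])
  have mU: "\<psi> (s0, x) \<in> U" if "x \<in> {h0-d2<..<h0+d2}" for x by (rule subsetD[OF V(2) psi_V[OF mB[OF that]]])
  define \<tau> where "\<tau> h = snd (\<phi> (G (\<psi> (s0, h))))" for h
  have inV2: "G (\<psi> p) \<in> V" if "p \<in> N d2" for p
    using d2(4)[rule_format, OF that] d1(2) psi_V by (metis imageE subsetD)
  have height: "snd (\<phi> (G (\<psi> (s, h)))) = \<tau> h" if "(s, h) \<in> N d2" for s h
    unfolding \<tau>_def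
    by (rule image_height[OF G, where e=d2]) (use d2 inV2 that in \<open>auto simp: N_def\<close>)
  have tau_mem: "\<tau> h \<in> {h0-d1<..<h0+d1}" if "h \<in> {h0-d2<..<h0+d2}" for h
  proof -
    have "(s0, h) \<in> N d2" using that d2 by (auto simp: N_def)
    then obtain q where "q \<in> N d1" "G (\<psi> (s0, h)) = \<psi> q" using d2(4) by blast
    then have "\<tau> h = snd q" using d1 phi_psi by (auto simp: \<tau>_def)
    then show ?thesis using \<open>q \<in> _\<close> by (auto simp: N_def)
  qed
  have tau_mem3: "\<tau> h \<in> {h0-d2<..<h0+d2}" if "h \<in> {h0-d3<..<h0+d3}" for h
  proof -
    have "(s0, h) \<in> N d3" using that d3 by (auto simp: N_def)
    then obtain q where "q \<in> N d2" "G (\<psi> (s0, h)) = \<psi> q" using d3(4) by blast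
    then have "\<tau> h = snd q" using d2 phi_psi by (auto simp: \<tau>_def)
    then show ?thesis using \<open>q \<in> _\<close> by (auto simp: N_def)
  qed
  have inj: "h = h'" if hh: "h \<in> {h0-d2<..<h0+d2}" "h' \<in> {h0-d2<..<h0+d2}" and eq: "\<tau> h = \<tau> h'" for h h'
  proof -
    have recover: "snd (\<phi> (G' (\<psi> (s0, \<tau> x)))) = x" if x: "x \<in> {h0-d2<..<h0+d2}" for x
    proof -
      have m: "(s0, x) \<in> N d2" using x d2 by (auto simp: N_def)
      then obtain s y where q: "(s, y) \<in> N d1" "G (\<psi> (s0, x)) = \<psi> (s, y)" using d2(4) by fast
      then have y: "y = \<tau> x" using d1 phi_psi by (auto simp: \<tau>_def)
      have U0: "\<psi> (s0, x) \<in> U" using m d2(3) psi_V V(2) by blast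
      have "snd (\<phi> (G' (\<psi> (s0, \<tau> x)))) = snd (\<phi> (G' (\<psi> (s, \<tau> x))))"
        by (rule image_height[OF G', where e=d1])
           (use d1 q y in \<open>auto simp: N_def\<close>)
      also have "G' (\<psi> (s, \<tau> x)) = \<psi> (s0, x)" using q y inv[OF U0] by simp
      also have "snd (\<phi> (\<psi> (s0, x))) = x" using m d2(3) phi_psi by auto
      finally show ?thesis .
    qed
    show ?thesis by (rule trans[OF sym[OF recover[OF hh(1), unfolded eq]] recover[OF hh(2)]])
  qed
  have tau_cont: "continuous_on {h0-d2<..<h0+d2} \<tau>"
  proof -
    have 1: "continuous_on {h0-d2<..<h0+d2} (\<lambda>h. \<psi> (s0, h))"
      by (rule continuous_on_compose2[OF cont_psi continuous_on_Pair[OF continuous_on_const continuous_on_id]])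
         (rule image_subsetI, erule mB)
    have cG: "continuous_on U G" using G by (simp add: leaf_map_def)
    have 2: "continuous_on {h0-d2<..<h0+d2} (\<lambda>h. G (\<psi> (s0, h)))"
      by (rule continuous_on_compose2[OF cG 1]) (rule image_subsetI, erule mU)
    have "continuous_on {h0-d2<..<h0+d2} (\<lambda>h. \<phi> (G (\<psi> (s0, h))))"
      by (rule continuous_on_compose2[OF cont_phi 2]) (rule image_subsetI, erule inV2[OF mN])
    then show ?thesis unfolding \<tau>_def by (intro continuous_on_snd)
  qed
  have t0: "\<tau> h0 = h0" using z0 phi_psi by (simp add: \<tau>_def)
  define \<sigma> where "\<sigma> = \<tau> \<circ> \<tau>"
  define I where "I = {h0-d3<..<h0+d3}"
  have I_sub: "I \<subseteq> {h0-d2<..<h0+d2}" using d3 by (auto simp: I_def)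
  have sig_cont: "continuous_on I \<sigma>"
    unfolding \<sigma>_def by (intro continuous_on_compose continuous_on_subset[OF tau_cont] I_sub)
      (use tau_mem3 in \<open>auto simp: I_def\<close>)
  have sig_mono: "strict_mono_on I \<sigma>"
  proof -
    have inj2: "inj_on \<tau> {h0-d2<..<h0+d2}" using inj by (rule inj_onI)
    have cases: "strict_mono_on {h0-d2<..<h0+d2} \<tau> \<or> strict_antimono_on {h0-d2<..<h0+d2} \<tau>"
      using injective_eq_monotone_map[of "{h0-d2<..<h0+d2}" \<tau>] tau_cont inj2
      by (auto simp: is_interval_oo)
    then show ?thesis
    proof
      assume m: "strict_mono_on {h0-d2<..<h0+d2} \<tau>"
      show ?thesis unfolding \<sigma>_def o_def
      proof (rule strict_mono_onI)
        fix x y assume xy: "x \<in> I" "y \<in> I" "x < y"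
        have "\<tau> x < \<tau> y" by (rule strict_mono_onD[OF m]) (use xy I_sub in auto)
        then show "\<tau> (\<tau> x) < \<tau> (\<tau> y)"
          by (rule strict_mono_onD[OF m, rotated 2]) (use xy tau_mem3 in \<open>auto simp: I_def\<close>)
      qed
    next
      assume m: "strict_antimono_on {h0-d2<..<h0+d2} \<tau>"
      then have m': "\<tau> y < \<tau> x" if "x < y" "x \<in> {h0-d2<..<h0+d2}" "y \<in> {h0-d2<..<h0+d2}" for x y
        using that unfolding monotone_on_def by blast
      show ?thesis unfolding \<sigma>_def o_def
      proof (rule strict_mono_onI)
        fix x y assume xy: "x \<in> I" "y \<in> I" "x < y"
        have "\<tau> y < \<tau> x" by (rule m') (use xy I_sub in auto)
        then show "\<tau> (\<tau> x) < \<tau> (\<tau> y)"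
          by (rule m') (use xy tau_mem3 in \<open>auto simp: I_def\<close>)
      qed
    qed
  qed
  define E where "E h h' \<longleftrightarrow> (\<exists>L\<in>\<F>. \<psi> (s0, h) \<in> L \<and> \<psi> (s0, h') \<in> L)" for h h'
  have E_sym: "E y x" if "E x y" for x y using that unfolding E_def by blast
  have E_trans: "E x z" if "E x y" "E y z" for x y z
    using that same_leaf unfolding E_def by metis
  have E_refl: "E x x" if "x \<in> {h0-d2<..<h0+d2}" for x
    using leaf_exists[OF mU[OF that]] unfolding E_def by blast
  have E_tau: "E x (\<tau> x)" if x: "x \<in> {h0-d2<..<h0+d2}" for x
  proof -
    have m: "(s0, x) \<in> N d2" using x d2 by (auto simp: N_def)
    then obtain s y where q: "(s, y) \<in> N d1" "G (\<psi> (s0, x)) = \<psi> (s, y)" using d2(4) by fast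
    then have y: "y = \<tau> x" using d1 phi_psi by (auto simp: \<tau>_def)
    obtain L where L: "L \<in> \<F>" "\<psi> (s0, x) \<in> L" using E_refl[OF x] unfolding E_def by blast
    have "\<psi> (s, \<tau> x) \<in> L" using leaf_mapD[OF G L] q y by simp
    then have "\<psi> (s0, \<tau> x) \<in> L"
      by (rule plaque_in_leaf[OF L(1)])
         (use q y subsetD[OF d1(2)] mB[of h0] d2(1) tau_mem[OF x] in \<open>auto simp: N_def\<close>)
    then show ?thesis using L unfolding E_def by blast
  qed
  have E_sig: "E x (\<sigma> x)" if "x \<in> I" for x
    using E_trans[OF E_tau[of x] E_tau[of "\<tau> x"]] that tau_mem3 I_sub by (auto simp: \<sigma>_def I_def)
  have isolated: "\<forall>\<^sub>F n in sequentially. x n = l"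
    if x: "\<And>n. x n \<in> {lo..hi}" "\<And>n. E h (x n)" "x \<longlonglongrightarrow> l" and sub: "{lo..hi} \<subseteq> I" for x l h lo hi
  proof -
    obtain L where L: "L \<in> \<F>" "\<psi> (s0, h) \<in> L" using x(2) unfolding E_def by blast
    have inL: "\<psi> (s0, x n) \<in> L" for n using x(2)[of n] L same_leaf unfolding E_def by metis
    have "l \<in> {lo..hi}" using closed_sequentially[of "{lo..hi}" x l] x by auto
    then have l: "(s0, l) \<in> unit_box" by (intro mB subsetD[OF I_sub] subsetD[OF sub])
    have "(s0, x n) \<in> unit_box" for n by (intro mB subsetD[OF I_sub] subsetD[OF sub] x(1))
    then show ?thesis using leaf_heights_isolated[OF L(1) inL _ x(3) l] by blast
  qed
  have sig0: "\<sigma> h0 = h0" by (simp add: \<sigma>_def t0)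
  have sig_id: "\<sigma> h = h" if h: "h \<in> I" for h
  proof (cases "h0 \<le> h")
    case True
    have sub: "{h0..h} \<subseteq> I" using h d3 by (auto simp: I_def)
    show ?thesis
    proof (rule strictly_increasing_isolated_classes_identity[where E=E and a=h0])
      show "strict_mono_on {h0..h} \<sigma>" using sig_mono sub by (auto simp: monotone_on_def)
      show "continuous_on {h0..h} \<sigma>" using sig_cont sub by (rule continuous_on_subset)
      show "\<And>x. x \<in> {h0..h} \<Longrightarrow> E x x" using E_refl sub I_sub by blast
      show "\<And>x. x \<in> {h0..h} \<Longrightarrow> E x (\<sigma> x)" using E_sig sub by blast
      show "\<forall>\<^sub>F n in sequentially. x n = l" if "\<And>n. x n \<in> {h0..h}" "\<And>n. E h (x n)" "x \<longlonglongrightarrow> l" for x l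
        by (rule isolated[OF that sub])
    qed (fact True sig0 E_sym E_trans)+
  next
    case False
    have sub: "{h..h0} \<subseteq> I" using h d3 by (auto simp: I_def)
    have ms: "-x \<in> {h..h0}" if "x \<in> {-h0..-h}" for x using that by auto
    \<comment> \<open>The heights below \<open>h0\<close> are treated by reflection.\<close>
    have "(\<lambda>x. - \<sigma> (-x)) (-h) = -h"
    proof (rule strictly_increasing_isolated_classes_identity[where E="\<lambda>x y. E (-x) (-y)" and a="-h0"])
      have mI: "-x \<in> I" if "x \<in> {-h0..-h}" for x by (rule subsetD[OF sub ms[OF that]])
      show "strict_mono_on {-h0..-h} (\<lambda>x. - \<sigma> (-x))"
      proof (rule strict_mono_onI)
        fix x y assume xy: "x \<in> {-h0..-h}" "y \<in> {-h0..-h}" "x < y"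
        show "- \<sigma> (-x) < - \<sigma> (-y)"
          using strict_mono_onD[OF sig_mono mI[OF xy(2)] mI[OF xy(1)]] xy(3) by simp
      qed
      show "continuous_on {-h0..-h} (\<lambda>x. - \<sigma> (-x))"
        by (intro continuous_on_minus continuous_on_compose2[OF sig_cont] continuous_on_id image_subsetI mI)
      show "E (-x) (-x)" if "x \<in> {-h0..-h}" for x
        by (rule E_refl[OF subsetD[OF I_sub mI[OF that]]])
      show "E (-x) (- (- \<sigma> (-x)))" if "x \<in> {-h0..-h}" for x
        using E_sig[OF mI[OF that]] by simp
      show "\<forall>\<^sub>F n in sequentially. x n = l" if "\<And>n. x n \<in> {-h0..-h}" "\<And>n. E (- (-h)) (- x n)" "x \<longlonglongrightarrow> l" for x l
      proof -
        have "\<forall>\<^sub>F n in sequentially. - x n = - l"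
          by (rule isolated[of _ h, OF _ _ tendsto_minus[OF that(3)] sub]) (use ms[OF that(1)] that(2) in simp_all)
        then show ?thesis by simp
      qed
      show "-h0 \<le> -h" using False by simp
      show "- \<sigma> (- (-h0)) = -h0" using sig0 by simp
      show "E (-y) (-x)" if "E (-x) (-y)" for x y by (rule E_sym[OF that])
      show "E (-x) (-z)" if "E (-x) (-y)" "E (-y) (-z)" for x y z by (rule E_trans[OF that])
    qed
    then show ?thesis by simp
  qed
  show ?thesis
  proof (rule that[OF d3(1)])
    show "{s0-d3<..<s0+d3} \<times> {h0-d3<..<h0+d3} \<subseteq> unit_box" using d3 by (simp add: N_def)
    fix s h assume sh: "s \<in> {s0-d3<..<s0+d3}" "h \<in> {h0-d3<..<h0+d3}"
    then obtain s' h' where q: "(s', h') \<in> N d2" "G (\<psi> (s, h)) = \<psi> (s', h')"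
      using d3(4)[of "(s, h)"] by (fastforce simp: N_def)
    have "(s, h) \<in> N d2" using sh d3(2) by (auto simp: N_def)
    from height[OF this] have "h' = \<tau> h" using q(2) phi_psi[OF subsetD[OF d2(3) q(1)]] by simp
    then have "snd (\<phi> (G (\<psi> (s', h')))) = \<sigma> h" using height[OF q(1)] by (simp add: \<sigma>_def)
    then show "G (G (\<psi> (s, h))) \<in> V \<and> snd (\<phi> (G (G (\<psi> (s, h))))) = h"
      using sig_id[of h] sh q inV2[OF q(1)] by (simp add: I_def)
  qed
qed

end

section \<open>Area carried by a flow box\<close>

locale weighted_flow_box = flow_box +
  fixes \<rho> :: "real \<times> real \<Rightarrow> real"
  assumes rho_cont: "continuous_on UNIV \<rho>" and rho_nonneg: "\<And>z. 0 \<le> \<rho> z"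
    and C1_phi: "C1_on \<phi> V" and C1_psi: "C1_on \<psi> unit_box"
begin

lemma jac_blinfun_continuous:
  assumes "continuous_on S (g' :: real \<times> real \<Rightarrow> (real \<times> real) \<Rightarrow>\<^sub>L (real \<times> real))"
  shows "continuous_on S (\<lambda>z. jac (blinfun_apply (g' z)))"
  unfolding jac_def by (intro continuous_intros assms)

text \<open>In the chart the area \<open>\<rho> dt dy\<close> has a continuous density. It vanishes only where \<open>\<rho>\<close> does, because
  the chart is a diffeomorphism.\<close>

lemma chart_density:
  obtains \<omega> where "continuous_on unit_box \<omega>" "\<And>p. p \<in> unit_box \<Longrightarrow> 0 \<le> \<omega> p"
    "\<And>p. p \<in> unit_box \<Longrightarrow> \<omega> p = 0 \<Longrightarrow> \<rho> (\<psi> p) = 0"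
    "\<And>D. compact D \<Longrightarrow> D \<subseteq> unit_box \<Longrightarrow> integral (\<psi> ` D) \<rho> = integral D \<omega>"
proof -
  obtain \<psi>' where d: "\<And>z. z \<in> unit_box \<Longrightarrow> (\<psi> has_derivative blinfun_apply (\<psi>' z)) (at z)"
    and c: "continuous_on unit_box \<psi>'"
    using C1_psi unfolding C1_on_def by blast
  obtain \<phi>' where d2: "\<And>z. z \<in> V \<Longrightarrow> (\<phi> has_derivative blinfun_apply (\<phi>' z)) (at z)"
    using C1_phi unfolding C1_on_def by blast
  define \<omega> where "\<omega> p = \<bar>jac (blinfun_apply (\<psi>' p))\<bar> * \<rho> (\<psi> p)" for p
  have jac: "jac (blinfun_apply (\<psi>' p)) \<noteq> 0" if p: "p \<in> unit_box" for p
  proof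
    assume j0: "jac (blinfun_apply (\<psi>' p)) = 0"
    have 1: "(\<phi> \<circ> \<psi> has_derivative blinfun_apply (\<phi>' (\<psi> p)) \<circ> blinfun_apply (\<psi>' p)) (at p)"
      by (rule diff_chain_at[OF d[OF p] d2[OF psi_V[OF p]]])
    have "(\<phi> \<circ> \<psi> has_derivative (\<lambda>x. x)) (at p)"
    proof (rule has_derivative_transform_within_open[OF has_derivative_ident open_box p])
      show "\<And>x. x \<in> unit_box \<Longrightarrow> x = (\<phi> \<circ> \<psi>) x" using phi_psi by simp
    qed
    from has_derivative_unique[OF 1 this]
    have id: "blinfun_apply (\<phi>' (\<psi> p)) (blinfun_apply (\<psi>' p) x) = x" for x
      by (metis comp_apply)
    define a b where "a = blinfun_apply (\<psi>' p) (1,0)" and "b = blinfun_apply (\<psi>' p) (0,1)"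
    have a0: "a \<noteq> 0" 
    proof
      assume "a = 0"
      then have "(1::real, 0::real) = 0"
        using id[of "(1,0)"] by (simp add: a_def[symmetric] blinfun.zero_right)
      then show False by (simp add: zero_prod_def)
    qed
    have ab: "fst a * snd b = fst b * snd a" using j0 by (simp add: jac_def a_def b_def)
    have lin: "blinfun_apply (\<psi>' p) (x, y) = x *\<^sub>R a + y *\<^sub>R b" for x y
    proof -
      have "(x, y) = x *\<^sub>R (1,0) + y *\<^sub>R (0,1::real)" by simp
      then show ?thesis unfolding a_def b_def by (metis blinfun.add_right blinfun.scaleR_right)
    qed
    have z: "(x, y) = 0" if "x *\<^sub>R a + y *\<^sub>R b = 0" for x y
      using id[of "(x, y)"] lin[of x y] that by (metis blinfun.zero_right)
    have "fst b *\<^sub>R a + (- fst a) *\<^sub>R b = 0" "snd b *\<^sub>R a + (- snd a) *\<^sub>R b = 0"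
      using ab by (auto simp: prod_eq_iff algebra_simps)
    from z[OF this(1)] z[OF this(2)] have "fst a = 0" "snd a = 0" by (auto simp: zero_prod_def)
    then show False using a0 by (auto simp: prod_eq_iff)
  qed
  have crp: "continuous_on unit_box (\<lambda>p. \<rho> (\<psi> p))"
    by (rule continuous_on_compose2[OF rho_cont cont_psi]) auto
  show ?thesis
  proof (rule that[of \<omega>])
    show cw: "continuous_on unit_box \<omega>" unfolding \<omega>_def
      by (intro continuous_intros jac_blinfun_continuous c crp)
    show "\<And>p. p \<in> unit_box \<Longrightarrow> 0 \<le> \<omega> p" by (simp add: \<omega>_def rho_nonneg)
    show "\<And>p. p \<in> unit_box \<Longrightarrow> \<omega> p = 0 \<Longrightarrow> \<rho> (\<psi> p) = 0" using jac by (auto simp: \<omega>_def)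
    fix D assume D: "compact D" "D \<subseteq> unit_box"
    have "integral (\<psi> ` D) \<rho> = integral D (\<lambda>p. \<bar>jac (blinfun_apply (\<psi>' p))\<bar> * \<rho> (\<psi> p))"
    proof (rule integral_image_plane[OF D(1)])
      show "(\<psi> has_derivative blinfun_apply (\<psi>' z)) (at z within D)" if "z \<in> D" for z
        using d[of z] that D(2) by (blast intro: has_derivative_at_withinI)
      show "inj_on \<psi> D"
        by (rule inj_on_inverseI[of _ \<phi>]) (rule phi_psi[OF subsetD[OF D(2)]])
      show "continuous_on (\<psi> ` D) \<rho>" using rho_cont continuous_on_subset by blast
      show "continuous_on D (\<lambda>z. \<bar>jac (blinfun_apply (\<psi>' z))\<bar> * \<rho> (\<psi> z))"
        using continuous_on_subset[OF cw D(2)] by (simp add: \<omega>_def[abs_def])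
    qed
    then show "integral (\<psi> ` D) \<rho> = integral D \<omega>" by (simp add: \<omega>_def[abs_def])
  qed
qed

lemma integral_rectangle_bounds:
  fixes f :: "real \<times> real \<Rightarrow> real"
  assumes "continuous_on ({a..b} \<times> {c..d}) f" "a \<le> b" "c \<le> d"
  shows "(\<And>p. p \<in> {a..b} \<times> {c..d} \<Longrightarrow> w \<le> f p) \<Longrightarrow> w * ((b - a) * (d - c)) \<le> integral ({a..b} \<times> {c..d}) f"
    and "(\<And>p. p \<in> {a..b} \<times> {c..d} \<Longrightarrow> f p \<le> w) \<Longrightarrow> integral ({a..b} \<times> {c..d}) f \<le> w * ((b - a) * (d - c))"
proof -
  have eq: "{a..b} \<times> {c..d} = cbox (a, c) (b, d)" by (simp add: cbox_Pair_eq)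
  have i: "f integrable_on cbox (a, c) (b, d)" using assms(1) by (simp add: eq integrable_continuous)
  have k: "((\<lambda>_. w) has_integral w * ((b - a) * (d - c))) (cbox (a, c) (b, d))"
    using has_integral_const[of w "(a, c)" "(b, d)"] assms(2,3)
    by (simp add: content_Pair mult.commute)
  show "w * ((b - a) * (d - c)) \<le> integral ({a..b} \<times> {c..d}) f"
    if "\<And>p. p \<in> {a..b} \<times> {c..d} \<Longrightarrow> w \<le> f p"
    unfolding eq by (rule has_integral_le[OF k integrable_integral[OF i]]) (use that eq in auto)
  show "integral ({a..b} \<times> {c..d}) f \<le> w * ((b - a) * (d - c))"
    if "\<And>p. p \<in> {a..b} \<times> {c..d} \<Longrightarrow> f p \<le> w"
    unfolding eq by (rule has_integral_le[OF integrable_integral[OF i] k]) (use that eq in auto)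
qed

lemma integral_Un_le:
  fixes f :: "real \<times> real \<Rightarrow> real"
  assumes "f integrable_on S" "f integrable_on T" "f integrable_on (S \<union> T)" "\<And>x. x \<in> S \<union> T \<Longrightarrow> 0 \<le> f x"
  shows "integral (S \<union> T) f \<le> integral S f + integral T f"
proof -
  let ?r = "\<lambda>A x. if x \<in> A then f x else 0"
  have i: "?r S integrable_on UNIV" "?r T integrable_on UNIV" "?r (S \<union> T) integrable_on UNIV"
    using assms integrable_restrict_UNIV by blast+
  have "integral UNIV (?r (S \<union> T)) \<le> integral UNIV (\<lambda>x. ?r S x + ?r T x)"
    by (rule integral_le[OF i(3) integrable_add[OF i(1,2)]]) (use assms(4) in auto)
  also have "\<dots> = integral UNIV (?r S) + integral UNIV (?r T)" by (rule integral_add[OF i(1,2)])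
  finally show ?thesis by (simp only: integral_restrict_UNIV)
qed

text \<open>Let \<open>H\<close> preserve area and heights, and shrink the plaque segment from \<open>p\<close> to \<open>q\<close> to the segment from
  \<open>p'\<close> to \<open>q\<close>. A strip of small height \<open>\<epsilon>\<close> over the first segment is mapped into a strip of the same
  height over an \<open>\<eta>\<close>-neighbourhood of the second. This gains area of order \<open>\<eta> \<epsilon>\<close> beyond \<open>q\<close>, while
  it loses area of order \<open>\<epsilon>\<close> near \<open>p\<close>, with \<open>\<eta>\<close> arbitrarily small, unless the density vanishes at \<open>p\<close>.\<close>

lemma lost_arc_massless:
  assumes H: "leaf_map U \<F> H"
    and mass: "\<And>E. compact E \<Longrightarrow> E \<subseteq> U \<Longrightarrow> integral (H ` E) \<rho> = integral E \<rho>"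
    and h: "h0 \<in> {-1<..<1}" and e: "0 < e" "h0 + e < 1"
    and J: "closed_segment p q \<subseteq> {-1<..<1}" and p': "p' \<in> closed_segment p q" "p' \<noteq> p"
    and heights: "\<And>s h. s \<in> closed_segment p q \<Longrightarrow> h \<in> {h0..h0+e} \<Longrightarrow>
          H (\<psi> (s, h)) \<in> V \<and> snd (\<phi> (H (\<psi> (s, h)))) = h"
    and shrink: "\<And>s. s \<in> closed_segment p q \<Longrightarrow> fst (\<phi> (H (\<psi> (s, h0)))) \<in> closed_segment p' q"
  shows "\<rho> (\<psi> (p, h0)) = 0"
proof (rule ccontr)
  assume nz: "\<rho> (\<psi> (p, h0)) \<noteq> 0"
  define j1 j2 j1' j2' where "j1 = min p q" and "j2 = max p q" and "j1' = min p' q" and "j2' = max p' q"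
  have seg: "closed_segment p q = {j1..j2}" "closed_segment p' q = {j1'..j2'}"
    by (auto simp: closed_segment_eq_real_ivl j1_def j2_def j1'_def j2'_def)
  note J = J[unfolded seg] and height = heights[unfolded seg] and J' = shrink[unfolded seg]
  have p: "p \<in> {j1..j2}" by (simp add: j1_def j2_def)
  have pq: "-1 < p" "p < 1" "-1 < q" "q < 1" using J by (auto simp: j1_def j2_def subset_iff)
  have p'q: "p < p' \<and> p' \<le> q \<or> q \<le> p' \<and> p' < p"
    using p' by (auto simp: closed_segment_eq_real_ivl split: if_splits)
  define d0 where "d0 = min (\<bar>p' - p\<bar> / 4) ((1 - \<bar>q\<bar>) / 2)"
  have "d0 \<le> \<bar>p' - p\<bar> / 4" "d0 \<le> (1 - \<bar>q\<bar>) / 2"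
    unfolding d0_def by (rule min.cobounded1, rule min.cobounded2)
  moreover have "0 < d0" using pq p'(2) by (auto simp: d0_def)
  ultimately have dd: "0 < d0" "4 * d0 \<le> \<bar>p' - p\<bar>" "2 * d0 \<le> 1 - \<bar>q\<bar>" by simp_all
  \<comment> \<open>The neighbourhood of the shorter segment is covered by a part \<open>{x1..x2}\<close> of the original segment
    away from \<open>p\<close> and an interval \<open>{r1..r2}\<close> of length at most \<open>\<eta>\<close> beyond \<open>q\<close>.\<close>
  have eta: "\<exists>x1 x2 r1 r2. {j1'-\<eta>..j2'+\<eta>} \<subseteq> {x1..x2} \<union> {r1..r2} \<and> {x1..x2} \<subseteq> {j1..j2} \<and>
        {r1..r2} \<subseteq> {-1+d0..1-d0} \<and> r1 \<le> r2 \<and> r2 - r1 \<le> \<eta> \<and> x1 \<le> x2 \<and>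
        j1'-\<eta> \<in> {-1<..<1} \<and> j2'+\<eta> \<in> {-1<..<1} \<and> {x1..x2} \<inter> {p-d0..p+d0} = {}"
    if "0 < \<eta>" "\<eta> < d0" for \<eta>
    using p'q
  proof
    assume "p < p' \<and> p' \<le> q"
    then show ?thesis
      by (intro exI[of _ "p' - \<eta>"] exI[of _ q] exI[of _ "q + \<eta>"])
         (use that dd pq in \<open>auto simp: j1_def j2_def j1'_def j2'_def\<close>)
  next
    assume "q \<le> p' \<and> p' < p"
    then show ?thesis
      by (intro exI[of _ q] exI[of _ "p' + \<eta>"] exI[of _ "q - \<eta>"])
         (use that dd pq in \<open>auto simp: j1_def j2_def j1'_def j2'_def\<close>)
  qed
  have near: "\<exists>a b. {a..b} \<subseteq> {j1..j2} \<inter> {p-d..p+d} \<and> b - a = d" if "0 < d" "d < d0" for d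
    using p'q
  proof
    assume "p < p' \<and> p' \<le> q"
    then show ?thesis
      by (intro exI[of _ p] exI[of _ "p + d"]) (use that dd pq in \<open>auto simp: j1_def j2_def\<close>)
  next
    assume "q \<le> p' \<and> p' < p"
    then show ?thesis
      by (intro exI[of _ "p - d"] exI[of _ p]) (use that dd pq in \<open>auto simp: j1_def j2_def\<close>)
  qed
  obtain \<omega> where w: "continuous_on unit_box \<omega>" "\<And>p. p \<in> unit_box \<Longrightarrow> 0 \<le> \<omega> p"
    "\<And>p. p \<in> unit_box \<Longrightarrow> \<omega> p = 0 \<Longrightarrow> \<rho> (\<psi> p) = 0"
    "\<And>D. compact D \<Longrightarrow> D \<subseteq> unit_box \<Longrightarrow> integral (\<psi> ` D) \<rho> = integral D \<omega>"
    using chart_density by blast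
  have pbox: "(p, h0) \<in> unit_box" using p J h by blast
  define w0 where "w0 = \<omega> (p, h0) / 2"
  have w0: "0 < w0" using w(2,3)[OF pbox] nz by (force simp: w0_def)
  have "isCont \<omega> (p, h0)" using w(1) open_box pbox by (simp add: continuous_on_eq_continuous_at)
  then obtain d1 where d1: "0 < d1" "\<And>q. dist q (p, h0) < d1 \<Longrightarrow> dist (\<omega> q) (\<omega> (p, h0)) < w0"
    unfolding continuous_at_eps_delta using w0 by blast
  define d where "d = min (d0 / 2) (d1 / 4)"
  have d: "0 < d" "d < d0" "2 * d < d1" using dd(1) d1 by (auto simp: d_def)
  obtain a b where ab: "{a..b} \<subseteq> {j1..j2} \<inter> {p-d..p+d}" "b - a = d" using near[OF d(1,2)] by blast
  have ab': "a \<le> b" using ab(2) d(1) by simp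
  let ?B = "{-1+d0..1-d0} \<times> {h0..h0+e}"
  have Bbox: "?B \<subseteq> unit_box" using dd(1) e h by auto
  have "compact (\<omega> ` ?B)"
    by (intro compact_continuous_image continuous_on_subset[OF w(1) Bbox] compact_Times) auto
  then obtain C0 where C0: "\<And>q. q \<in> ?B \<Longrightarrow> \<bar>\<omega> q\<bar> \<le> C0"
    using compact_imp_bounded[of "\<omega> ` ?B"] unfolding bounded_iff by fastforce
  define C where "C = \<bar>C0\<bar> + 1"
  have C: "0 < C" by (simp add: C_def)
  have Cw: "\<omega> q \<le> C" if "q \<in> ?B" for q using C0[OF that] by (simp add: C_def)
  \<comment> \<open>Small enough for the gain \<open>C * \<eta>\<close> to be less than the loss \<open>w0 * d\<close>, per unit of height.\<close>
  define \<eta> where "\<eta> = min (d0 / 2) (w0 * d / (2 * C))"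
  have eta0: "0 < \<eta>" "\<eta> < d0" using dd(1) w0 d C by (auto simp: \<eta>_def)
  have "\<eta> \<le> w0 * d / (2 * C)" by (simp add: \<eta>_def)
  then have "C * \<eta> \<le> w0 * d / 2" using C by (simp add: field_simps)
  moreover have "0 < w0 * d" using w0 d(1) by simp
  ultimately have eta1: "C * \<eta> < w0 * d" by simp
  obtain x1 x2 r1 r2 where x: "{j1'-\<eta>..j2'+\<eta>} \<subseteq> {x1..x2} \<union> {r1..r2}" "{x1..x2} \<subseteq> {j1..j2}"
    "{r1..r2} \<subseteq> {-1+d0..1-d0}" "r1 \<le> r2" "r2 - r1 \<le> \<eta>" "x1 \<le> x2" "j1'-\<eta> \<in> {-1<..<1}" "j2'+\<eta> \<in> {-1<..<1}"
    "{x1..x2} \<inter> {p-d0..p+d0} = {}"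
    using eta[OF eta0] by blast
  let ?JI = "{j1..j2} \<times> {h0..h0+e}"
  have JIbox: "?JI \<subseteq> unit_box" using J e h by auto
  have JIU: "\<psi> ` ?JI \<subseteq> U" using JIbox psi_V V(2) by blast
  define F where "F = (\<lambda>q. fst (\<phi> (H (\<psi> q))))"
  have c1: "continuous_on ?JI (\<lambda>q. H (\<psi> q))"
    by (rule continuous_on_compose2[of U H])
       (use H JIU continuous_on_subset[OF cont_psi JIbox] in \<open>auto simp: leaf_map_def\<close>)
  have "continuous_on ?JI (\<lambda>q. \<phi> (H (\<psi> q)))"
    by (rule continuous_on_compose2[OF cont_phi c1]) (use height in auto)
  then have "continuous_on ?JI F" unfolding F_def by (intro continuous_on_fst)
  then have "uniformly_continuous_on ?JI F"
    by (intro compact_uniformly_continuous compact_Times) auto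
  then obtain \<delta> where \<delta>: "0 < \<delta>" "\<And>q q'. q \<in> ?JI \<Longrightarrow> q' \<in> ?JI \<Longrightarrow> dist q' q < \<delta> \<Longrightarrow> dist (F q') (F q) < \<eta>"
    unfolding uniformly_continuous_on_def using eta0(1) by metis
  define \<epsilon> where "\<epsilon> = min (min e (\<delta> / 2)) d"
  have eps: "0 < \<epsilon>" "\<epsilon> \<le> e" "\<epsilon> < \<delta>" "\<epsilon> \<le> d" using e(1) \<delta>(1) d(1) by (auto simp: \<epsilon>_def)
  let ?I = "{h0..h0+\<epsilon>}"
  define E where "E = {j1..j2} \<times> ?I"
  define E' where "E' = {j1'-\<eta>..j2'+\<eta>} \<times> ?I"
  have sub: "E \<subseteq> unit_box" "E' \<subseteq> unit_box" "E \<subseteq> ?JI" using J eps e h x(7,8) by (auto simp: E_def E'_def)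
  have cE: "compact E" "compact E'" by (auto simp: E_def E'_def intro!: compact_Times)
  have HE: "H ` \<psi> ` E \<subseteq> \<psi> ` E'"
  proof (clarsimp simp: image_image)
    fix s h assume sh: "(s, h) \<in> E"
    then have s: "s \<in> {j1..j2}" "h \<in> {h0..h0+e}" "\<bar>h - h0\<bar> < \<delta>" "h \<in> ?I" using eps by (auto simp: E_def)
    have "dist (s, h) (s, h0) < \<delta>" using s(3) by (simp add: dist_Pair_Pair dist_real_def)
    then have "dist (F (s, h)) (F (s, h0)) < \<eta>" using \<delta>(2)[of "(s, h0)" "(s, h)"] s e(1) by auto
    then have "F (s, h) \<in> {j1'-\<eta>..j2'+\<eta>}" using J'[OF s(1)] by (auto simp: F_def dist_real_def)
    then have "\<phi> (H (\<psi> (s, h))) \<in> E'" using height[OF s(1,2)] s(4) by (auto simp: E'_def F_def mem_Times_iff)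
    then show "H (\<psi> (s, h)) \<in> \<psi> ` E'" using psi_phi height[OF s(1,2)] by (metis image_eqI)
  qed
  have cont: "continuous_on D \<omega>" if "D \<subseteq> unit_box" for D by (rule continuous_on_subset[OF w(1) that])
  have int: "\<omega> integrable_on D" if "compact D" "D \<subseteq> unit_box" for D
    using set_borel_integral_eq_integral(1)[of D \<omega>] borel_integrable_compact[OF that(1) cont[OF that(2)]]
    by (simp add: set_integrable_def)
  have cpsi: "compact (\<psi> ` D)" if "compact D" "D \<subseteq> unit_box" for D
    using compact_continuous_image[OF continuous_on_subset[OF cont_psi that(2)] that(1)] .
  have intr: "\<rho> integrable_on D" if "compact D" for D
    using set_borel_integral_eq_integral(1)[of D \<rho>] borel_integrable_compact[OF that continuous_on_subset[OF rho_cont]]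
    by (simp add: set_integrable_def)
  have EU: "\<psi> ` E \<subseteq> U" using sub psi_V V(2) by blast
  have cHE: "compact (H ` \<psi> ` E)"
    using compact_continuous_image[OF _ cpsi[OF cE(1) sub(1)], of H] H EU continuous_on_subset
    unfolding leaf_map_def by blast
  have "integral E \<omega> = integral (\<psi> ` E) \<rho>" using w(4)[OF cE(1) sub(1)] by simp
  also have "\<dots> = integral (H ` \<psi> ` E) \<rho>" using mass[OF cpsi[OF cE(1) sub(1)] EU] by simp
  also have "\<dots> \<le> integral (\<psi> ` E') \<rho>"
    by (rule integral_subset_le[OF HE intr[OF cHE] intr[OF cpsi[OF cE(2) sub(2)]]]) (simp add: rho_nonneg)
  also have "\<dots> = integral E' \<omega>" by (rule w(4)[OF cE(2) sub(2)])
  finally have main: "integral E \<omega> \<le> integral E' \<omega>" .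
  define X where "X = {x1..x2} \<times> ?I"
  define R where "R = {r1..r2} \<times> ?I"
  define S where "S = {a..b} \<times> ?I"
  have XRS: "compact X" "compact R" "compact S" "X \<subseteq> E" "S \<subseteq> E" "E' \<subseteq> X \<union> R" "R \<subseteq> ?B" "X \<inter> S = {}"
    using x ab d eps by (auto simp: X_def R_def S_def E_def E'_def intro!: compact_Times)
  have bx: "X \<subseteq> unit_box" "R \<subseteq> unit_box" "S \<subseteq> unit_box" using XRS sub Bbox by blast+
  have iX: "\<omega> integrable_on X" and iR: "\<omega> integrable_on R" and iS: "\<omega> integrable_on S"
    and iE: "\<omega> integrable_on E" and iE': "\<omega> integrable_on E'"
    by (rule int[OF XRS(1) bx(1)] int[OF XRS(2) bx(2)] int[OF XRS(3) bx(3)] int[OF cE(1) sub(1)] int[OF cE(2) sub(2)])+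
  have iXR: "\<omega> integrable_on X \<union> R" and iXS: "\<omega> integrable_on X \<union> S"
    by (rule int[OF compact_Un[OF XRS(1,2)] Un_least[OF bx(1,2)]] int[OF compact_Un[OF XRS(1,3)] Un_least[OF bx(1,3)]])+
  have nn: "0 \<le> \<omega> z" if "z \<in> D" "D \<subseteq> unit_box" for z D by (rule w(2)[OF subsetD[OF that(2,1)]])
  have "integral E' \<omega> \<le> integral (X \<union> R) \<omega>"
    by (rule integral_subset_le[OF XRS(6) iE' iXR]) (intro ballI, erule nn, rule Un_least[OF bx(1,2)])
  also have "\<dots> \<le> integral X \<omega> + integral R \<omega>"
    by (rule integral_Un_le[OF iX iR iXR], erule nn, rule Un_least[OF bx(1,2)])
  finally have 1: "integral E' \<omega> \<le> integral X \<omega> + integral R \<omega>" .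
  have "integral X \<omega> + integral S \<omega> = integral (X \<union> S) \<omega>"
    by (rule integral_Un[symmetric, OF iX iS]) (simp add: XRS(8))
  also have "\<dots> \<le> integral E \<omega>"
    by (rule integral_subset_le[OF Un_least[OF XRS(4,5)] iXS iE]) (intro ballI, erule nn, rule sub(1))
  finally have 2: "integral X \<omega> + integral S \<omega> \<le> integral E \<omega>" .
  have "w0 * ((b - a) * (h0 + \<epsilon> - h0)) \<le> integral ({a..b} \<times> ?I) \<omega>"
  proof (rule integral_rectangle_bounds(1))
    show "continuous_on ({a..b} \<times> ?I) \<omega>" using cont[OF bx(3)] by (simp add: S_def)
    fix q assume q: "q \<in> {a..b} \<times> ?I"
    have "dist q (p, h0) \<le> \<bar>fst q - p\<bar> + \<bar>snd q - h0\<bar>"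
      by (cases q) (simp add: dist_Pair_Pair dist_real_def sqrt_sum_squares_le_sum_abs)
    also have "\<dots> \<le> d + d"
    proof (rule add_mono)
      have "fst q \<in> {p-d..p+d}" using subsetD[OF ab(1), of "fst q"] q by auto
      then show "\<bar>fst q - p\<bar> \<le> d" by auto
      show "\<bar>snd q - h0\<bar> \<le> d" using q eps by auto
    qed
    also have "\<dots> < d1" using d by simp
    finally have "dist (\<omega> q) (\<omega> (p, h0)) < w0" by (rule d1(2))
    then have "\<bar>\<omega> q - \<omega> (p, h0)\<bar> < w0" by (simp only: dist_real_def)
    then show "w0 \<le> \<omega> q" using w0_def by linarith
  qed (use ab' eps in auto)
  then have 3: "w0 * d * \<epsilon> \<le> integral S \<omega>" by (simp add: S_def ab(2) mult.assoc)
  have "integral ({r1..r2} \<times> ?I) \<omega> \<le> C * ((r2 - r1) * (h0 + \<epsilon> - h0))"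
    by (rule integral_rectangle_bounds(2))
       (use cont[OF bx(2)] Cw[OF subsetD[OF XRS(7)]] x(4) eps in \<open>auto simp: R_def\<close>)
  then have "integral R \<omega> \<le> C * (r2 - r1) * \<epsilon>" by (simp add: R_def mult.assoc)
  also have "\<dots> \<le> C * \<eta> * \<epsilon>" using x(5) C eps(1) by (intro mult_right_mono mult_left_mono) auto
  finally have "w0 * d * \<epsilon> \<le> C * \<eta> * \<epsilon>" using 1 2 3 main by linarith
  then have "w0 * d \<le> C * \<eta>" using eps(1) by simp
  then show False using eta1 by simp
qed
end

section \<open>Periodic leaves of an area-preserving foliation\<close>

text \<open>The properties of the billiard map near \<open>C\<close> that make rational leaves periodic. The density \<open>\<rho>\<close> may
  vanish over a nowhere dense set of base points, and \<open>T_twist\<close> says that a phase point is determined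
  by its base point and the next one.\<close>

locale measured_foliation =
  fixes P :: real and U :: "(real \<times> real) set" and \<F> :: "(real \<times> real) set set"
    and \<rho> :: "real \<times> real \<Rightarrow> real" and T :: "real \<times> real \<Rightarrow> real \<times> real"
  assumes P: "0 < P" and oU: "open U" and fol: "C1_foliation U \<F>"
    and leaf: "\<And>L. L \<in> \<F> \<Longrightarrow> \<exists>c. rotational_param P c \<and> range c = L"
    and rho_cont: "continuous_on UNIV \<rho>" and rho_nonneg: "\<And>z. 0 \<le> \<rho> z"
    and rho_period: "\<And>z. \<rho> (z + (P, 0)) = \<rho> z"
    and rho_pos: "\<And>a b. a < b \<Longrightarrow> \<exists>t\<in>{a<..<b}. \<forall>y. (t, y) \<in> U \<longrightarrow> \<rho> (t, y) \<noteq> 0"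
    and T_cont: "continuous_on U T" and T_inj: "inj_on T U"
    and T_leaf: "\<And>L. L \<in> \<F> \<Longrightarrow> T ` L = L"
    and T_period: "\<And>z. z \<in> U \<Longrightarrow> T (z + (P, 0)) = T z + (P, 0)"
    and T_twist: "\<And>z z'. z \<in> U \<Longrightarrow> z' \<in> U \<Longrightarrow> fst z = fst z' \<Longrightarrow> fst (T z) = fst (T z') \<Longrightarrow> z = z'"
    and T_mass: "\<And>E. compact E \<Longrightarrow> E \<subseteq> U \<Longrightarrow> integral (T ` E) \<rho> = integral E \<rho>"
begin

lemma Un: "\<Union>\<F> = U" and disj: "pairwise disjnt \<F>"
  using fol by (simp_all add: C1_foliation_def)

text \<open>Both properties are inherited by compositions, which gives them for the return map below.\<close>

definition preserving :: "(real \<times> real \<Rightarrow> real \<times> real) \<Rightarrow> bool"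
  where "preserving F \<longleftrightarrow> leaf_map U \<F> F \<and>
    (\<forall>E. compact E \<and> E \<subseteq> U \<longrightarrow> integral (F ` E) \<rho> = integral E \<rho>)"

lemma leaf_map_image: "leaf_map U \<F> F \<Longrightarrow> F ` U \<subseteq> U"
  using Un unfolding leaf_map_def by blast

lemma leaf_map_comp:
  assumes "leaf_map U \<F> F" "leaf_map U \<F> G"
  shows "leaf_map U \<F> (F \<circ> G)"
proof -
  have "continuous_on U (F \<circ> G)"
    using assms leaf_map_image[OF assms(2)] unfolding leaf_map_def
    by (intro continuous_on_compose) (auto elim: continuous_on_subset)
  moreover have "(F \<circ> G) ` L \<subseteq> L" if "L \<in> \<F>" for L
    by (rule image_subsetI) (simp add: leaf_mapD[OF assms(1) that] leaf_mapD[OF assms(2) that])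
  ultimately show ?thesis by (simp add: leaf_map_def)
qed

lemma preserving_comp:
  assumes F: "preserving F" and G: "preserving G" shows "preserving (F \<circ> G)"
  unfolding preserving_def
proof (intro conjI allI impI, goal_cases)
  case 1 show ?case using leaf_map_comp F G by (simp add: preserving_def)
next
  case (2 E)
  then have E: "compact E" "E \<subseteq> U" by auto
  have "compact (G ` E)"
    using G E unfolding preserving_def leaf_map_def
    by (intro compact_continuous_image) (auto elim: continuous_on_subset)
  moreover have "G ` E \<subseteq> U" using G E leaf_map_image unfolding preserving_def by blast
  ultimately have "integral (F ` G ` E) \<rho> = integral E \<rho>" using F G E by (simp add: preserving_def)
  then show ?case by (simp only: image_comp)
qed

lemma leaf_map_power: "leaf_map U \<F> F \<Longrightarrow> leaf_map U \<F> (F ^^ n)"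
proof (induction n)
  case 0 show ?case by (simp add: leaf_map_def id_def)
next
  case (Suc n) then show ?case using leaf_map_comp[of F "F ^^ n"] by (simp only: funpow.simps)
qed

lemma preserving_power: "preserving F \<Longrightarrow> preserving (F ^^ n)"
proof (induction n)
  case 0 show ?case by (simp add: preserving_def leaf_map_def id_def)
next
  case (Suc n) then show ?case using preserving_comp[of F "F ^^ n"] by (simp only: funpow.simps)
qed

lemma preserving_shift: "preserving (\<lambda>z. z + (of_int n * P, 0))"
  unfolding preserving_def leaf_map_def
proof (intro conjI ballI allI impI, goal_cases)
  case 1 show ?case by (intro continuous_intros)
next
  case (2 L)
  then obtain c where c: "rotational_param P c" "range c = L" using leaf by blast
  show ?case
  proof (rule image_subsetI)
    fix z assume "z \<in> L"
    then obtain u where "z = c u" using c(2) by blast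
    then have "z + (of_int n * P, 0) = c (u + of_int n)"
      using rotational_param_shift[OF c(1)] by simp
    then show "z + (of_int n * P, 0) \<in> L" using c(2) by (metis rangeI)
  qed
next
  case (3 E)
  have per: "\<rho> (z + (of_int n * P, 0)) = \<rho> z" for z
  proof (induction n rule: int_induct[where k=0])
    case base then show ?case by (simp add: zero_prod_def[symmetric])
  next
    case (step1 i)
    have "z + (of_int (i + 1) * P, 0) = (z + (of_int i * P, 0)) + (P, 0)"
      by (simp add: prod_eq_iff algebra_simps)
    then show ?case using rho_period step1 by metis
  next
    case (step2 i)
    have "z + (of_int i * P, 0) = (z + (of_int (i - 1) * P, 0)) + (P, 0)"
      by (simp add: prod_eq_iff algebra_simps)
    then show ?case using rho_period step2 by metis
  qed
  have "integral ((\<lambda>z. z + (of_int n * P, 0)) ` E) \<rho> =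
      integral E (\<lambda>z. \<bar>jac (\<lambda>x. x)\<bar> * \<rho> (z + (of_int n * P, 0)))"
  proof (rule integral_image_plane)
    show "((\<lambda>z. z + (of_int n * P, 0)) has_derivative (\<lambda>x. x)) (at z within E)" for z
      by (auto intro!: derivative_eq_intros)
    show "continuous_on E (\<lambda>z. \<bar>jac (\<lambda>x. x)\<bar> * \<rho> (z + (of_int n * P, 0)))"
      unfolding per by (intro continuous_intros continuous_on_subset[OF rho_cont]) auto
  qed (use 3 continuous_on_subset[OF rho_cont] in \<open>auto simp: inj_on_def\<close>)
  then show ?case by (simp add: per jac_def)
qed

lemma preserving_T: "preserving T"
  unfolding preserving_def leaf_map_def using T_cont T_leaf T_mass by auto

lemma T_image: "T ` U = U"
  using T_leaf Un by (metis (no_types, lifting) image_Union image_cong image_ident)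

lemma T_inverse:
  obtains T' where "leaf_map U \<F> T'" "\<And>z. z \<in> U \<Longrightarrow> T' (T z) = z"
proof -
  obtain T' where h: "homeomorphism U (T ` U) T T'"
    using invariance_of_domain_homeomorphism[OF oU T_cont _ T_inj] by auto
  have 1: "T' (T z) = z" if "z \<in> U" for z using h that by (simp add: homeomorphism_def)
  have "T' ` L \<subseteq> L" if L: "L \<in> \<F>" for L
  proof (rule image_subsetI)
    fix z assume "z \<in> L"
    then obtain w where w: "w \<in> L" "z = T w" using T_leaf[OF L] by blast
    then show "T' z \<in> L" using 1[of w] UnionI[OF L w(1)] Un by simp
  qed
  then have "leaf_map U \<F> T'" using h T_image by (simp add: leaf_map_def homeomorphism_def)
  then show ?thesis using that 1 by blast
qed

text \<open>The circle map is determined by the lift of \<open>T\<close>. It preserves orientation because \<open>T\<close> commutes with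
  the translation by one period.\<close>

lemma leaf_circle_map:
  assumes L: "L \<in> \<F>" and c: "rotational_param P c" "range c = L"
  obtains f where "continuous_on UNIV f" "strict_mono f" "\<And>u. f (u + 1) = f u + 1"
    "\<And>u. T (c u) = c (f u)"
proof -
  have LU: "L \<subseteq> U" using L Un by blast
  have inj: "inj c" and cc: "continuous_on UNIV c" using c by (auto simp: rotational_param_def)
  have "\<forall>u. \<exists>v. T (c u) = c v" using T_leaf[OF L] c(2) by (metis imageE imageI rangeI)
  then obtain f where f: "\<And>u. T (c u) = c (f u)" using choice by metis
  have "continuous_on UNIV f"
    unfolding continuous_on_def
  proof
    fix u :: real
    have "continuous_on UNIV (\<lambda>u. T (c u))"
      using continuous_on_compose2[OF T_cont cc] LU c(2) by blast
    then have "((\<lambda>u. T (c u)) \<longlongrightarrow> T (c u)) (at u)"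
      by (simp add: continuous_on_def)
    then show "(f \<longlongrightarrow> f u) (at u within UNIV)"
      using rotational_param_tendsto[OF P c(1)] unfolding f by blast
  qed
  moreover have per: "f (u + 1) = f u + 1" for u
  proof -
    have "c (f (u + 1)) = T (c u + (P, 0))" using c(1) f[of "u + 1"] by (simp add: rotational_param_def)
    also have "\<dots> = T (c u) + (P, 0)" using T_period[of "c u"] LU c(2) by blast
    also have "\<dots> = c (f u + 1)" using c(1) f[of u] by (simp add: rotational_param_def)
    finally show ?thesis using inj by (simp add: inj_def)
  qed
  moreover have "inj f"
  proof (rule injI)
    fix u v assume "f u = f v"
    then have "T (c u) = T (c v)" using f by simp
    moreover have "c u \<in> U" "c v \<in> U" using LU c(2) by auto
    ultimately have "c u = c v" using T_inj by (meson inj_onD)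
    then show "u = v" using inj by (meson injD)
  qed
  ultimately show ?thesis using that f continuous_strict_mono_of_inj by metis
qed

context
  fixes L :: "(real \<times> real) set" and c :: "real \<Rightarrow> real \<times> real" and f :: "real \<Rightarrow> real" and k :: nat and r :: int
  assumes L: "L \<in> \<F>" and c: "rotational_param P c" "range c = L"
    and f: "continuous_on UNIV f" "strict_mono f" "\<And>u. T (c u) = c (f u)"
begin

definition return_map :: "real \<Rightarrow> real" where "return_map u = (f ^^ k) u - of_int r"
definition phase_return :: "real \<times> real \<Rightarrow> real \<times> real" where
  "phase_return z = (T ^^ k) z + (of_int (-r) * P, 0)"

lemma c_in_U: "c u \<in> U" using L c(2) Un by blast

lemma T_pow_c: "(T ^^ n) (c u) = c ((f ^^ n) u)"
  by (induction n) (auto simp: f(3))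

lemma phase_return_c: "phase_return (c u) = c (return_map u)"
  using rotational_param_shift[OF c(1), of "(f ^^ k) u" "-r"]
  by (simp add: phase_return_def T_pow_c return_map_def)

lemma preserving_phase_return: "preserving phase_return"
proof -
  have "phase_return = (\<lambda>z. z + (of_int (-r) * P, 0)) \<circ> (T ^^ k)" by (auto simp: phase_return_def)
  then show ?thesis using preserving_comp[OF preserving_shift preserving_power[OF preserving_T]] by (simp only:)
qed

lemma phase_return_inverse:
  obtains G where "leaf_map U \<F> G" "\<And>z. z \<in> U \<Longrightarrow> G (phase_return z) = z"
proof -
  obtain T' where T': "leaf_map U \<F> T'" "\<And>z. z \<in> U \<Longrightarrow> T' (T z) = z" using T_inverse by blast
  have TU: "(T ^^ n) z \<in> U" if "z \<in> U" for n z using that T_image by (induction n) auto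
  have pw: "(T' ^^ n) ((T ^^ n) z) = z" if "z \<in> U" for n z
  proof (induction n)
    case (Suc n)
    have "(T' ^^ Suc n) ((T ^^ Suc n) z) = (T' ^^ n) (T' (T ((T ^^ n) z)))"
      by (simp add: funpow_swap1)
    then show ?case using Suc T'(2)[OF TU[OF that]] by simp
  qed simp
  define G where "G = (T' ^^ k) \<circ> (\<lambda>z. z + (of_int r * P, 0))"
  have "leaf_map U \<F> G" unfolding G_def
    using leaf_map_comp[OF leaf_map_power[OF T'(1)]] preserving_shift by (simp add: preserving_def)
  moreover have "G (phase_return z) = z" if "z \<in> U" for z
  proof -
    have "phase_return z + (of_int r * P, 0) = (T ^^ k) z" by (simp add: phase_return_def prod_eq_iff)
    then show ?thesis using pw[OF that] by (simp add: G_def)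
  qed
  ultimately show ?thesis using that by blast
qed

lemma return_mono: "strict_mono return_map"
  using strict_mono_funpow[OF f(2), of k] by (simp add: strict_mono_def return_map_def)

lemma return_cont: "continuous_on UNIV return_map"
  unfolding return_map_def[abs_def] by (intro continuous_intros continuous_on_funpow f(1))

text \<open>The square of the return map has \<open>c b\<close> as a fixed point and preserves heights near it. If it moves
  \<open>c v\<close> towards \<open>c b\<close>, then it shrinks the arc between them, and \<open>\<rho>\<close> vanishes at the abandoned end.\<close>

lemma attracted_arc_massless:
  assumes b: "return_map b = b"
  shows "\<exists>\<delta>>0. \<forall>v. \<bar>v - b\<bar> < \<delta> \<longrightarrow> return_map (return_map v) \<in> closed_segment v b \<longrightarrow>
    return_map (return_map v) \<noteq> v \<longrightarrow> \<rho> (c v) = 0"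
proof -
  let ?g = "\<lambda>v. return_map (return_map v)"
  obtain V \<phi> \<psi> where ch: "c b \<in> V" "open V" "V \<subseteq> U" "homeomorphism V unit_box \<phi> \<psi>" "C1_on \<phi> V" "C1_on \<psi> unit_box"
     "\<And>L K. L \<in> \<F> \<Longrightarrow> K \<in> components (L \<inter> V) \<Longrightarrow> \<exists>h. \<phi> ` K = {-1<..<1} \<times> {h}"
    using fol c_in_U[of b] unfolding C1_foliation_def by metis
  interpret weighted_flow_box P U V \<F> \<phi> \<psi> \<rho>
    by unfold_locales (use P Un disj leaf oU ch rho_cont rho_nonneg in auto)
  obtain s0 h0 where sh: "\<phi> (c b) = (s0, h0)" by (metis surj_pair)
  have box0: "(s0, h0) \<in> unit_box" using phi_box[OF ch(1)] sh by simp
  have psi0: "\<psi> (s0, h0) = c b" using psi_phi[OF ch(1)] sh by simp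
  obtain G' where G': "leaf_map U \<F> G'" "\<And>z. z \<in> U \<Longrightarrow> G' (phase_return z) = z"
    using phase_return_inverse by blast
  have G: "leaf_map U \<F> phase_return" using preserving_phase_return by (simp add: preserving_def)
  have fixb: "phase_return (\<psi> (s0, h0)) = \<psi> (s0, h0)" using psi0 phase_return_c b by simp
  obtain e where e: "0 < e" "{s0-e<..<s0+e} \<times> {h0-e<..<h0+e} \<subseteq> unit_box"
    "\<And>s h. s \<in> {s0-e<..<s0+e} \<Longrightarrow> h \<in> {h0-e<..<h0+e} \<Longrightarrow>
       phase_return (phase_return (\<psi> (s, h))) \<in> V \<and> snd (\<phi> (phase_return (phase_return (\<psi> (s, h))))) = h"
    using square_preserves_heights[OF G G' box0 fixb] by metis
  define H where "H = phase_return \<circ> phase_return"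
  have H: "preserving H" unfolding H_def by (rule preserving_comp[OF preserving_phase_return preserving_phase_return])
  have Hc: "H (c v) = c (?g v)" for v by (simp add: H_def phase_return_c)
  have cc: "continuous_on UNIV c" and injc: "inj c" using c(1) by (auto simp: rotational_param_def)
  define s where "s v = fst (\<phi> (c v))" for v
  have oV: "open (c -` V)" using cc ch(2) open_vimage continuous_on_eq_continuous_at open_UNIV by blast
  have "continuous_on (c -` V) (\<lambda>v. \<phi> (c v))"
    by (rule continuous_on_compose2[OF cont_phi continuous_on_subset[OF cc]]) auto
  then have s_cont: "continuous_on (c -` V) s" unfolding s_def by (rule continuous_on_fst)
  then have "isCont s b" using oV ch(1) by (simp add: continuous_on_eq_continuous_at)
  then obtain d1 where d1: "0 < d1" "\<And>v. dist v b < d1 \<Longrightarrow> dist (s v) (s b) < e"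
    unfolding continuous_at_eps_delta using e(1) by blast
  obtain d2 where d2: "0 < d2" "ball b d2 \<subseteq> c -` V" using oV ch(1) by (meson openE vimageI2)
  define \<delta> where "\<delta> = min d1 d2"
  have \<delta>: "0 < \<delta>" "\<delta> \<le> d1" "\<delta> \<le> d2" using d1 d2 by (auto simp: \<delta>_def)
  have inV: "c v \<in> V" if "\<bar>v - b\<bar> < \<delta>" for v
    using d2(2) \<delta> that by (auto simp: subset_iff dist_real_def abs_minus_commute)
  have chart: "\<phi> (c v) = (s v, h0)" if v: "\<bar>v - b\<bar> < \<delta>" for v
  proof -
    have "snd (\<phi> (c v)) = snd (\<phi> (c b))"
    proof (rule connected_height[OF L])
      show "connected (c ` ball b \<delta>)"
        by (intro connected_continuous_image continuous_on_subset[OF cc]) auto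
      show "c ` ball b \<delta> \<subseteq> L \<inter> V" using inV c(2) by (auto simp: dist_real_def abs_minus_commute)
    qed (use v \<delta>(1) in \<open>auto simp: dist_real_def abs_minus_commute\<close>)
    then show ?thesis using sh by (simp add: s_def prod_eq_iff)
  qed
  have sb: "s b = s0" using sh by (simp add: s_def)
  have s_near: "s v \<in> {s0-e<..<s0+e}" if "\<bar>v - b\<bar> < \<delta>" for v
    using d1(2)[of v] that \<delta>(2) sb by (auto simp: dist_real_def)
  have s_inj: "v = w" if "\<bar>v - b\<bar> < \<delta>" "\<bar>w - b\<bar> < \<delta>" "s v = s w" for v w
  proof -
    have "\<phi> (c v) = \<phi> (c w)" using chart that by simp
    then have "c v = c w" using psi_phi inV that by metis
    then show ?thesis using injc by (simp add: inj_eq)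
  qed
  have seg_near: "\<bar>w - b\<bar> < \<delta>" if "w \<in> closed_segment v b" "\<bar>v - b\<bar> < \<delta>" for v w
    using that by (auto simp: closed_segment_eq_real_ivl split: if_splits)
  have s_seg: "s ` closed_segment v w = closed_segment (s v) (s w)" if "\<bar>v - b\<bar> < \<delta>" "\<bar>w - b\<bar> < \<delta>" for v w
  proof (rule continuous_injective_image_segment_1)
    have n: "\<bar>x - b\<bar> < \<delta>" if "x \<in> closed_segment v w" for x
      using that \<open>\<bar>v - b\<bar> < \<delta>\<close> \<open>\<bar>w - b\<bar> < \<delta>\<close> by (auto simp: closed_segment_eq_real_ivl split: if_splits)
    show "continuous_on (closed_segment v w) s"
      by (rule continuous_on_subset[OF s_cont]) (use n inV in blast)
    show "inj_on s (closed_segment v w)" by (rule inj_onI) (use s_inj n in blast)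
  qed
  have "\<rho> (c v) = 0"
    if v: "\<bar>v - b\<bar> < \<delta>" and g: "?g v \<in> closed_segment v b" "?g v \<noteq> v" for v
  proof -
    have gb: "?g b = b" using b by simp
    have bb: "\<bar>b - b\<bar> < \<delta>" using \<delta>(1) by simp
    have gv: "\<bar>?g v - b\<bar> < \<delta>" by (rule seg_near[OF g(1) v])
    have seg_sub: "closed_segment (s v) s0 \<subseteq> {s0-e<..<s0+e}"
      using s_near[OF v] e(1) by (auto simp: closed_segment_eq_real_ivl split: if_splits)
    have h01: "(h0 :: real) \<in> {-1<..<1}" using box0 by simp
    have "(s0, h0 + e/2) \<in> unit_box" using e(1) by (intro subsetD[OF e(2)]) auto
    then have h1: "h0 + e/2 < 1" by simp
    have "\<rho> (\<psi> (s v, h0)) = 0"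
    proof (rule lost_arc_massless[where H=H and e="e/2" and q=s0 and p'="s (?g v)"])
      show "leaf_map U \<F> H" "\<And>E. compact E \<Longrightarrow> E \<subseteq> U \<Longrightarrow> integral (H ` E) \<rho> = integral E \<rho>"
        using H by (auto simp: preserving_def)
      show "h0 \<in> {-1<..<1}" "0 < e / 2" "h0 + e / 2 < 1" using h01 e(1) h1 by auto
      show "closed_segment (s v) s0 \<subseteq> {-1<..<1}"
      proof
        fix x assume "x \<in> closed_segment (s v) s0"
        then have "(x, h0) \<in> unit_box" using seg_sub e(1) by (intro subsetD[OF e(2)]) auto
        then show "x \<in> {-1<..<1}" by simp
      qed
      show "s (?g v) \<in> closed_segment (s v) s0"
        using s_seg[OF v bb] g(1) sb by blast
      show "s (?g v) \<noteq> s v" using s_inj[OF gv v] g(2) by blast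
      show "H (\<psi> (x, h)) \<in> V \<and> snd (\<phi> (H (\<psi> (x, h)))) = h"
        if "x \<in> closed_segment (s v) s0" "h \<in> {h0..h0+e/2}" for x h
        using e(3)[of x h] subsetD[OF seg_sub that(1)] that(2) e(1) by (simp add: H_def)
      show "fst (\<phi> (H (\<psi> (x, h0)))) \<in> closed_segment (s (?g v)) s0" if x: "x \<in> closed_segment (s v) s0" for x
      proof -
        obtain w where w: "w \<in> closed_segment v b" "x = s w" using x s_seg[OF v bb] sb by (metis imageE)
        have wn: "\<bar>w - b\<bar> < \<delta>" by (rule seg_near[OF w(1) v])
        have "\<psi> (x, h0) = c w" using chart[OF wn] psi_phi[OF inV[OF wn]] w(2) by simp
        then have "fst (\<phi> (H (\<psi> (x, h0)))) = s (?g w)" by (simp add: Hc s_def)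
        moreover have "?g w \<in> closed_segment (?g v) b"
        proof -
          have m: "?g x \<le> ?g y" if "x \<le> y" for x y
            using return_mono that by (simp add: strict_mono_less_eq)
          show ?thesis using w(1) m[of v w] m[of w v] m[of w b] m[of b w] gb
            by (auto simp: closed_segment_eq_real_ivl split: if_splits)
        qed
        ultimately show ?thesis using s_seg[OF gv bb] sb by blast
      qed
    qed
    then show ?thesis using chart[OF v] psi_phi[OF inV[OF v]] by simp
  qed
  then show ?thesis using \<delta>(1) by blast
qed

lemma constant_if_massless:
  fixes a b :: real and h :: "real \<Rightarrow> real"
  assumes h: "continuous_on {a<..<b} h" and z: "\<And>v. v \<in> {a<..<b} \<Longrightarrow> \<exists>y. (h v, y) \<in> U \<and> \<rho> (h v, y) = 0"
    and vw: "v \<in> {a<..<b}" "w \<in> {a<..<b}"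
  shows "h v = h w"
proof -
  have le: "h v \<ge> h w" if vw: "v \<in> {a<..<b}" "w \<in> {a<..<b}" for v w
  proof (rule ccontr)
    assume "\<not> h v \<ge> h w"
    then obtain t where t: "t \<in> {h v<..<h w}" "\<And>y. (t, y) \<in> U \<Longrightarrow> \<rho> (t, y) \<noteq> 0"
      using rho_pos[of "h v" "h w"] by auto
    have "connected (h ` {a<..<b})" by (rule connected_continuous_image[OF h connected_Ioo])
    then have "t \<in> h ` {a<..<b}"
      using connectedD_interval[of "h ` {a<..<b}" "h v" "h w" t] vw t(1) by auto
    then show False using z t(2) by blast
  qed
  show ?thesis using le[OF vw] le[OF vw(2,1)] by simp
qed

text \<open>Otherwise a point moves under the return map, and all points between it and the nearest fixed point \<open>b\<close>
  in the direction of motion approach \<open>b\<close>. The density vanishes on an arc ending at \<open>b\<close> and, \<open>f\<close>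
  commuting with the return map, on the image of this arc. Then two consecutive base points are constant
  along the arc, and with them the phase point.\<close>

lemma return_map_identity:
  assumes u0: "return_map u0 = u0" and per: "\<And>u. f (u + 1) = f u + 1"
  shows "return_map u = u"
proof (rule ccontr)
  assume nu: "return_map u \<noteq> u"
  let ?g = return_map
  have f_shift: "f (v + of_int n) = f v + of_int n" for v and n :: int
    using shift_commute[of f 1 v n] per by simp
  have "(f ^^ m) (v + of_int n) = (f ^^ m) v + of_int n" for m v and n :: int
    by (induction m) (auto simp: f_shift)
  then have gper: "?g (v + of_int n) = ?g v + of_int n" for v and n :: int
    by (simp add: return_map_def)
  have gm: "?g v < ?g w \<longleftrightarrow> v < w" for v w using return_mono by (simp add: strict_mono_less)
  have cfix: "closed {v. ?g v = v}"
    by (intro closed_Collect_eq continuous_on_id return_cont)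
  have "\<exists>b a d. ?g b = b \<and> a < d \<and> (b = a \<or> b = d) \<and>
      (\<forall>v\<in>{a<..<d}. ?g (?g v) \<in> closed_segment v b \<and> ?g (?g v) \<noteq> v)"
  proof (cases "u < ?g u")
    case True
    define S where "S = {v. ?g v = v} \<inter> {u..}"
    have "u0 + of_int \<lceil>u - u0\<rceil> \<in> S" using gper[of u0] u0 by (auto simp: S_def) linarith
    then have ne: "S \<noteq> {}" by blast
    have bd: "bdd_below S" by (auto simp: S_def)
    have cS: "closed S" unfolding S_def by (intro closed_Int cfix closed_atLeast)
    define b where "b = Inf S"
    have bS: "b \<in> S" unfolding b_def by (rule closed_contains_Inf[OF ne bd cS])
    have "b \<noteq> u" using bS True by (auto simp: S_def)
    then have ub: "u < b" "?g b = b" using bS by (auto simp: S_def)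
    have up: "v < ?g v" if v: "u < v" "v < b" for v
    proof (rule ccontr)
      assume "\<not> v < ?g v"
      have "\<exists>x\<ge>u. x \<le> v \<and> x - ?g x = 0"
        by (rule IVT') (use True \<open>\<not> v < ?g v\<close> v in \<open>auto intro!: continuous_intros continuous_on_subset[OF return_cont]\<close>)
      then obtain x where "u \<le> x" "x \<le> v" "?g x = x" by auto
      then have "x \<in> S" by (simp add: S_def)
      then have "b \<le> x" unfolding b_def by (rule cInf_lower[OF _ bd])
      then show False using \<open>x \<le> v\<close> v by simp
    qed
    have "?g (?g v) \<in> closed_segment v b \<and> ?g (?g v) \<noteq> v" if v: "v \<in> {u<..<b}" for v
    proof -
      have "v < ?g v" using up v by simp
      moreover have "?g v < ?g (?g v)" using calculation gm by simp
      moreover have "?g v < b" using gm[of v b] ub v by simp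
      moreover have "?g (?g v) < b" using gm[of "?g v" b] ub calculation by simp
      ultimately show ?thesis by (auto simp: closed_segment_eq_real_ivl)
    qed
    then show ?thesis using ub by blast
  next
    case False
    then have less: "?g u < u" using nu by simp
    define S where "S = {v. ?g v = v} \<inter> {..u}"
    have "u0 + of_int \<lfloor>u - u0\<rfloor> \<in> S" using gper[of u0] u0 by (auto simp: S_def) linarith
    then have ne: "S \<noteq> {}" by blast
    have bd: "bdd_above S" by (auto simp: S_def)
    have cS: "closed S" unfolding S_def by (intro closed_Int cfix closed_atMost)
    define b where "b = Sup S"
    have bS: "b \<in> S" unfolding b_def by (rule closed_contains_Sup[OF ne bd cS])
    have "b \<noteq> u" using bS less by (auto simp: S_def)
    then have ub: "b < u" "?g b = b" using bS by (auto simp: S_def)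
    have down: "?g v < v" if v: "b < v" "v < u" for v
    proof (rule ccontr)
      assume "\<not> ?g v < v"
      have "\<exists>x\<ge>v. x \<le> u \<and> x - ?g x = 0"
        by (rule IVT') (use less \<open>\<not> ?g v < v\<close> v in \<open>auto intro!: continuous_intros continuous_on_subset[OF return_cont]\<close>)
      then obtain x where "v \<le> x" "x \<le> u" "?g x = x" by auto
      then have "x \<in> S" by (simp add: S_def)
      then have "x \<le> b" unfolding b_def by (rule cSup_upper[OF _ bd])
      then show False using \<open>v \<le> x\<close> v by simp
    qed
    have "?g (?g v) \<in> closed_segment v b \<and> ?g (?g v) \<noteq> v" if v: "v \<in> {b<..<u}" for v
    proof -
      have "?g v < v" using down v by simp
      moreover have "?g (?g v) < ?g v" using calculation gm by simp
      moreover have "b < ?g v" using gm[of b v] ub v by simp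
      moreover have "b < ?g (?g v)" using gm[of b "?g v"] ub calculation by simp
      ultimately show ?thesis by (auto simp: closed_segment_eq_real_ivl)
    qed
    then show ?thesis using ub by blast
  qed
  then obtain b a d where bad: "?g b = b" "a < d" "b = a \<or> b = d"
    "\<And>v. v \<in> {a<..<d} \<Longrightarrow> ?g (?g v) \<in> closed_segment v b \<and> ?g (?g v) \<noteq> v" by blast
  have gf: "?g (f v) = f (?g v)" for v
    using f_shift[of "(f ^^ k) v - of_int r" r] by (simp add: return_map_def funpow_swap1)
  obtain \<delta>1 where \<delta>1: "0 < \<delta>1" "\<And>v. \<bar>v - b\<bar> < \<delta>1 \<Longrightarrow> ?g (?g v) \<in> closed_segment v b \<Longrightarrow> ?g (?g v) \<noteq> v \<Longrightarrow> \<rho> (c v) = 0"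
    using attracted_arc_massless[OF bad(1)] by blast
  have "?g (f b) = f b" using gf bad(1) by simp
  then obtain \<delta>2 where \<delta>2: "0 < \<delta>2" "\<And>v. \<bar>v - f b\<bar> < \<delta>2 \<Longrightarrow> ?g (?g v) \<in> closed_segment v (f b) \<Longrightarrow> ?g (?g v) \<noteq> v \<Longrightarrow> \<rho> (c v) = 0"
    using attracted_arc_massless by blast
  have "isCont f b" using f(1) by (simp add: continuous_on_eq_continuous_at)
  then obtain \<delta>3 where \<delta>3: "0 < \<delta>3" "\<And>v. \<bar>v - b\<bar> < \<delta>3 \<Longrightarrow> \<bar>f v - f b\<bar> < \<delta>2"
    unfolding continuous_at_eps_delta dist_real_def using \<delta>2(1) by blast
  define m where "m = min (min \<delta>1 \<delta>3) (d - a)"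
  have m: "0 < m" "m \<le> \<delta>1" "m \<le> \<delta>3" "m \<le> d - a" using \<delta>1 \<delta>3 bad(2) by (auto simp: m_def)
  obtain a' d' where ad: "a' < d'" "{a'<..<d'} \<subseteq> {a<..<d}" "\<And>v. v \<in> {a'<..<d'} \<Longrightarrow> \<bar>v - b\<bar> < m"
  proof (cases "b = a")
    case True then show ?thesis using m by (intro that[of a "a + m"]) auto
  next
    case False then show ?thesis using m bad(3) by (intro that[of "d - m" d]) auto
  qed
  have fm: "f v \<le> f w \<longleftrightarrow> v \<le> w" and feq: "f v = f w \<longleftrightarrow> v = w" for v w
    using f(2) by (auto simp: strict_mono_less_eq strict_mono_eq)
  have z1: "\<rho> (c v) = 0" if "v \<in> {a'<..<d'}" for v
    using \<delta>1(2)[of v] ad(3)[OF that] bad(4)[OF subsetD[OF ad(2) that]] m by auto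
  have z2: "\<rho> (c (f v)) = 0" if v: "v \<in> {a'<..<d'}" for v
  proof (rule \<delta>2(2))
    have b4: "?g (?g v) \<in> closed_segment v b" "?g (?g v) \<noteq> v" using bad(4)[OF subsetD[OF ad(2) v]] by auto
    show "\<bar>f v - f b\<bar> < \<delta>2" using \<delta>3(2) ad(3)[OF v] m by auto
    show "?g (?g (f v)) \<in> closed_segment (f v) (f b)"
      using b4(1) unfolding gf by (auto simp: closed_segment_eq_real_ivl fm split: if_splits)
    show "?g (?g (f v)) \<noteq> f v" using b4(2) by (simp add: gf feq)
  qed
  have cc: "continuous_on A c" for A using c(1) continuous_on_subset by (auto simp: rotational_param_def)
  define v w where "v = a' + (d' - a') / 3" and "w = a' + (d' - a') / 2"
  have vw: "v \<in> {a'<..<d'}" "w \<in> {a'<..<d'}" "v \<noteq> w" using ad(1) by (auto simp: v_def w_def field_simps)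
  have "fst (c v) = fst (c w)"
  proof (rule constant_if_massless[of a' d' "\<lambda>v. fst (c v)"])
    show "continuous_on {a'<..<d'} (\<lambda>v. fst (c v))" by (intro continuous_on_fst cc)
    show "\<exists>y. (fst (c v), y) \<in> U \<and> \<rho> (fst (c v), y) = 0" if "v \<in> {a'<..<d'}" for v
      using z1[OF that] c_in_U[of v] by (intro exI[of _ "snd (c v)"]) simp
  qed (use vw in auto)
  moreover have "fst (c (f v)) = fst (c (f w))"
  proof (rule constant_if_massless[of a' d' "\<lambda>v. fst (c (f v))"])
    show "continuous_on {a'<..<d'} (\<lambda>v. fst (c (f v)))"
      by (intro continuous_on_fst continuous_on_compose2[OF cc[of UNIV] continuous_on_subset[OF f(1)]]) auto
    show "\<exists>y. (fst (c (f v)), y) \<in> U \<and> \<rho> (fst (c (f v)), y) = 0" if "v \<in> {a'<..<d'}" for v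
      using z2[OF that] c_in_U[of "f v"] by (intro exI[of _ "snd (c (f v))"]) simp
  qed (use vw in auto)
  ultimately have "c v = c w" using T_twist[OF c_in_U c_in_U] f(3) by metis
  then show False using c(1) vw(3) by (auto simp: rotational_param_def inj_def)
qed

end
end

section \<open>Twist maps with a foliated neighbourhood\<close>

text \<open>If the displacement \<open>f\<^sup>k u - u - r\<close> had no zero, it would have a constant sign and be bounded away
  from zero by periodicity, and the rotation number would differ from \<open>r / k\<close>.\<close>

lemma rotation_number_periodic_point:
  fixes k :: nat and r :: int
  assumes "0 < k" and "has_rotation_number P T C (of_int r / of_nat k)"
  obtains c f u where "rotational_param P c" "range c = C" "\<And>u. T (c u) = c (f u)" "(f ^^ k) u = u + of_int r"
proof -
  obtain c f where cf: "rotational_param P c" "range c = C" "continuous_on UNIV f"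
    and cf': "\<forall>u. f (u + 1) = f u + 1" "\<forall>u. T (c u) = c (f u)"
    "\<forall>u. (\<lambda>n. (f ^^ n) u / real n) \<longlonglongrightarrow> of_int r / of_nat k"
    using assms(2) unfolding has_rotation_number_def by blast
  note f_per = cf'(1)[rule_format] and f_T = cf'(2)[rule_format] and f_lim = cf'(3)[rule_format]
  define h where "h u = (f ^^ k) u - u - of_int r" for u
  have hc: "continuous_on UNIV h" unfolding h_def by (intro continuous_intros continuous_on_funpow cf(3))
  have hper: "h (u + of_int n) = h u" for u and n :: int
    using shift_commute[of "f ^^ k" 1 u n] funpow_shift[of f 1] f_per by (simp add: h_def)
  have "\<exists>u. h u = 0"
  proof (rule ccontr)
    assume nz: "\<nexists>u. h u = 0"
    have "continuous_on {0..1} (\<lambda>u. \<bar>h u\<bar>)"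
      by (intro continuous_intros continuous_on_subset[OF hc]) auto
    then obtain m where m: "m \<in> {0..1}" "\<And>u. u \<in> {0..1} \<Longrightarrow> \<bar>h m\<bar> \<le> \<bar>h u\<bar>"
      using continuous_attains_inf[of "{0..1::real}" "\<lambda>u. \<bar>h u\<bar>"] by auto
    define d where "d = \<bar>h m\<bar>"
    have d: "0 < d" using nz by (auto simp: d_def)
    have dle: "d \<le> \<bar>h u\<bar>" for u
      using m(2)[of "frac u"] hper[of "frac u" "\<lfloor>u\<rfloor>"] frac_lt_1[of u] by (simp add: d_def frac_def)
    have sgn: "(\<forall>u. h u > 0) \<or> (\<forall>u. h u < 0)"
    proof (rule ccontr)
      assume "\<not> ?thesis"
      then obtain u v where "h u \<le> 0" "0 \<le> h v" by (meson not_less)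
      moreover have "connected (range h)" by (rule connected_continuous_image[OF hc]) auto
      ultimately have "0 \<in> range h" using connectedD_interval[of "range h" "h u" "h v" 0] by auto
      then show False using nz by (metis imageE)
    qed
    have lim: "(\<lambda>n. (f ^^ (k * n)) 0 / real (k * n)) \<longlonglongrightarrow> of_int r / of_nat k"
    proof -
      have "filterlim (\<lambda>n. k * n) sequentially sequentially"
        using assms(1) by (intro filterlim_subseq strict_monoI) auto
      then show ?thesis by (rule filterlim_compose[OF f_lim[of 0]])
    qed
    have step: "(f ^^ (k * Suc n)) 0 = (f ^^ k) ((f ^^ (k * n)) 0)" for n
      by (metis comp_apply funpow_add mult_Suc_right)
    have hstep: "(f ^^ (k * Suc n)) 0 = (f ^^ (k * n)) 0 + of_int r + h ((f ^^ (k * n)) 0)" for n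
      unfolding step h_def by simp
    from sgn show False
    proof
      assume pos: "\<forall>u. h u > 0"
      have "(f ^^ (k * n)) 0 \<ge> n * (of_int r + d)" for n
      proof (induction n)
        case (Suc n)
        have "h ((f ^^ (k * n)) 0) \<ge> d" using dle pos by (metis abs_of_pos)
        then show ?case using Suc unfolding hstep by (simp add: algebra_simps)
      qed simp
      note le = this
      have "(of_int r + d) / k \<le> (f ^^ (k * n)) 0 / real (k * n)" if "n \<ge> 1" for n
      proof -
        have "(of_int r + d) / k = n * (of_int r + d) / real (k * n)" using that by simp
        then show ?thesis using divide_right_mono[OF le[of n], of "real (k * n)"] by simp
      qed
      then have "(of_int r + d) / k \<le> of_int r / of_nat k"
        using lim by (intro LIMSEQ_le_const[OF lim]) blast
      moreover have "of_int r / of_nat k < (of_int r + d) / k"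
        using d assms(1) by (intro divide_strict_right_mono) auto
      ultimately show False by simp
    next
      assume neg: "\<forall>u. h u < 0"
      have "(f ^^ (k * n)) 0 \<le> n * (of_int r - d)" for n
      proof (induction n)
        case (Suc n)
        have "h ((f ^^ (k * n)) 0) \<le> - d" using dle[of "(f ^^ (k * n)) 0"] neg[rule_format, of "(f ^^ (k * n)) 0"] by linarith
        then show ?case using Suc unfolding hstep by (simp add: algebra_simps)
      qed simp
      note le = this
      have "(f ^^ (k * n)) 0 / real (k * n) \<le> (of_int r - d) / k" if "n \<ge> 1" for n
      proof -
        have "(of_int r - d) / k = n * (of_int r - d) / real (k * n)" using that by simp
        then show ?thesis using divide_right_mono[OF le[of n], of "real (k * n)"] by simp
      qed
      then have "of_int r / of_nat k \<le> (of_int r - d) / k"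
        using lim by (intro LIMSEQ_le_const2[OF lim]) blast
      moreover have "(of_int r - d) / k < of_int r / of_nat k"
        using d assms(1) by (intro divide_strict_right_mono) auto
      ultimately show False by simp
    qed
  qed
  then obtain u where "h u = 0" by blast
  then have "(f ^^ k) u = u + of_int r" by (simp add: h_def)
  then show ?thesis by (rule that[OF cf(1,2) f_T])
qed

text \<open>Here \<open>Om\<close> is the set of pairs of consecutive base points, \<open>\<alpha>\<close> and \<open>\<beta>\<close> are the second coordinates of
  the phase point over the first and of its image over the second base point, and \<open>\<alpha>\<^sub>1\<close>, \<open>\<alpha>\<^sub>2\<close>, \<open>\<beta>\<^sub>1\<close>,
  \<open>\<beta>\<^sub>2\<close> are their partial derivatives. The sign of \<open>\<epsilon>\<close> is the direction of the twist. The last assumption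
  says that the area \<open>\<rho> dt dy\<close> has the same density in the pair whether it is computed before or
  after the map. The billiard map itself need not be differentiable, since \<open>\<alpha>\<^sub>2\<close> may vanish.\<close>

locale twist_billiard =
  fixes P \<epsilon> :: real and Om :: "(real \<times> real) set" and \<alpha> \<beta> :: "real \<Rightarrow> real \<Rightarrow> real"
    and M :: "(real \<times> real) set" and T :: "real \<times> real \<Rightarrow> real \<times> real"
    and \<rho> \<alpha>\<^sub>1 \<alpha>\<^sub>2 \<beta>\<^sub>1 \<beta>\<^sub>2 :: "real \<times> real \<Rightarrow> real"
  assumes P: "0 < P" and Om_open: "open Om"
    and Om_less: "\<And>t t1. (t, t1) \<in> Om \<Longrightarrow> t < t1"
    and Om_period: "\<And>t t1. (t, t1) \<in> Om \<Longrightarrow> (t + P, t1 + P) \<in> Om"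
    and period: "\<And>t t1. \<alpha> (t + P) (t1 + P) = \<alpha> t t1" "\<And>t t1. \<beta> (t + P) (t1 + P) = \<beta> t t1"
    and alpha_mono: "\<And>t t1 t2. (t, t1) \<in> Om \<Longrightarrow> (t, t2) \<in> Om \<Longrightarrow> t1 < t2 \<Longrightarrow> \<epsilon> * \<alpha> t t1 < \<epsilon> * \<alpha> t t2"
    and beta_mono: "\<And>t t' t1. (t, t1) \<in> Om \<Longrightarrow> (t', t1) \<in> Om \<Longrightarrow> t < t' \<Longrightarrow> \<epsilon> * \<beta> t' t1 < \<epsilon> * \<beta> t t1"
    and M_sub: "\<And>t y. (t, y) \<in> M \<Longrightarrow> \<exists>t1. (t, t1) \<in> Om \<and> y = \<alpha> t t1"
    and T_eq: "\<And>t t1. (t, t1) \<in> Om \<Longrightarrow> T (t, \<alpha> t t1) = (t1, \<beta> t t1)"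
    and alpha_deriv: "\<And>z. z \<in> Om \<Longrightarrow>
      ((\<lambda>z. \<alpha> (fst z) (snd z)) has_derivative (\<lambda>h. \<alpha>\<^sub>1 z * fst h + \<alpha>\<^sub>2 z * snd h)) (at z)"
    and beta_deriv: "\<And>z. z \<in> Om \<Longrightarrow>
      ((\<lambda>z. \<beta> (fst z) (snd z)) has_derivative (\<lambda>h. \<beta>\<^sub>1 z * fst h + \<beta>\<^sub>2 z * snd h)) (at z)"
    and partials_cont: "continuous_on Om \<alpha>\<^sub>2" "continuous_on Om \<beta>\<^sub>1"
    and rho_cont: "continuous_on UNIV \<rho>" and rho_nonneg: "\<And>z. 0 \<le> \<rho> z"
    and rho_period: "\<And>z. \<rho> (z + (P, 0)) = \<rho> z"
    and rho_pos: "\<And>a b. a < b \<Longrightarrow> \<exists>t\<in>{a<..<b}. \<forall>y. (t, y) \<in> M \<longrightarrow> \<rho> (t, y) \<noteq> 0"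
    and density: "\<And>t t1. (t, t1) \<in> Om \<Longrightarrow>
      \<bar>\<alpha>\<^sub>2 (t, t1)\<bar> * \<rho> (t, \<alpha> t t1) = \<bar>\<beta>\<^sub>1 (t, t1)\<bar> * \<rho> (t1, \<beta> t t1)"
begin

definition "out_chart z = (fst z, \<alpha> (fst z) (snd z))"
definition "in_chart z = (snd z, \<beta> (fst z) (snd z))"

lemma alpha_inj: "(t, t1) \<in> Om \<Longrightarrow> (t, t2) \<in> Om \<Longrightarrow> \<alpha> t t1 = \<alpha> t t2 \<Longrightarrow> t1 = t2"
  using alpha_mono by (metis linorder_neqE_linordered_idom less_irrefl)

lemma beta_inj: "(t, t1) \<in> Om \<Longrightarrow> (t', t1) \<in> Om \<Longrightarrow> \<beta> t t1 = \<beta> t' t1 \<Longrightarrow> t = t'"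
  using beta_mono by (metis linorder_neqE_linordered_idom less_irrefl)

lemma out_inj: "inj_on out_chart Om" and in_inj: "inj_on in_chart Om"
  using alpha_inj beta_inj by (auto simp: inj_on_def out_chart_def in_chart_def)

lemma out_deriv: "z \<in> Om \<Longrightarrow> (out_chart has_derivative (\<lambda>h. (fst h, \<alpha>\<^sub>1 z * fst h + \<alpha>\<^sub>2 z * snd h))) (at z)"
  unfolding out_chart_def[abs_def] by (intro has_derivative_Pair has_derivative_fst has_derivative_ident alpha_deriv)

lemma in_deriv: "z \<in> Om \<Longrightarrow> (in_chart has_derivative (\<lambda>h. (snd h, \<beta>\<^sub>1 z * fst h + \<beta>\<^sub>2 z * snd h))) (at z)"
  unfolding in_chart_def[abs_def] by (intro has_derivative_Pair has_derivative_snd has_derivative_ident beta_deriv)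

lemma out_cont: "continuous_on Om out_chart" and in_cont: "continuous_on Om in_chart"
  by (auto intro!: continuous_at_imp_continuous_on has_derivative_continuous[OF out_deriv] has_derivative_continuous[OF in_deriv])

lemma M_out: "M \<subseteq> out_chart ` Om"
proof (rule subsetI, clarify)
  fix t y assume "(t, y) \<in> M"
  then obtain t1 where "(t, t1) \<in> Om" "y = \<alpha> t t1" using M_sub by blast
  then show "(t, y) \<in> out_chart ` Om" by (intro image_eqI[of _ _ "(t, t1)"]) (auto simp: out_chart_def)
qed

lemma T_out: "z \<in> Om \<Longrightarrow> T (out_chart z) = in_chart z"
  using T_eq by (cases z) (auto simp: out_chart_def in_chart_def)

text \<open>The map factors as \<open>in_chart \<circ> out_chart\<^sup>-\<^sup>1\<close>. Invariance of domain makes the inverse of \<open>out_chart\<close>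
  continuous, and the change of variables formula for both charts shows that area is preserved.\<close>

lemma totally_integrable_measured_foliation:
  assumes U: "open U" "U \<subseteq> M" and fol: "C1_foliation U \<F>"
    and leaves: "\<And>L. L \<in> \<F> \<Longrightarrow> rotational_invariant_curve P M T L"
  shows "measured_foliation P U \<F> \<rho> T"
proof -
  obtain pairs where h: "homeomorphism Om (out_chart ` Om) out_chart pairs"
    using invariance_of_domain_homeomorphism[OF Om_open out_cont _ out_inj] by auto
  have pairs: "pairs z \<in> Om" "out_chart (pairs z) = z" if "z \<in> M" for z
    using h M_out that unfolding homeomorphism_def by auto
  have pairs_cont: "continuous_on M pairs"
    using h M_out unfolding homeomorphism_def by (metis continuous_on_subset)
  have T_pairs: "T z = in_chart (pairs z)" if "z \<in> M" for z
    using T_out pairs[OF that] by metis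
  show ?thesis
  proof (unfold_locales)
    show "0 < P" "open U" "C1_foliation U \<F>" "continuous_on UNIV \<rho>" by (fact P U fol rho_cont)+
    show "\<exists>c. rotational_param P c \<and> range c = L" "T ` L = L" if "L \<in> \<F>" for L
      using leaves[OF that] by (auto simp: rotational_invariant_curve_def)
    show "0 \<le> \<rho> z" "\<rho> (z + (P, 0)) = \<rho> z" for z by (fact rho_nonneg rho_period)+
    show "\<exists>t\<in>{a<..<b}. \<forall>y. (t, y) \<in> U \<longrightarrow> \<rho> (t, y) \<noteq> 0" if "a < b" for a b
      using rho_pos[OF that] U by blast
    show "continuous_on U T"
    proof -
      have "continuous_on U (\<lambda>z. in_chart (pairs z))"
        by (rule continuous_on_compose2[OF in_cont continuous_on_subset[OF pairs_cont U(2)]])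
           (use pairs U in auto)
      then show ?thesis using T_pairs U(2) by (subst continuous_on_cong[OF refl]) auto
    qed
    show "inj_on T U"
    proof (rule inj_onI)
      fix z w assume zw: "z \<in> U" "w \<in> U" "T z = T w"
      then have "in_chart (pairs z) = in_chart (pairs w)"
        using T_pairs[OF subsetD[OF U(2) zw(1)]] T_pairs[OF subsetD[OF U(2) zw(2)]] by simp
      then have "pairs z = pairs w" using inj_onD[OF in_inj] pairs zw U(2) by blast
      then show "z = w" using pairs zw U(2) by (metis subsetD)
    qed
    have rep: "\<exists>t1. z = (fst z, \<alpha> (fst z) t1) \<and> (fst z, t1) \<in> Om" if "z \<in> U" for z
    proof -
      have "(fst z, snd z) \<in> M" using that U(2) by auto
      then show ?thesis using M_sub by (metis prod.collapse)
    qed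
    show "T (z + (P, 0)) = T z + (P, 0)" if zU: "z \<in> U" for z
    proof -
      obtain t t1 where z: "z = (t, \<alpha> t t1)" "(t, t1) \<in> Om" using rep[OF zU] by metis
      show ?thesis using T_eq[OF z(2)] T_eq[OF Om_period[OF z(2)]] by (simp add: z(1) period)
    qed
    show "z = w" if zw: "z \<in> U" "w \<in> U" and e: "fst z = fst w" "fst (T z) = fst (T w)" for z w
    proof -
      obtain t t1 where z: "z = (t, \<alpha> t t1)" "(t, t1) \<in> Om" using rep[OF zw(1)] by metis
      obtain t' t2 where w: "w = (t', \<alpha> t' t2)" "(t', t2) \<in> Om" using rep[OF zw(2)] by metis
      show ?thesis using e T_eq[OF z(2)] T_eq[OF w(2)] by (simp add: z(1) w(1))
    qed
    show "integral (T ` E) \<rho> = integral E \<rho>" if E: "compact E" "E \<subseteq> U" for E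
    proof -
      define F where "F = pairs ` E"
      have EM: "E \<subseteq> M" using E U by blast
      have cF: "compact F" unfolding F_def
        by (rule compact_continuous_image[OF continuous_on_subset[OF pairs_cont EM] E(1)])
      have FO: "F \<subseteq> Om" using pairs EM by (auto simp: F_def)
      have oF: "out_chart ` F = E" using pairs EM by (force simp: F_def image_image)
      have iF: "in_chart ` F = T ` E" using T_pairs EM by (force simp: F_def image_image)
      have eq: "\<bar>\<alpha>\<^sub>2 z\<bar> * \<rho> (out_chart z) = \<bar>\<beta>\<^sub>1 z\<bar> * \<rho> (in_chart z)" if "z \<in> F" for z
        using density[of "fst z" "snd z"] that FO by (auto simp: out_chart_def in_chart_def)
      have cr: "continuous_on F (\<lambda>z. \<rho> (g z))" if "continuous_on Om g" for g
        by (rule continuous_on_compose2[OF rho_cont continuous_on_subset[OF that FO]]) auto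
      have "integral (out_chart ` F) \<rho> = integral F (\<lambda>z. \<bar>jac (\<lambda>h. (fst h, \<alpha>\<^sub>1 z * fst h + \<alpha>\<^sub>2 z * snd h))\<bar> * \<rho> (out_chart z))"
      proof (rule integral_image_plane[OF cF])
        show "(out_chart has_derivative (\<lambda>h. (fst h, \<alpha>\<^sub>1 z * fst h + \<alpha>\<^sub>2 z * snd h))) (at z within F)" if "z \<in> F" for z
          using out_deriv FO that by (blast intro: has_derivative_at_withinI)
        show "inj_on out_chart F" using out_inj FO by (rule inj_on_subset)
        show "continuous_on (out_chart ` F) \<rho>" using rho_cont continuous_on_subset by blast
        show "continuous_on F (\<lambda>z. \<bar>jac (\<lambda>h. (fst h, \<alpha>\<^sub>1 z * fst h + \<alpha>\<^sub>2 z * snd h))\<bar> * \<rho> (out_chart z))"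
          by (simp add: jac_def) (intro continuous_intros cr out_cont continuous_on_subset[OF partials_cont(1) FO])
      qed
      also have "\<dots> = integral F (\<lambda>z. \<bar>jac (\<lambda>h. (snd h, \<beta>\<^sub>1 z * fst h + \<beta>\<^sub>2 z * snd h))\<bar> * \<rho> (in_chart z))"
        by (rule integral_cong) (simp add: jac_def eq)
      also have "\<dots> = integral (in_chart ` F) \<rho>"
      proof (rule integral_image_plane[OF cF, symmetric])
        show "(in_chart has_derivative (\<lambda>h. (snd h, \<beta>\<^sub>1 z * fst h + \<beta>\<^sub>2 z * snd h))) (at z within F)" if "z \<in> F" for z
          using in_deriv FO that by (blast intro: has_derivative_at_withinI)
        show "inj_on in_chart F" using in_inj FO by (rule inj_on_subset)
        show "continuous_on (in_chart ` F) \<rho>" using rho_cont continuous_on_subset by blast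
        show "continuous_on F (\<lambda>z. \<bar>jac (\<lambda>h. (snd h, \<beta>\<^sub>1 z * fst h + \<beta>\<^sub>2 z * snd h))\<bar> * \<rho> (in_chart z))"
          by (simp add: jac_def) (intro continuous_intros cr in_cont continuous_on_subset[OF partials_cont(2) FO])
      qed
      finally show ?thesis by (simp add: oF iF)
    qed
  qed
qed

text \<open>Orbits are represented by their base points; indices in \<open>nat\<close> suffice for periodic orbits.\<close>

definition orbit :: "(nat \<Rightarrow> real) \<Rightarrow> bool"
  where "orbit a \<longleftrightarrow> (\<forall>i. (a i, a (Suc i)) \<in> Om \<and> \<beta> (a i) (a (Suc i)) = \<alpha> (a (Suc i)) (a (Suc (Suc i))))"

text \<open>If \<open>b\<close> is ahead of \<open>a\<close> before the contact, then by the two monotonicities it is behind \<open>a\<close> after it.\<close>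

lemma orbits_cross_where_they_touch:
  assumes a: "orbit a" and b: "orbit b" and le: "\<And>i. a i \<le> b i" and eq: "a (Suc i) = b (Suc i)"
  shows "a i = b i"
proof (rule ccontr)
  assume "a i \<noteq> b i"
  then have lt: "a i < b i" using le[of i] by simp
  have Oa: "(a i, a (Suc i)) \<in> Om" "(a (Suc i), a (Suc (Suc i))) \<in> Om"
    and Ob: "(b i, a (Suc i)) \<in> Om" "(a (Suc i), b (Suc (Suc i))) \<in> Om"
    using a b eq unfolding orbit_def by metis+
  have E: "\<beta> (a i) (a (Suc i)) = \<alpha> (a (Suc i)) (a (Suc (Suc i)))" "\<beta> (b i) (a (Suc i)) = \<alpha> (a (Suc i)) (b (Suc (Suc i)))"
    using a b eq unfolding orbit_def by metis+
  have "\<epsilon> * \<beta> (b i) (a (Suc i)) < \<epsilon> * \<beta> (a i) (a (Suc i))"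
    by (rule beta_mono[OF Oa(1) Ob(1) lt])
  then have "\<epsilon> * \<alpha> (a (Suc i)) (b (Suc (Suc i))) < \<epsilon> * \<alpha> (a (Suc i)) (a (Suc (Suc i)))" by (simp only: E)
  moreover have "\<epsilon> * \<alpha> (a (Suc i)) (a (Suc (Suc i))) \<le> \<epsilon> * \<alpha> (a (Suc i)) (b (Suc (Suc i)))"
    using alpha_mono[OF Oa(2) Ob(2)] le[of "Suc (Suc i)"] by (cases "a (Suc (Suc i)) = b (Suc (Suc i))") auto
  ultimately show False by simp
qed

lemma orbit_determined:
  assumes a: "orbit a" and b: "orbit b" and eq: "a i = b i" "a (Suc i) = b (Suc i)"
  shows "a (i + n) = b (i + n)"
proof -
  have "a (i + n) = b (i + n) \<and> a (Suc (i + n)) = b (Suc (i + n))"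
  proof (induction n)
    case (Suc n)
    let ?j = "i + n"
    have "(a (Suc ?j), a (Suc (Suc ?j))) \<in> Om" "(a (Suc ?j), b (Suc (Suc ?j))) \<in> Om"
      "\<alpha> (a (Suc ?j)) (a (Suc (Suc ?j))) = \<alpha> (a (Suc ?j)) (b (Suc (Suc ?j)))"
      using a b Suc unfolding orbit_def by metis+
    then show ?case using Suc alpha_inj by simp
  qed (use eq in simp)
  then show ?thesis by simp
qed

context
  fixes c f and k :: nat and r :: int
  assumes k: "0 < k" and c: "rotational_param P c" and cM: "range c \<subseteq> M"
    and f: "continuous_on UNIV f" "strict_mono f" "\<And>u. f (u + 1) = f u + 1" "\<And>u. T (c u) = c (f u)"
    and periodic: "\<And>u. (f ^^ k) u = u + of_int r"
begin

definition "base u i = fst (c ((f ^^ i) u))"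

lemma fst_c_shift: "fst (c (u + of_int n)) = fst (c u) + of_int n * P"
  using rotational_param_shift[OF c, of u n] by simp

lemma curve_point:
  "(fst (c v), fst (c (f v))) \<in> Om" "snd (c v) = \<alpha> (fst (c v)) (fst (c (f v)))"
  "snd (c (f v)) = \<beta> (fst (c v)) (fst (c (f v)))"
proof -
  have "(fst (c v), snd (c v)) \<in> M" using cM by auto
  then obtain t1 where t1: "(fst (c v), t1) \<in> Om" "snd (c v) = \<alpha> (fst (c v)) t1" using M_sub by blast
  have "c (f v) = T (fst (c v), snd (c v))" by (simp add: f(4))
  also have "\<dots> = (t1, \<beta> (fst (c v)) t1)" unfolding t1(2) by (rule T_eq[OF t1(1)])
  finally show "(fst (c v), fst (c (f v))) \<in> Om" "snd (c v) = \<alpha> (fst (c v)) (fst (c (f v)))"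
    "snd (c (f v)) = \<beta> (fst (c v)) (fst (c (f v)))" using t1 by auto
qed

lemma base_orbit: "orbit (base u)"
  unfolding orbit_def base_def
  using curve_point by (metis comp_apply funpow.simps(2))

lemma base_inj:
  assumes "base u i = base v i" "base u (Suc i) = base v (Suc i)" shows "u = v"
proof -
  have "c ((f ^^ i) u) = c ((f ^^ i) v)"
    using assms curve_point(2)[of "(f ^^ i) u"] curve_point(2)[of "(f ^^ i) v"]
    by (simp add: base_def prod_eq_iff)
  then have "(f ^^ i) u = (f ^^ i) v" using c by (auto simp: rotational_param_def inj_def)
  then show ?thesis using strict_mono_funpow[OF f(2)] by (simp add: strict_mono_eq)
qed

lemma base_period: "base u (i + k) = base u i + of_int r * P"
proof -
  have "(f ^^ (i + k)) u = (f ^^ k) ((f ^^ i) u)" by (metis add.commute comp_apply funpow_add)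
  then show ?thesis using fst_c_shift by (simp add: base_def periodic)
qed

lemma base_cont: "continuous_on UNIV (\<lambda>u. base u i)"
proof -
  have "continuous_on UNIV c" using c by (simp add: rotational_param_def)
  then have "continuous_on UNIV (\<lambda>u. c ((f ^^ i) u))"
    by (rule continuous_on_compose2[OF _ continuous_on_funpow[OF f(1)]]) simp
  then show ?thesis unfolding base_def by (rule continuous_on_fst)
qed

lemma periodic_all_iff:
  assumes b: "\<And>i. b (i + k) = b i + of_int r * P"
  shows "(\<forall>i. b i < base u i) \<longleftrightarrow> (\<forall>i<k. b i < base u i)"
proof
  assume *: "\<forall>i<k. b i < base u i"
  show "\<forall>i. b i < base u i"
  proof
    fix i show "b i < base u i"
    proof (induction i rule: less_induct)
      case (less i)
      show ?case
      proof (cases "i < k")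
        case False
        then have "b (i - k) < base u (i - k)" using less[of "i - k"] k by simp
        then show ?thesis using b[of "i - k"] base_period[of u "i - k"] False by simp
      qed (use * in simp)
    qed
  qed
qed simp

text \<open>Let \<open>w\<close> be the last parameter for which the orbit starting at \<open>c w\<close> is not strictly ahead of \<open>b\<close>. It exists
  because far along the curve the orbits are ahead of \<open>b\<close>, and by periodicity being ahead is an open
  condition. The orbit of \<open>w\<close> touches \<open>b\<close> without crossing it, so it coincides with \<open>b\<close>.\<close>

lemma periodic_orbit_on_curve:
  assumes b: "orbit b" and per: "\<And>i. b (i + k) = b i + of_int r * P"
  obtains w where "\<And>i. b i = base w i" "\<And>v i. w < v \<Longrightarrow> b i < base v i"
proof -
  define B where "B = {u. \<not> (\<forall>i. b i < base u i)}"
  have B_eq: "B = (\<Union>i\<in>{..<k}. {u. base u i \<le> b i})"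
    unfolding B_def periodic_all_iff[of b, OF per] by (auto simp: not_less)
  have "closed {u. base u i \<le> b i}" for i
    by (rule closed_Collect_le[OF base_cont continuous_on_const])
  then have closedB: "closed B" unfolding B_eq by (intro closed_UN) auto
  obtain D where D: "\<And>u. \<bar>fst (c u) - P * u\<bar> \<le> D" using rotational_param_bounded[OF c] by blast
  have fmono: "strict_mono (f ^^ i)" for i by (rule strict_mono_funpow[OF f(2)])
  have fper: "(f ^^ i) (u + of_int n) = (f ^^ i) u + of_int n" for i u and n :: int
    using shift_commute[of "f ^^ i" 1 u n] funpow_shift[of f 1] f(3) by simp
  have ne: "B \<noteq> {}"
  proof -
    define u where "u = (b 0 - D) / P"
    have "base u 0 \<le> b 0" using D[of u] P by (simp add: base_def u_def)
    then show ?thesis unfolding B_def by (auto simp: not_less)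
  qed
  have bdd: "bdd_above B"
  proof -
    define R where "R = Max ((\<lambda>i. (b i + D) / P - (f ^^ i) 0) ` {..<k})"
    have R: "(b i + D) / P - (f ^^ i) 0 \<le> R" if "i < k" for i
      unfolding R_def by (rule Max_ge) (use that in auto)
    define n where "n = \<lceil>R\<rceil> + 1"
    have "u \<le> of_int n" if uB: "u \<in> B" for u
    proof (rule ccontr)
      assume "\<not> u \<le> of_int n"
      obtain i where i: "i < k" "base u i \<le> b i" using uB unfolding B_eq by auto
      have "(f ^^ i) 0 + of_int n \<le> (f ^^ i) u"
        using fper[of i 0 n] fmono[of i] \<open>\<not> u \<le> of_int n\<close> by (metis add_0 less_imp_le not_le strict_mono_less_eq)
      moreover have "R < of_int n" unfolding n_def by linarith
      ultimately have "(b i + D) / P < (f ^^ i) u" using R[OF i(1)] by linarith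
      then have "b i + D < P * (f ^^ i) u" using P by (simp add: field_simps)
      then show False using D[of "(f ^^ i) u"] i(2) by (simp add: base_def)
    qed
    then show ?thesis by (rule bdd_aboveI)
  qed
  define w where "w = Sup B"
  have wB: "w \<in> B" unfolding w_def by (rule closed_contains_Sup[OF ne bdd closedB])
  have above: "b i < base v i" if "w < v" for v i
  proof -
    have "v \<notin> B" using cSup_upper[OF _ bdd, of v] that by (auto simp: w_def)
    then show ?thesis by (simp add: B_def)
  qed
  have le: "b i \<le> base w i" for i
  proof (rule tendsto_lowerbound)
    have "continuous (at w) (\<lambda>u. base u i)" using base_cont by (simp add: continuous_on_eq_continuous_at)
    then show "((\<lambda>u. base u i) \<longlongrightarrow> base w i) (at_right w)"
      unfolding continuous_at by (rule filterlim_mono[OF _ order_refl at_le]) simp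
    show "\<forall>\<^sub>F u in at_right w. b i \<le> base u i"
      unfolding eventually_at_right_field using above by (intro exI[of _ "w + 1"]) (auto intro: less_imp_le)
  qed simp
  obtain i where "base w i \<le> b i" using wB by (auto simp: B_def not_less)
  then have "b i = base w i" using le[of i] by simp
  \<comment> \<open>The contact is moved one period ahead so that it has a predecessor.\<close>
  then have "b (i + k) = base w (i + k)" using per base_period by simp
  then have e: "b (Suc (i + (k - 1))) = base w (Suc (i + (k - 1)))" using k by simp
  have e0: "b (i + (k - 1)) = base w (i + (k - 1))"
    by (rule orbits_cross_where_they_touch[OF b base_orbit le e])
  let ?j = "i + (k - 1)"
  have late: "b (?j + n) = base w (?j + n)" for n
    by (rule orbit_determined[OF b base_orbit e0 e])
  have repeat: "a (n + m * k) = a n + m * (of_int r * P)"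
    if a: "\<And>i. a (i + k) = a i + of_int r * P" for a :: "nat \<Rightarrow> real" and n m
  proof (induction m)
    case (Suc m)
    have "n + Suc m * k = (n + m * k) + k" by simp
    then show ?case using a[of "n + m * k"] Suc by (simp add: algebra_simps)
  qed simp
  have "b n = base w n" for n
  proof -
    have "?j \<le> n + ?j * k" using k by (simp add: trans_le_add2)
    then have "b (n + ?j * k) = base w (n + ?j * k)" using late[of "n + ?j * k - ?j"] by simp
    then show ?thesis using repeat[of b n ?j, OF per] repeat[of "base w" n ?j, OF base_period] by simp
  qed
  then show ?thesis using that above by blast
qed

lemma base_strict_mono: assumes "u < v" shows "base u i < base v i"
proof -
  obtain w where w: "\<And>i. base u i = base w i" "\<And>v i. w < v \<Longrightarrow> base u i < base v i"
    using periodic_orbit_on_curve[OF base_orbit base_period, of u] by blast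
  have "u = w" using base_inj[OF w(1)[of 0] w(1)[of "Suc 0"]] .
  then show ?thesis using w(2) assms by blast
qed

text \<open>The \<open>\<sigma>\<close>-image of the orbit starting at \<open>c u\<close> is the orbit of some \<open>c w\<close> by \<open>periodic_orbit_on_curve\<close>. If \<open>w\<close>
  exceeded \<open>f u\<close>, then \<open>\<sigma>\<close> would advance every base point by more than a step of the orbit, and its
  \<open>k\<close>-th iterate by more than \<open>r\<close> turns; similarly if \<open>w\<close> were less. So one step of the orbit is \<open>\<sigma>\<close>.\<close>

lemma symmetry_is_dynamics:
  assumes s_mono: "strict_mono \<sigma>" and s_period: "\<And>t. \<sigma> (t + P) = \<sigma> t + P"
    and s_k: "\<And>t. (\<sigma> ^^ k) t = t + of_int r * P"
    and s_orbit: "\<And>a. orbit a \<Longrightarrow> orbit (\<lambda>i. \<sigma> (a i))"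
  obtains a where "orbit a" "\<And>i. a i = (\<sigma> ^^ i) t"
proof -
  obtain D where D: "\<And>u. \<bar>fst (c u) - P * u\<bar> \<le> D" using rotational_param_bounded[OF c] by blast
  have "\<exists>u\<ge>(t - D) / P. u \<le> (t + D) / P \<and> base u 0 = t"
  proof (rule IVT')
    show "base ((t - D) / P) 0 \<le> t" using D[of "(t - D) / P"] P by (simp add: base_def)
    show "t \<le> base ((t + D) / P) 0" using D[of "(t + D) / P"] P by (simp add: base_def)
    show "(t - D) / P \<le> (t + D) / P" using D[of 0] P by (simp add: divide_right_mono)
  qed (use base_cont[of 0] in \<open>rule continuous_on_subset, simp\<close>)
  then obtain u where u: "base u 0 = t" by blast
  have s_shift: "\<sigma> (s + of_int n * P) = \<sigma> s + of_int n * P" for s and n :: int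
    by (rule shift_commute[of \<sigma> P, OF s_period])
  define b where "b i = \<sigma> (base u i)" for i
  have "orbit b" unfolding b_def[abs_def] by (rule s_orbit[OF base_orbit])
  moreover have "b (i + k) = b i + of_int r * P" for i by (simp add: b_def base_period s_shift)
  ultimately obtain w where w: "\<And>i. b i = base w i" using periodic_orbit_on_curve by metis
  have next_base: "base (f v) i = base v (Suc i)" for v i by (simp add: base_def funpow_swap1)
  have base_k: "base u k = t + of_int r * P" using base_period[of u 0] u by simp
  have "w = f u"
  proof (rule ccontr)
    assume "w \<noteq> f u"
    then consider "f u < w" | "w < f u" by linarith
    then show False
    proof cases
      case 1
      then have step: "base u (Suc i) < \<sigma> (base u i)" for i
        using base_strict_mono[of "f u" w i] w[of i] next_base[of u i] by (simp add: b_def)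
      have "base u (Suc i) < (\<sigma> ^^ Suc i) t" for i
      proof (induction i)
        case (Suc i)
        have "base u (Suc (Suc i)) < \<sigma> (base u (Suc i))" by (rule step)
        also have "\<dots> < \<sigma> ((\<sigma> ^^ Suc i) t)" using Suc s_mono by (simp add: strict_mono_less)
        finally show ?case by simp
      qed (use step[of 0] u in simp)
      from this[of "k - 1"] show False using k base_k s_k[of t] by simp
    next
      case 2
      then have step: "\<sigma> (base u i) < base u (Suc i)" for i
        using base_strict_mono[of w "f u" i] w[of i] next_base[of u i] by (simp add: b_def)
      have "(\<sigma> ^^ Suc i) t < base u (Suc i)" for i
      proof (induction i)
        case (Suc i)
        have "\<sigma> ((\<sigma> ^^ Suc i) t) < \<sigma> (base u (Suc i))" using Suc s_mono by (simp add: strict_mono_less)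
        also have "\<dots> < base u (Suc (Suc i))" by (rule step)
        finally show ?case by simp
      qed (use step[of 0] u in simp)
      from this[of "k - 1"] show False using k base_k s_k[of t] by simp
    qed
  qed
  then have step: "base u (Suc i) = \<sigma> (base u i)" for i
    using w[of i] next_base[of u i] by (simp add: b_def)
  have "base u i = (\<sigma> ^^ i) t" for i by (induction i) (auto simp: u step)
  then show ?thesis using that base_orbit by blast
qed

end

text \<open>The curve \<open>C\<close> only provides a periodic point; the argument runs on the leaf of the foliation
  through this point.\<close>

theorem symmetry_orbits:
  fixes k :: nat and r :: int
  assumes k: "0 < k" and C: "rotational_invariant_curve P M T C" "C \<subseteq> U"
    and rot: "has_rotation_number P T C (of_int r / of_nat k)"
    and ti: "totally_integrable P M T U"
    and s: "strict_mono \<sigma>" "\<And>t. \<sigma> (t + P) = \<sigma> t + P" "\<And>t. (\<sigma> ^^ k) t = t + of_int r * P"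
      "\<And>a. orbit a \<Longrightarrow> orbit (\<lambda>i. \<sigma> (a i))"
  shows "orbit (\<lambda>i. (\<sigma> ^^ i) t)"
proof -
  obtain \<F> where U: "open U" "U \<subseteq> M" and F: "C1_foliation U \<F>" "\<And>L. L \<in> \<F> \<Longrightarrow> rotational_invariant_curve P M T L"
    using ti unfolding totally_integrable_def by metis
  interpret mf: measured_foliation P U \<F> \<rho> T by (rule totally_integrable_measured_foliation[OF U F])
  obtain c0 f0 u0 where c0: "rotational_param P c0" "range c0 = C" "\<And>u. T (c0 u) = c0 (f0 u)"
    "(f0 ^^ k) u0 = u0 + of_int r"
    using rotation_number_periodic_point[OF k rot] by metis
  have Tn0: "(T ^^ n) (c0 u) = c0 ((f0 ^^ n) u)" for n u by (induction n) (auto simp: c0(3))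
  have "c0 u0 \<in> U" using c0(2) C(2) by blast
  then obtain L where L: "L \<in> \<F>" "c0 u0 \<in> L" using mf.Un by blast
  obtain c where c: "rotational_param P c" "range c = L" using mf.leaf[OF L(1)] by blast
  obtain f where f: "continuous_on UNIV f" "strict_mono f" "\<And>u. f (u + 1) = f u + 1" "\<And>u. T (c u) = c (f u)"
    using mf.leaf_circle_map[OF L(1) c] by blast
  obtain u1 where u1: "c u1 = c0 u0" using L(2) c(2) by (metis imageE)
  have Tn: "(T ^^ n) (c u) = c ((f ^^ n) u)" for n u by (induction n) (auto simp: f(4))
  have "c ((f ^^ k) u1) = c (u1 + of_int r)"
    using Tn[of k u1] Tn0[of k u0] u1 c0(4) rotational_param_shift[OF c0(1), of u0 r]
      rotational_param_shift[OF c(1), of u1 r] by simp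
  then have "(f ^^ k) u1 = u1 + of_int r" using c(1) by (auto simp: rotational_param_def inj_def)
  then have fix1: "mf.return_map f k r u1 = u1" by (simp add: mf.return_map_def[OF L(1) c f(1,2,4)])
  have periodic: "(f ^^ k) u = u + of_int r" for u
    using mf.return_map_identity[OF L(1) c f(1,2,4) fix1 f(3), of u]
    by (simp add: mf.return_map_def[OF L(1) c f(1,2,4)])
  have cM: "range c \<subseteq> M" using c(2) L(1) mf.Un U(2) by blast
  obtain a where a: "orbit a" "\<And>i. a i = (\<sigma> ^^ i) t"
    using symmetry_is_dynamics[OF k c(1) cM f periodic s] by blast
  have "a = (\<lambda>i. (\<sigma> ^^ i) t)" using a(2) by auto
  then show ?thesis using a(1) by simp
qed

end

section \<open>Plane maps of finite order and invariant ellipses\<close>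

lemma bracket_eq: "bracket u w = u $ 1 * w $ 2 - u $ 2 * w $ 1"
  by (simp add: bracket_def det_2)

lemma bounded_bilinear_bracket: "bounded_bilinear bracket"
proof -
  have "bilinear bracket"
    unfolding bilinear_def by (auto intro!: linearI simp: bracket_eq algebra_simps)
  then show ?thesis by (simp add: bilinear_conv_bounded_bilinear)
qed

interpretation bracket: bounded_bilinear bracket by (rule bounded_bilinear_bracket)

lemma bracket_self [simp]: "bracket u u = 0" by (simp add: bracket_eq)
lemma bracket_swap: "bracket u w = - bracket w u" by (simp add: bracket_eq)

lemma bracket_zero_parallel:
  assumes "bracket u w = 0" "u \<noteq> 0" obtains c where "w = c *\<^sub>R u"
proof (cases "u $ 1 = 0")
  case False
  then have "w = (w $ 1 / u $ 1) *\<^sub>R u"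
    using assms(1) by (simp add: vec_eq_iff forall_2 bracket_eq field_simps)
  then show ?thesis by (rule that)
next
  case True
  then have "u $ 2 \<noteq> 0" using assms(2) by (auto simp: vec_eq_iff forall_2)
  then have "w = (w $ 2 / u $ 2) *\<^sub>R u"
    using assms(1) True by (simp add: vec_eq_iff forall_2 bracket_eq)
  then show ?thesis by (rule that)
qed

lemma bracket_matrix: "bracket (B *v u) (B *v w) = det B * bracket u w"
  by (simp add: bracket_eq det_2 matrix_vector_mult_def sum_2 algebra_simps)

lemma matrix_pow_mult: "matrix_pow A n *v x = (((*v) A) ^^ n) x"
  by (induction n) (auto simp: matrix_pow_def matrix_vector_mul_assoc[symmetric])

lemma det_matrix_pow: "det (matrix_pow A n) = det A ^ n"
  by (induction n) (auto simp: matrix_pow_def det_mul)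

lemma abs_eq_1_if_power_eq_1:
  fixes a :: real assumes "a ^ n = 1" "0 < n" shows "\<bar>a\<bar> = 1"
  using power_eq_iff_eq_base[OF assms(2), of "\<bar>a\<bar>" 1] assms(1) by (simp add: power_abs[symmetric])

lemma finite_order_eigenvalue:
  assumes B: "matrix_pow B n = mat 1" "0 < n" and v: "v \<noteq> 0" "B *v v = l *\<^sub>R v"
  shows "l = 1 \<or> l = -1"
proof -
  have "(((*v) B) ^^ m) v = l ^ m *\<^sub>R v" for m
    by (induction m) (auto simp: matrix_vector_mult_scaleR v(2))
  then have "l ^ n *\<^sub>R v = v" using B(1) matrix_pow_mult[of B n v] by simp
  then have "l ^ n = 1" using v(1) by (metis scaleR_cancel_right scaleR_one)
  then have "\<bar>l\<bar> = 1" using B(2) by (rule abs_eq_1_if_power_eq_1)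
  then show ?thesis by linarith
qed

text \<open>The square of \<open>B\<close> fixes the eigenvector and has determinant one, so it is a shear; a nontrivial shear
  has infinite order.\<close>

lemma finite_order_eigenvector_involution:
  assumes B: "matrix_pow B n = mat 1" "0 < n" and v: "v \<noteq> 0" "B *v v = l *\<^sub>R v"
  shows "B *v (B *v x) = x"
proof -
  have l2: "l * l = 1" using finite_order_eigenvalue[OF assms] by auto
  have "det B ^ n = 1" using B(1) det_matrix_pow[of B n] by simp
  then have "\<bar>det B\<bar> = 1" using B(2) by (rule abs_eq_1_if_power_eq_1)
  then have d2: "det B * det B = 1" by (metis abs_mult_self_eq mult_1)
  have Mv: "B *v (B *v v) = v" by (simp add: v(2) matrix_vector_mult_scaleR l2)
  define w where "w = (vector [- v$2, v$1] :: real^2)"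
  have vw: "bracket v w = v$1 * v$1 + v$2 * v$2" by (simp add: bracket_eq w_def)
  have vw0: "bracket v w \<noteq> 0"
    using v(1) unfolding vw by (auto simp: vec_eq_iff forall_2 add_nonneg_eq_0_iff)
  have "bracket v (B *v (B *v w)) = bracket (B *v (B *v v)) (B *v (B *v w))" by (simp add: Mv)
  also have "\<dots> = bracket v w" using d2 by (simp add: bracket_matrix mult.assoc[symmetric])
  finally have "bracket v (B *v (B *v w) - w) = 0" by (simp add: bracket_eq algebra_simps)
  then obtain c where c: "B *v (B *v w) - w = c *\<^sub>R v" using bracket_zero_parallel v(1) by blast
  then have Mw: "B *v (B *v w) = w + c *\<^sub>R v" by (simp add: algebra_simps)
  have pw: "(((*v) B) ^^ (2 * m)) w = w + (real m * c) *\<^sub>R v" for m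
  proof (induction m)
    case (Suc m)
    have "(((*v) B) ^^ (2 * Suc m)) w = B *v (B *v ((((*v) B) ^^ (2 * m)) w))" by simp
    then show ?case using Suc Mw Mv
      by (simp add: matrix_vector_right_distrib matrix_vector_mult_scaleR algebra_simps)
  qed simp
  have it: "(((*v) B) ^^ (m * n)) w = w" for m
  proof (induction m)
    case (Suc m)
    then show ?case using B(1) matrix_pow_mult[of B n] by (simp add: funpow_add)
  qed simp
  have "w + (real n * c) *\<^sub>R v = w" using pw[of n] it[of 2] by simp
  then have "c = 0" using v(1) B(2) by simp
  then have Mw': "B *v (B *v w) = w" using Mw by simp
  have "x = (bracket x w / bracket v w) *\<^sub>R v + (bracket v x / bracket v w) *\<^sub>R w"
  proof -
    have "bracket v w *\<^sub>R x = bracket x w *\<^sub>R v + bracket v x *\<^sub>R w"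
      by (simp add: vec_eq_iff forall_2 bracket_eq algebra_simps)
    then have "(1 / bracket v w) *\<^sub>R (bracket v w *\<^sub>R x) = (1 / bracket v w) *\<^sub>R (bracket x w *\<^sub>R v + bracket v x *\<^sub>R w)"
      by simp
    then show ?thesis using vw0 by (simp add: scaleR_right_distrib)
  qed
  then obtain a b where x: "x = a *\<^sub>R v + b *\<^sub>R w" by blast
  show ?thesis by (simp add: x Mv Mw' matrix_vector_mult_scaleR matrix_vector_right_distrib)
qed

lemma has_matrix_order_not_involution:
  assumes "has_matrix_order A k" "3 \<le> k" shows "\<exists>x. A *v (A *v x) \<noteq> x"
proof (rule ccontr)
  assume "\<not> ?thesis"
  then have "matrix_pow A 2 *v x = mat 1 *v x" for x by (simp add: matrix_pow_mult numeral_2_eq_2)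
  then have "matrix_pow A 2 = mat 1" by (simp add: matrix_eq)
  moreover have "(0::nat) < 2 \<and> 2 < k" using assms(2) by simp
  ultimately show False using assms(1) unfolding has_matrix_order_def by blast
qed

text \<open>A plane map with determinant \<open>-1\<close> has real eigenvalues, so in finite order it is an involution.\<close>

lemma finite_order_det_one:
  assumes A: "has_matrix_order A k" "3 \<le> k" shows "det A = 1"
proof -
  have Ak: "matrix_pow A k = mat 1" "0 < k" using A by (auto simp: has_matrix_order_def)
  have "det A ^ k = 1" using Ak(1) det_matrix_pow[of A k] by simp
  then have d: "\<bar>det A\<bar> = 1" using Ak(2) by (rule abs_eq_1_if_power_eq_1)
  have "det A \<noteq> -1"
  proof
    assume d1: "det A = -1"
    define tr where "tr = A$1$1 + A$2$2"
    define l where "l = (tr + sqrt (tr\<^sup>2 + 4)) / 2"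
    have "(sqrt (tr\<^sup>2 + 4))\<^sup>2 = tr\<^sup>2 + 4" by simp
    then have l: "l\<^sup>2 = tr * l + 1" by (simp add: l_def power2_eq_square field_simps)
    have "det (A - mat l) = 0"
      using d1 l by (simp add: det_2 mat_def tr_def power2_eq_square algebra_simps)
    then obtain v where v: "v \<noteq> 0" "(A - mat l) *v v = 0"
      using invertible_det_nz[of "A - mat l"] invertible_left_inverse[of "A - mat l"]
        matrix_left_invertible_ker[of "A - mat l"] by blast
    have "(A - mat l) *v v = A *v v - l *\<^sub>R v"
      by (simp add: vec_eq_iff forall_2 matrix_vector_mult_def sum_2 mat_def algebra_simps)
    then have "A *v v = l *\<^sub>R v" using v(2) by simp
    then show False using finite_order_eigenvector_involution[OF Ak v(1)] has_matrix_order_not_involution[OF A] by blast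
  qed
  then show ?thesis using d by linarith
qed

text \<open>The axes are at half the argument of the complex number \<open>(p - w) + 2 q \<i>\<close>, whence the square root.\<close>

lemma quadratic_form_principal_axes:
  fixes p q w :: real
  obtains u v :: "real^2" where "norm u = 1" "norm v = 1" "u \<bullet> v = 0"
    "\<And>x. x = (x \<bullet> u) *\<^sub>R u + (x \<bullet> v) *\<^sub>R v"
    "p * (u$1 * v$1) + q * (u$1 * v$2 + u$2 * v$1) + w * (u$2 * v$2) = 0"
proof -
  define z where "z = csqrt (Complex (p - w) (2 * q))"
  define u1 where "u1 = (if z = 0 then 1 else Re z / cmod z)"
  define u2 where "u2 = (if z = 0 then 0 else Im z / cmod z)"
  have zz: "z * z = Complex (p - w) (2 * q)" unfolding z_def by (metis power2_csqrt power2_eq_square)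
  have re: "Re z * Re z - Im z * Im z = p - w" and im: "2 * (Re z * Im z) = 2 * q"
    using arg_cong[OF zz, of Re] arg_cong[OF zz, of Im] by (auto simp: algebra_simps)
  have n: "u1 * u1 + u2 * u2 = 1"
    using cmod_power2[of z] by (auto simp: u1_def u2_def power2_eq_square add_divide_distrib[symmetric])
  have "q * (u1 * u1 - u2 * u2) = (p - w) * (u1 * u2)"
  proof (cases "z = 0")
    case True then show ?thesis using re im by (simp add: u1_def u2_def)
  next
    case False
    have "q * (Re z * Re z - Im z * Im z) = (p - w) * (Re z * Im z)" using re im by simp
    then have "q * (Re z * Re z - Im z * Im z) / (cmod z * cmod z) = (p - w) * (Re z * Im z) / (cmod z * cmod z)" by simp
    then show ?thesis using False by (simp add: u1_def u2_def diff_divide_distrib algebra_simps)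
  qed
  then have ax: "p * (u1 * (- u2)) + q * (u1 * u1 + u2 * (- u2)) + w * (u2 * u1) = 0" by (simp add: algebra_simps)
  define u where "u = (vector [u1, u2] :: real^2)"
  define v where "v = (vector [- u2, u1] :: real^2)"
  have dot: "x \<bullet> y = x$1 * y$1 + x$2 * y$2" for x y :: "real^2" by (simp add: inner_vec_def sum_2)
  show ?thesis
  proof (rule that[of u v])
    show "norm u = 1" "norm v = 1" using n by (simp_all add: norm_eq_1 dot u_def v_def algebra_simps)
    show "u \<bullet> v = 0" by (simp add: dot u_def v_def)
    show "p * (u$1 * v$1) + q * (u$1 * v$2 + u$2 * v$1) + w * (u$2 * v$2) = 0"
      using ax by (simp add: u_def v_def)
    show "x = (x \<bullet> u) *\<^sub>R u + (x \<bullet> v) *\<^sub>R v" for x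
    proof -
      have "x$1 = x$1 * (u1*u1 + u2*u2)" "x$2 = x$2 * (u1*u1 + u2*u2)" by (simp_all add: n)
      then show ?thesis by (simp add: vec_eq_iff forall_2 dot u_def v_def algebra_simps)
    qed
  qed
qed

lemma definite_level_set_ellipse:
  fixes p q w :: real
  assumes def: "\<And>x :: real^2. x \<noteq> 0 \<Longrightarrow> 0 < p * (x$1 * x$1) + 2 * q * (x$1 * x$2) + w * (x$2 * x$2)"
  shows "is_ellipse {x :: real^2. p * (x$1 * x$1) + 2 * q * (x$1 * x$2) + w * (x$2 * x$2) = 1}"
proof -
  obtain u v :: "real^2" where uv: "norm u = 1" "norm v = 1" "u \<bullet> v = 0"
    "\<And>x. x = (x \<bullet> u) *\<^sub>R u + (x \<bullet> v) *\<^sub>R v"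
    "p * (u$1 * v$1) + q * (u$1 * v$2 + u$2 * v$1) + w * (u$2 * v$2) = 0"
    using quadratic_form_principal_axes by blast
  define Q where "Q x = p * (x$1 * x$1) + 2 * q * (x$1 * x$2) + w * (x$2 * x$2)" for x :: "real^2"
  have "u \<noteq> 0" "v \<noteq> 0" using uv by auto
  then have pos: "0 < Q u" "0 < Q v" using def by (auto simp: Q_def)
  have Q: "Q x = Q u * (x \<bullet> u)\<^sup>2 + Q v * (x \<bullet> v)\<^sup>2" for x
  proof -
    define a b where "a = x \<bullet> u" and "b = x \<bullet> v"
    have x: "x = a *\<^sub>R u + b *\<^sub>R v" using uv(4) by (simp add: a_def b_def)
    have "Q x = Q u * a\<^sup>2 + Q v * b\<^sup>2 + 2 * a * b * (p * (u$1 * v$1) + q * (u$1 * v$2 + u$2 * v$1) + w * (u$2 * v$2))"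
      unfolding x Q_def by (simp add: power2_eq_square algebra_simps)
    then show ?thesis using uv(5) by (simp add: a_def b_def)
  qed
  have eq: "Q x = (((x - 0) \<bullet> u) / (1 / sqrt (Q u)))\<^sup>2 + (((x - 0) \<bullet> v) / (1 / sqrt (Q v)))\<^sup>2" for x
    using Q[of x] pos by (simp add: power_mult_distrib mult.commute)
  have S: "{x. p * (x$1 * x$1) + 2 * q * (x$1 * x$2) + w * (x$2 * x$2) = 1} =
      {x. (((x - 0) \<bullet> u) / (1 / sqrt (Q u)))\<^sup>2 + (((x - 0) \<bullet> v) / (1 / sqrt (Q v)))\<^sup>2 = 1}"
    unfolding eq[symmetric] unfolding Q_def by (rule refl)
  have "0 < 1 / sqrt (Q u)" "0 < 1 / sqrt (Q v)" using pos by auto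
  then show ?thesis unfolding is_ellipse_def S using uv(1,2,3) by blast
qed

text \<open>The convex body \<open>K\<close> is the hull of its frontier and so lies in the solid ellipse. The frontier of \<open>K\<close> does
  not meet the open solid ellipse, which is connected and therefore contained in \<open>K\<close>.\<close>

lemma ellipse_of_definite_form:
  fixes p q w C :: real and K :: "(real^2) set"
  defines "Q x \<equiv> p * (x$1 * x$1) + 2 * q * (x$1 * x$2) + w * (x$2 * x$2)"
  assumes def: "\<And>x. x \<noteq> 0 \<Longrightarrow> 0 < Q x"
    and K: "compact K" "convex K" "interior K \<noteq> {}" and fr: "\<And>x. x \<in> frontier K \<Longrightarrow> Q x = 1"
  shows "is_ellipse (frontier K)"
proof -
  define D where "D = {x. Q x \<le> 1}"
  have Qc: "continuous_on UNIV Q" unfolding Q_def by (intro continuous_intros)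
  have Qconv: "Q ((1 - t) *\<^sub>R x + t *\<^sub>R y) \<le> (1 - t) * Q x + t * Q y" if "0 \<le> t" "t \<le> 1" for x y t
  proof -
    have "(1 - t) * Q x + t * Q y - Q ((1 - t) *\<^sub>R x + t *\<^sub>R y) = t * (1 - t) * Q (x - y)"
      by (simp add: Q_def algebra_simps)
    moreover have "0 \<le> Q (x - y)" using def[of "x - y"] by (cases "x = y") (auto simp: Q_def)
    ultimately show ?thesis using that by (smt (verit) mult_nonneg_nonneg)
  qed
  have "convex D" unfolding convex_alt
  proof (intro ballI allI impI)
    fix x y t assume *: "x \<in> D" "y \<in> D" "0 \<le> t \<and> t \<le> (1::real)"
    then have "(1 - t) * Q x + t * Q y \<le> (1 - t) * 1 + t * 1"
      by (intro add_mono mult_left_mono) (auto simp: D_def)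
    then show "(1 - t) *\<^sub>R x + t *\<^sub>R y \<in> D" using Qconv[of t x y] * by (simp add: D_def)
  qed
  have openlt: "open {x. Q x < 1}" by (rule open_Collect_less[OF Qc continuous_on_const])
  have conn: "connected {x. Q x < 1}"
  proof (rule convex_connected, unfold convex_alt, intro ballI allI impI)
    fix x y t assume *: "x \<in> {x. Q x < 1}" "y \<in> {x. Q x < 1}" "0 \<le> t \<and> t \<le> (1::real)"
    have "(1 - t) * Q x + t * Q y < 1"
    proof (cases "t = 0")
      case False
      then have "t * Q y < t * 1" using * by (intro mult_strict_left_mono) auto
      moreover have "(1 - t) * Q x \<le> (1 - t) * 1" using * by (intro mult_left_mono) auto
      ultimately show ?thesis by simp
    qed (use * in simp)
    then show "(1 - t) *\<^sub>R x + t *\<^sub>R y \<in> {x. Q x < 1}" using Qconv[of t x y] * by simp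
  qed
  have scale: "Q (c *\<^sub>R x) = c\<^sup>2 * Q x" for c x by (simp add: Q_def power2_eq_square algebra_simps)
  have KD: "K \<subseteq> D"
  proof -
    have "K = convex hull (frontier K)" using Krein_Milman_frontier[OF K(2,1)] .
    also have "\<dots> \<subseteq> D" using fr \<open>convex D\<close> by (intro hull_minimal) (auto simp: D_def)
    finally show ?thesis .
  qed
  have intK: "interior K \<subseteq> {x. Q x < 1}"
  proof
    fix x assume x: "x \<in> interior K"
    then obtain e where e: "0 < e" "ball x e \<subseteq> K" using mem_interior by blast
    show "x \<in> {x. Q x < 1}"
    proof (cases "x = 0")
      case False
      define c where "c = 1 + e / (2 * norm x)"
      have "dist (c *\<^sub>R x) x < e"
      proof -
        have "c *\<^sub>R x - x = (e / (2 * norm x)) *\<^sub>R x" by (simp add: c_def algebra_simps)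
        then show ?thesis using e(1) False by (simp add: dist_norm)
      qed
      then have "c *\<^sub>R x \<in> D" using e(2) KD by (auto simp: dist_commute subset_iff)
      then have "c\<^sup>2 * Q x \<le> 1" by (simp add: D_def scale)
      moreover have "1 < c" using e(1) False by (simp add: c_def)
      then have "1 < c\<^sup>2" by (simp add: power2_eq_square less_1_mult)
      then have "Q x < c\<^sup>2 * Q x" using def[OF False] by simp
      ultimately show ?thesis by simp
    qed (simp add: Q_def)
  qed
  have "{x. Q x < 1} \<subseteq> K"
  proof (rule ccontr)
    assume "\<not> ?thesis"
    then have "{x. Q x < 1} \<inter> frontier K \<noteq> {}"
      using connected_Int_frontier[OF conn, of K] K(3) intK interior_subset by blast
    then show False using fr by fastforce
  qed
  have "closure {x. Q x < 1} = D"
  proof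
    have "closed D" unfolding D_def by (rule closed_Collect_le[OF Qc continuous_on_const])
    then show "closure {x. Q x < 1} \<subseteq> D" by (rule closure_minimal[rotated]) (auto simp: D_def)
    show "D \<subseteq> closure {x. Q x < 1}"
    proof
      fix x assume x: "x \<in> D"
      have "(\<lambda>n. (1 - inverse (real (Suc n))) *\<^sub>R x) \<longlonglongrightarrow> (1 - 0) *\<^sub>R x"
        by (intro tendsto_intros LIMSEQ_inverse_real_of_nat)
      moreover have "(1 - inverse (real (Suc n))) *\<^sub>R x \<in> {x. Q x < 1}" for n
      proof -
        let ?c = "1 - inverse (real (Suc n))"
        have c: "0 \<le> ?c" "?c < 1" by (auto simp: field_simps)
        then have "?c\<^sup>2 < 1" by (simp add: power_less_one_iff)
        have "0 \<le> Q x" using def[of x] by (cases "x = 0") (auto simp: Q_def)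
        then have "?c\<^sup>2 * Q x \<le> ?c\<^sup>2 * 1" using x by (intro mult_left_mono) (auto simp: D_def)
        then show ?thesis using \<open>?c\<^sup>2 < 1\<close> by (simp only: scale mem_Collect_eq)
      qed
      ultimately show "x \<in> closure {x. Q x < 1}"
        unfolding closure_sequential by force
    qed
  qed
  then have "D \<subseteq> K" using closure_minimal[OF \<open>{x. Q x < 1} \<subseteq> K\<close> compact_imp_closed[OF K(1)]] by simp
  then have "K = D" using KD by blast
  have "frontier K = {x. Q x = 1}"
  proof
    show "frontier K \<subseteq> {x. Q x = 1}" using fr by blast
    show "{x. Q x = 1} \<subseteq> frontier K"
      using \<open>K = D\<close> intK compact_imp_closed[OF K(1)] by (auto simp: frontier_def D_def closure_closed)
  qed
  then show ?thesis using definite_level_set_ellipse[of p q w] def by (simp add: Q_def)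
qed

section \<open>Strictly convex curves\<close>

lemma vector_derivative_chain:
  assumes "(f has_derivative f') (at z)" "(g has_vector_derivative d) (at (f z))"
  shows "((\<lambda>z. g (f z)) has_derivative (\<lambda>h. f' h *\<^sub>R d)) (at z)"
  using has_derivative_compose[OF assms(1) assms(2)[unfolded has_vector_derivative_def]] .

locale convex_curve =
  fixes \<gamma> :: "real \<Rightarrow> real^2" and P :: real
  assumes curve: "strictly_convex_C2_curve \<gamma> P"
begin

abbreviation "\<gamma>' \<equiv> velocity \<gamma>"
definition "\<gamma>'' t = vector_derivative \<gamma>' (at t)"

lemma P: "0 < P" and periodic: "\<gamma> (t + P) = \<gamma> t" and inj: "inj_on \<gamma> {0..<P}"
  and vel_nz: "\<gamma>' t \<noteq> 0"
  using curve unfolding strictly_convex_C2_curve_def by auto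

lemma vel: "(\<gamma> has_vector_derivative \<gamma>' t) (at t)" and vel_cont: "continuous_on UNIV \<gamma>'"
  using curve unfolding strictly_convex_C2_curve_def C1_differentiable_on_eq
  by (auto simp: vector_derivative_works)

lemma acc: "(\<gamma>' has_vector_derivative \<gamma>'' t) (at t)" and acc_cont: "continuous_on UNIV \<gamma>''"
  using curve unfolding strictly_convex_C2_curve_def C1_differentiable_on_eq \<gamma>''_def[abs_def]
  by (auto simp: vector_derivative_works)

lemma cont: "continuous_on A \<gamma>" "continuous_on A \<gamma>'" "continuous_on A \<gamma>''"
proof -
  have "isCont \<gamma> t" for t using vel by (rule has_vector_derivative_continuous)
  then show "continuous_on A \<gamma>" by (simp add: continuous_at_imp_continuous_on)
qed (use vel_cont acc_cont continuous_on_subset in blast)+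

lemma periodic_int: "\<gamma> (t + of_int n * P) = \<gamma> t"
proof (induction n rule: int_induct[where k=0])
  case (step1 i) then show ?case using periodic[of "t + of_int i * P"] by (simp add: algebra_simps)
next
  case (step2 i) then show ?case using periodic[of "t + of_int (i - 1) * P"] by (simp add: algebra_simps)
qed simp

lemma derivative_shift:
  assumes "\<And>t. (f has_vector_derivative f' t) (at t)" "\<And>t. f (t + P) = f t"
  shows "f' (t + P) = f' t"
proof -
  have "((f \<circ> (\<lambda>t. t + P)) has_vector_derivative (1 *\<^sub>R f' (t + P))) (at t)"
    by (rule vector_diff_chain_at) (auto intro!: derivative_eq_intros assms(1))
  moreover have "f \<circ> (\<lambda>t. t + P) = f" using assms(2) by auto
  ultimately show ?thesis using assms(1)[of t] vector_derivative_unique_at by (metis scaleR_one)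
qed

lemma vel_periodic: "\<gamma>' (t + P) = \<gamma>' t" by (rule derivative_shift[OF vel periodic])
lemma acc_periodic: "\<gamma>'' (t + P) = \<gamma>'' t" by (rule derivative_shift[OF acc vel_periodic])

lemma same_point_iff: "\<gamma> s = \<gamma> t \<longleftrightarrow> (\<exists>n::int. s = t + of_int n * P)"
proof
  assume eq: "\<gamma> s = \<gamma> t"
  define red where "red x = x - of_int \<lfloor>x / P\<rfloor> * P" for x
  have red: "red x \<in> {0..<P}" for x
  proof -
    show ?thesis using floor_divide_lower[OF P, of x] floor_divide_upper[OF P, of x]
      by (simp add: red_def algebra_simps)
  qed
  have gred: "\<gamma> (red x) = \<gamma> x" for x using periodic_int[of "red x" "\<lfloor>x / P\<rfloor>"] by (simp add: red_def)
  have "red s = red t" using inj_onD[OF inj, of "red s" "red t"] red gred eq by simp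
  then have "s = t + of_int (\<lfloor>s / P\<rfloor> - \<lfloor>t / P\<rfloor>) * P" by (simp add: red_def algebra_simps)
  then show "\<exists>n::int. s = t + of_int n * P" by blast
qed (auto simp: periodic_int)

lemma distinct_within_period:
  assumes "s < t" "t < s + P" shows "\<gamma> s \<noteq> \<gamma> t"
proof
  assume "\<gamma> s = \<gamma> t"
  then obtain n :: int where n: "t = s + of_int n * P" using same_point_iff[of t s] by auto
  then have "0 < of_int n * P" "of_int n * P < 1 * P" using assms by auto
  then have "0 < (of_int n :: real)" "(of_int n :: real) < 1" using P by (auto simp: zero_less_mult_iff)
  then show False by simp
qed

text \<open>Every point of \<open>K\<close> is on the left of the tangent line, and the midpoint of a chord is interior to \<open>K\<close>.\<close>

lemma support: assumes "\<gamma> s \<noteq> \<gamma> t" shows "0 < bracket (\<gamma>' t) (\<gamma> s - \<gamma> t)"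
proof -
  obtain K where K: "compact K" "strictly_convex K" "frontier K = range \<gamma>"
    "\<And>t z. z \<in> interior K \<Longrightarrow> 0 < bracket (\<gamma>' t) (z - \<gamma> t)"
    using curve unfolding strictly_convex_C2_curve_def by blast
  have inK: "\<gamma> x \<in> K" for x using K(1,3) frontier_subset_closed[OF compact_imp_closed] by blast
  have "midpoint (\<gamma> s) (\<gamma> t) \<in> open_segment (\<gamma> s) (\<gamma> t)"
    using assms by (simp add: midpoint_in_open_segment)
  then have "midpoint (\<gamma> s) (\<gamma> t) \<in> interior K"
    using K(2) inK assms unfolding strictly_convex_def by blast
  then have "0 < bracket (\<gamma>' t) (midpoint (\<gamma> s) (\<gamma> t) - \<gamma> t)" by (rule K(4))
  moreover have "midpoint (\<gamma> s) (\<gamma> t) - \<gamma> t = (1/2) *\<^sub>R (\<gamma> s - \<gamma> t)"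
    by (simp add: midpoint_def algebra_simps scaleR_half_double[symmetric] flip: scaleR_left_distrib)
  ultimately show ?thesis by (simp add: bracket.scaleR_right)
qed

lemma support_within: "t < s \<Longrightarrow> s < t + P \<Longrightarrow> 0 < bracket (\<gamma>' t) (\<gamma> s - \<gamma> t)"
  "t < s \<Longrightarrow> s < t + P \<Longrightarrow> 0 < bracket (\<gamma>' s) (\<gamma> t - \<gamma> s)"
  using support distinct_within_period by metis+

definition "height t s = bracket (\<gamma>' t) (\<gamma> s - \<gamma> t)"

lemma height_deriv: "(height t has_real_derivative bracket (\<gamma>' t) (\<gamma>' s)) (at s)"
proof -
  have "((\<lambda>s. bracket (\<gamma>' t) (\<gamma> s - \<gamma> t)) has_vector_derivative bracket (\<gamma>' t) (\<gamma>' s)) (at s)"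
    using bounded_linear.has_vector_derivative[OF bracket.bounded_linear_right, of "\<lambda>s. \<gamma> s - \<gamma> t" "\<gamma>' s" "at s" "\<gamma>' t"]
      vel[of s] by (auto intro!: derivative_eq_intros simp: has_vector_derivative_diff_const)
  then show ?thesis by (simp add: height_def[abs_def] has_real_derivative_iff_has_vector_derivative)
qed

lemma height_cont: "continuous_on A (height t)"
  unfolding height_def[abs_def] by (intro continuous_intros cont bracket.continuous_on)

lemma wedge_cont: "continuous_on A (\<lambda>s. bracket (\<gamma>' t) (\<gamma>' s))"
  by (intro continuous_intros cont bracket.continuous_on)

lemma height_ends: "height t t = 0" "height t (t + P) = 0"
  by (simp_all add: height_def periodic bracket.zero_right)

lemma height_pos: "t < s \<Longrightarrow> s < t + P \<Longrightarrow> 0 < height t s"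
  by (simp add: height_def support_within)

text \<open>Where the tangent is parallel to the one at \<open>t\<close>, support at both points forces the two tangents to be
  antiparallel, and support at \<open>m\<close> makes \<open>m\<close> the unique highest point.\<close>

lemma height_critical:
  assumes m: "t < m" "m < t + P" "bracket (\<gamma>' t) (\<gamma>' m) = 0"
    and s: "t < s" "s < t + P" "s \<noteq> m"
  shows "height t s < height t m"
proof -
  obtain c where c: "\<gamma>' m = c *\<^sub>R \<gamma>' t" using bracket_zero_parallel[OF m(3) vel_nz] by blast
  have "0 < bracket (\<gamma>' m) (\<gamma> t - \<gamma> m)" using support_within(2) m by blast
  then have "0 < c * - height t m"
    by (simp add: c height_def bracket.scaleR_left bracket.diff_right algebra_simps)
  then have "c < 0" using height_pos[OF m(1,2)] by (simp add: mult_less_0_iff)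
  have "0 < bracket (\<gamma>' m) (\<gamma> s - \<gamma> m)"
    using support_within[of m s] support_within[of s m] s m by linarith
  then have "0 < c * (height t s - height t m)"
    by (simp add: c height_def bracket.scaleR_left bracket.diff_right algebra_simps)
  then show ?thesis using \<open>c < 0\<close> by (simp add: zero_less_mult_iff)
qed

lemma height_critical_unique:
  assumes "t < m" "m < t + P" "bracket (\<gamma>' t) (\<gamma>' m) = 0"
    and "t < n" "n < t + P" "bracket (\<gamma>' t) (\<gamma>' n) = 0"
  shows "m = n"
  using height_critical[of t m n] height_critical[of t n m] assms by force

lemma mvt: assumes "a < b" shows "\<exists>x. a < x \<and> x < b \<and> height t b - height t a = (b - a) * bracket (\<gamma>' t) (\<gamma>' x)"
  using MVT2[OF assms, of "height t" "\<lambda>s. bracket (\<gamma>' t) (\<gamma>' s)"] height_deriv by blast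

lemma wedge_zero:
  assumes "a \<le> b" "bracket (\<gamma>' t) (\<gamma>' a) \<le> 0 \<and> 0 \<le> bracket (\<gamma>' t) (\<gamma>' b) \<or>
    0 \<le> bracket (\<gamma>' t) (\<gamma>' a) \<and> bracket (\<gamma>' t) (\<gamma>' b) \<le> 0"
  shows "\<exists>x. a \<le> x \<and> x \<le> b \<and> bracket (\<gamma>' t) (\<gamma>' x) = 0"
  using IVT'[of "\<lambda>s. bracket (\<gamma>' t) (\<gamma>' s)" a 0 b] IVT2'[of "\<lambda>s. bracket (\<gamma>' t) (\<gamma>' s)" b 0 a]
    assms wedge_cont[of "{a..b}" t] by blast

text \<open>If the derivative of the height over the tangent at \<open>t\<close> were not positive at \<open>p\<close>, it would have a zero
  not later than \<open>p\<close>, and another one before it becomes positive again at \<open>q\<close>.\<close>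

lemma wedge_pos_shrink_right:
  assumes "t < p" "p < q" "q < t + P" "0 < bracket (\<gamma>' t) (\<gamma>' q)"
  shows "0 < bracket (\<gamma>' t) (\<gamma>' p)"
proof (rule ccontr)
  assume np: "\<not> ?thesis"
  obtain x where x: "t < x" "x < p" "height t p - height t t = (p - t) * bracket (\<gamma>' t) (\<gamma>' x)"
    using mvt[OF assms(1)] by blast
  have "0 < (p - t) * bracket (\<gamma>' t) (\<gamma>' x)"
    using x(3) height_ends height_pos[of t p] assms by simp
  then have "0 < bracket (\<gamma>' t) (\<gamma>' x)" using assms(1) by (simp add: zero_less_mult_iff)
  then obtain m where m: "x \<le> m" "m \<le> p" "bracket (\<gamma>' t) (\<gamma>' m) = 0"
    using wedge_zero[of x p t] np x by force
  obtain y where y: "m < y" "y < q" "height t q - height t m = (q - m) * bracket (\<gamma>' t) (\<gamma>' y)"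
    using mvt[of m q t] m assms by force
  have "height t q < height t m" by (rule height_critical) (use m x assms in auto)
  then have "(q - m) * bracket (\<gamma>' t) (\<gamma>' y) < 0" using y(3) by simp
  then have "bracket (\<gamma>' t) (\<gamma>' y) < 0" using y by (simp add: mult_less_0_iff)
  then obtain n where "y \<le> n" "n \<le> q" "bracket (\<gamma>' t) (\<gamma>' n) = 0"
    using wedge_zero[of y q t] assms y by force
  then show False using height_critical_unique[of t m n] m x y assms by force
qed

text \<open>The mirror image of \<open>wedge_pos_shrink_right\<close>, seen from \<open>q\<close> with \<open>t\<close> and \<open>p\<close> moved one period ahead.\<close>

lemma wedge_pos_shrink_left:
  assumes "t < p" "p < q" "q < t + P" "0 < bracket (\<gamma>' t) (\<gamma>' q)"
  shows "0 < bracket (\<gamma>' p) (\<gamma>' q)"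
proof (rule ccontr)
  assume "\<not> ?thesis"
  then have np: "0 \<le> bracket (\<gamma>' q) (\<gamma>' (p + P))"
    using bracket_swap[of "\<gamma>' p" "\<gamma>' q"] by (simp add: vel_periodic)
  have neg: "bracket (\<gamma>' q) (\<gamma>' (t + P)) < 0"
    using assms(4) bracket_swap[of "\<gamma>' t" "\<gamma>' q"] by (simp add: vel_periodic)
  have pq: "p + P < q + P" using assms by simp
  obtain x where x: "p + P < x" "x < q + P" "height q (q + P) - height q (p + P) = (q + P - (p + P)) * bracket (\<gamma>' q) (\<gamma>' x)"
    using mvt[OF pq] by blast
  have "(q - p) * bracket (\<gamma>' q) (\<gamma>' x) < 0"
    using x(3) height_ends height_pos[of q "p + P"] assms by simp
  then have "bracket (\<gamma>' q) (\<gamma>' x) < 0" using assms by (simp add: mult_less_0_iff)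
  then obtain m where m: "p + P \<le> m" "m \<le> x" "bracket (\<gamma>' q) (\<gamma>' m) = 0"
    using wedge_zero[of "p + P" x q] np x by force
  obtain y where y: "t + P < y" "y < m" "height q m - height q (t + P) = (m - (t + P)) * bracket (\<gamma>' q) (\<gamma>' y)"
    using mvt[of "t + P" m q] m assms by force
  have "height q (t + P) < height q m" by (rule height_critical) (use m x assms in auto)
  then have "0 < (m - (t + P)) * bracket (\<gamma>' q) (\<gamma>' y)" using y(3) by simp
  then have "0 < bracket (\<gamma>' q) (\<gamma>' y)" using y by (simp add: zero_less_mult_iff)
  then obtain n where "t + P \<le> n" "n \<le> y" "bracket (\<gamma>' q) (\<gamma>' n) = 0"
    using wedge_zero[of "t + P" y q] neg y by force
  then show False using height_critical_unique[of q m n] m x y assms by force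
qed

lemma wedge_pos_near:
  assumes "t < b" obtains s where "t < s" "s < b" "s < t + P" "0 < bracket (\<gamma>' t) (\<gamma>' s)"
proof -
  define q where "q = min ((t + b) / 2) (t + P / 2)"
  have q: "t < q" "q < b" "q < t + P" using assms P by (auto simp: q_def min_def field_simps)
  obtain x where x: "t < x" "x < q" "height t q - height t t = (q - t) * bracket (\<gamma>' t) (\<gamma>' x)"
    using mvt[OF q(1)] by blast
  have "0 < (q - t) * bracket (\<gamma>' t) (\<gamma>' x)"
    using x(3) height_ends height_pos[OF q(1,3)] by simp
  then have "0 < bracket (\<gamma>' t) (\<gamma>' x)" using q by (simp add: zero_less_mult_iff)
  then show ?thesis using that[of x] x q by simp
qed

definition "pairs = {(t, t1). t < t1 \<and> t1 < t + P \<and> 0 < bracket (\<gamma>' t) (\<gamma>' t1)}"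

lemma open_pairs: "open pairs"
proof -
  have eq: "pairs = {z. fst z < snd z} \<inter> {z. snd z < fst z + P} \<inter> {z. 0 < bracket (\<gamma>' (fst z)) (\<gamma>' (snd z))}"
    by (auto simp: pairs_def)
  have "continuous_on UNIV (\<lambda>z. bracket (\<gamma>' (fst z)) (\<gamma>' (snd z)))"
    by (intro bracket.continuous_on continuous_on_compose2[OF cont(2)[of UNIV]] continuous_intros) auto
  then show ?thesis unfolding eq by (intro open_Int open_Collect_less continuous_intros)
qed

lemma gamma_fst_deriv: "((\<lambda>z. \<gamma> (fst z)) has_derivative (\<lambda>h. fst h *\<^sub>R \<gamma>' (fst z))) (at (z :: real \<times> real))"
  and gamma_snd_deriv: "((\<lambda>z. \<gamma> (snd z)) has_derivative (\<lambda>h. snd h *\<^sub>R \<gamma>' (snd z))) (at (z :: real \<times> real))"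
  and vel_fst_deriv: "((\<lambda>z. \<gamma>' (fst z)) has_derivative (\<lambda>h. fst h *\<^sub>R \<gamma>'' (fst z))) (at (z :: real \<times> real))"
  and vel_snd_deriv: "((\<lambda>z. \<gamma>' (snd z)) has_derivative (\<lambda>h. snd h *\<^sub>R \<gamma>'' (snd z))) (at (z :: real \<times> real))"
  using vector_derivative_chain[OF has_derivative_fst[OF has_derivative_ident] vel]
    vector_derivative_chain[OF has_derivative_snd[OF has_derivative_ident] vel]
    vector_derivative_chain[OF has_derivative_fst[OF has_derivative_ident] acc]
    vector_derivative_chain[OF has_derivative_snd[OF has_derivative_ident] acc] by blast+

end

section \<open>The two billiards as twist maps\<close>

context convex_curve begin

lemma pairs_period: "(t, t1) \<in> pairs \<Longrightarrow> (t + P, t1 + P) \<in> pairs"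
  by (simp add: pairs_def vel_periodic)

lemma pairsD: "(t, t1) \<in> pairs \<Longrightarrow> t < t1 \<and> t1 < t + P \<and> 0 < bracket (\<gamma>' t) (\<gamma>' t1)"
  by (simp add: pairs_def)

lemma cont_comp:
  fixes g :: "real \<times> real \<Rightarrow> real" assumes "continuous_on A g"
  shows "continuous_on A (\<lambda>z. \<gamma> (g z))" "continuous_on A (\<lambda>z. \<gamma>' (g z))" "continuous_on A (\<lambda>z. \<gamma>'' (g z))"
  by (rule continuous_on_compose2[OF cont(1)[of UNIV] assms], simp)
     (rule continuous_on_compose2[OF cont(2)[of UNIV] assms], simp,
      rule continuous_on_compose2[OF cont(3)[of UNIV] assms], simp)

lemmas cont_parts = cont_comp[OF continuous_on_fst[OF continuous_on_id]] cont_comp[OF continuous_on_snd[OF continuous_on_id]]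

lemma symplectic_twist:
  "twist_billiard P (-1) pairs (\<lambda>t t1. - bracket (\<gamma>' t) (\<gamma> t1)) (\<lambda>t t1. bracket (\<gamma> t) (\<gamma>' t1))
    (symplectic_phase \<gamma> P) (symplectic_billiard \<gamma> P) (\<lambda>_. 1)
    (\<lambda>z. - bracket (\<gamma>'' (fst z)) (\<gamma> (snd z))) (\<lambda>z. - bracket (\<gamma>' (fst z)) (\<gamma>' (snd z)))
    (\<lambda>z. bracket (\<gamma>' (fst z)) (\<gamma>' (snd z))) (\<lambda>z. bracket (\<gamma> (fst z)) (\<gamma>'' (snd z)))"
proof -
  have alpha_mono: "-1 * - bracket (\<gamma>' t) (\<gamma> t1) < -1 * - bracket (\<gamma>' t) (\<gamma> t2)"
    if p: "(t, t1) \<in> pairs" "(t, t2) \<in> pairs" "t1 < t2" for t t1 t2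
  proof -
    have "height t t1 < height t t2"
    proof (rule DERIV_pos_imp_increasing[OF p(3)])
      fix x assume x: "t1 \<le> x" "x \<le> t2"
      have "0 < bracket (\<gamma>' t) (\<gamma>' x)"
        using wedge_pos_shrink_right[of t x t2] pairsD[OF p(1)] pairsD[OF p(2)] x by (cases "x = t2") auto
      then show "\<exists>y. (height t has_real_derivative y) (at x) \<and> 0 < y" using height_deriv by blast
    qed
    then show ?thesis by (simp add: height_def bracket.diff_right)
  qed
  have beta_mono: "-1 * bracket (\<gamma> t') (\<gamma>' t1) < -1 * bracket (\<gamma> t) (\<gamma>' t1)"
    if p: "(t, t1) \<in> pairs" "(t', t1) \<in> pairs" "t < t'" for t t' t1
  proof -
    have "height t1 t' < height t1 t"
    proof (rule DERIV_neg_imp_decreasing[OF p(3)])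
      fix x assume x: "t \<le> x" "x \<le> t'"
      have "0 < bracket (\<gamma>' x) (\<gamma>' t1)"
        using wedge_pos_shrink_left[of t x t1] pairsD[OF p(1)] pairsD[OF p(2)] x by (cases "x = t") auto
      then have "bracket (\<gamma>' t1) (\<gamma>' x) < 0" by (subst bracket_swap) simp
      then show "\<exists>y. (height t1 has_real_derivative y) (at x) \<and> y < 0" using height_deriv by blast
    qed
    then have "bracket (\<gamma>' t1) (\<gamma> t') < bracket (\<gamma>' t1) (\<gamma> t)" by (simp add: height_def bracket.diff_right)
    then show ?thesis using bracket_swap[of "\<gamma>' t1" "\<gamma> t'"] bracket_swap[of "\<gamma>' t1" "\<gamma> t"] by simp
  qed
  show ?thesis
  proof (unfold_locales)
    show "0 < P" "open pairs" by (fact P open_pairs)+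
    show "\<And>t t1. (t, t1) \<in> pairs \<Longrightarrow> t < t1" by (simp add: pairs_def)
    show "\<And>t t1. (t, t1) \<in> pairs \<Longrightarrow> (t + P, t1 + P) \<in> pairs" by (rule pairs_period)
    show "\<exists>t1. (t, t1) \<in> pairs \<and> y = - bracket (\<gamma>' t) (\<gamma> t1)" if "(t, y) \<in> symplectic_phase \<gamma> P" for t y
      using that by (auto simp: symplectic_phase_def pairs_def)
    show "symplectic_billiard \<gamma> P (t, - bracket (\<gamma>' t) (\<gamma> t1)) = (t1, bracket (\<gamma> t) (\<gamma>' t1))"
      if p: "(t, t1) \<in> pairs" for t t1
      unfolding symplectic_billiard_def split
    proof (rule the_equality)
      show "case (t1, bracket (\<gamma> t) (\<gamma>' t1)) of (ta, s1) \<Rightarrow> t < ta \<and> ta < t + P \<and> 0 < bracket (\<gamma>' t) (\<gamma>' ta) \<and>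
          - bracket (\<gamma>' t) (\<gamma> t1) = - bracket (\<gamma>' t) (\<gamma> ta) \<and> s1 = bracket (\<gamma> t) (\<gamma>' ta)"
        using pairsD[OF p] by simp
      fix q :: "real \<times> real"
      assume q: "case q of (ta, s1) \<Rightarrow> t < ta \<and> ta < t + P \<and> 0 < bracket (\<gamma>' t) (\<gamma>' ta) \<and>
          - bracket (\<gamma>' t) (\<gamma> t1) = - bracket (\<gamma>' t) (\<gamma> ta) \<and> s1 = bracket (\<gamma> t) (\<gamma>' ta)"
      then have "(t, fst q) \<in> pairs" "bracket (\<gamma>' t) (\<gamma> t1) = bracket (\<gamma>' t) (\<gamma> (fst q))"
        by (auto simp: pairs_def)
      then have "fst q = t1" using alpha_mono[of t t1 "fst q"] alpha_mono[of t "fst q" t1] p by force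
      then show "q = (t1, bracket (\<gamma> t) (\<gamma>' t1))" using q by (auto simp: prod_eq_iff split: prod.splits)
    qed
    fix z :: "real \<times> real"
    show "((\<lambda>z. - bracket (\<gamma>' (fst z)) (\<gamma> (snd z))) has_derivative
        (\<lambda>h. - bracket (\<gamma>'' (fst z)) (\<gamma> (snd z)) * fst h + - bracket (\<gamma>' (fst z)) (\<gamma>' (snd z)) * snd h)) (at z)"
      using has_derivative_minus[OF bracket.FDERIV[OF vel_fst_deriv gamma_snd_deriv]]
      by (rule has_derivative_eq_rhs) (simp add: fun_eq_iff bracket.scaleR_left bracket.scaleR_right)
    show "((\<lambda>z. bracket (\<gamma> (fst z)) (\<gamma>' (snd z))) has_derivative
        (\<lambda>h. bracket (\<gamma>' (fst z)) (\<gamma>' (snd z)) * fst h + bracket (\<gamma> (fst z)) (\<gamma>'' (snd z)) * snd h)) (at z)"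
      using bracket.FDERIV[OF gamma_fst_deriv vel_snd_deriv]
      by (rule has_derivative_eq_rhs) (simp add: fun_eq_iff bracket.scaleR_left bracket.scaleR_right)
  next
    show "continuous_on pairs (\<lambda>z. - bracket (\<gamma>' (fst z)) (\<gamma>' (snd z)))"
      "continuous_on pairs (\<lambda>z. bracket (\<gamma>' (fst z)) (\<gamma>' (snd z)))"
      by (intro continuous_on_minus bracket.continuous_on cont_parts)+
    show "\<exists>t\<in>{a<..<b}. \<forall>y. (t, y) \<in> symplectic_phase \<gamma> P \<longrightarrow> 1 \<noteq> (0 :: real)" if "a < b" for a b :: real
      using dense[OF that] by auto
  qed (use alpha_mono beta_mono in \<open>auto simp: periodic vel_periodic\<close>)
qed

text \<open>The intersection point of the tangents at \<open>t\<close> and \<open>t1\<close> is \<open>\<gamma> t + out_length t t1 \<cdot> \<gamma>' t\<close> and also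
  \<open>\<gamma> t1 - in_length t t1 \<cdot> \<gamma>' t1\<close>, by Cramer's rule. In the coordinates \<open>(t, l)\<close> on the exterior of
  the curve, \<open>curvature_density\<close> is the density of the area of the plane.\<close>

definition "out_length t t1 = bracket (\<gamma> t1 - \<gamma> t) (\<gamma>' t1) / bracket (\<gamma>' t) (\<gamma>' t1)"
definition "in_length t t1 = bracket (\<gamma>' t) (\<gamma> t1 - \<gamma> t) / bracket (\<gamma>' t) (\<gamma>' t1)"
definition "curvature_density z = \<bar>snd z * bracket (\<gamma>' (fst z)) (\<gamma>'' (fst z))\<bar>"

lemma cramer:
  assumes "bracket a b \<noteq> 0"
  shows "x + l *\<^sub>R a = y - m *\<^sub>R b \<longleftrightarrow> l = bracket (y - x) b / bracket a b \<and> m = bracket a (y - x) / bracket a b"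
proof
  assume "x + l *\<^sub>R a = y - m *\<^sub>R b"
  then have yx: "y - x = l *\<^sub>R a + m *\<^sub>R b" by (simp add: algebra_simps)
  show "l = bracket (y - x) b / bracket a b \<and> m = bracket a (y - x) / bracket a b"
    unfolding yx using assms
    by (simp add: bracket.add_left bracket.add_right bracket.scaleR_left bracket.scaleR_right)
next
  assume lm: "l = bracket (y - x) b / bracket a b \<and> m = bracket a (y - x) / bracket a b"
  have "bracket a b *\<^sub>R (y - x) = bracket (y - x) b *\<^sub>R a + bracket a (y - x) *\<^sub>R b"
    by (simp add: vec_eq_iff forall_2 bracket_eq algebra_simps)
  then have "(1 / bracket a b) *\<^sub>R (bracket a b *\<^sub>R (y - x)) = (1 / bracket a b) *\<^sub>R (bracket (y - x) b *\<^sub>R a + bracket a (y - x) *\<^sub>R b)"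
    by simp
  then have "y - x = l *\<^sub>R a + m *\<^sub>R b" using assms lm by (simp add: scaleR_right_distrib)
  then show "x + l *\<^sub>R a = y - m *\<^sub>R b" by (simp add: algebra_simps)
qed

lemma tangents_meet:
  assumes "(t, t1) \<in> pairs"
  shows "\<gamma> t + out_length t t1 *\<^sub>R \<gamma>' t = \<gamma> t1 - in_length t t1 *\<^sub>R \<gamma>' t1"
    and "0 < out_length t t1" "0 < in_length t t1"
proof -
  have p: "t < t1" "t1 < t + P" "0 < bracket (\<gamma>' t) (\<gamma>' t1)" using pairsD[OF assms] by auto
  show "\<gamma> t + out_length t t1 *\<^sub>R \<gamma>' t = \<gamma> t1 - in_length t t1 *\<^sub>R \<gamma>' t1"
    using cramer[of "\<gamma>' t" "\<gamma>' t1"] p by (simp add: out_length_def in_length_def)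
  have "bracket (\<gamma> t1 - \<gamma> t) (\<gamma>' t1) = bracket (\<gamma>' t1) (\<gamma> t - \<gamma> t1)" by (simp add: bracket_eq algebra_simps)
  then show "0 < out_length t t1" "0 < in_length t t1"
    using p support_within[of t t1] by (simp_all add: out_length_def in_length_def)
qed

text \<open>The point of the tangent at \<open>t\<close> where the tangent at \<open>t1\<close> arrives is to the left of the tangent at \<open>t2\<close>: it is
  reached from \<open>\<gamma> t1\<close> by going backwards along the tangent at \<open>t1\<close>, which leads away from that line.\<close>

lemma out_length_mono:
  assumes p: "(t, t1) \<in> pairs" "(t, t2) \<in> pairs" "t1 < t2"
  shows "out_length t t1 < out_length t t2"
proof -
  note b = pairsD[OF p(1)] pairsD[OF p(2)]
  have w12: "0 < bracket (\<gamma>' t1) (\<gamma>' t2)" using wedge_pos_shrink_left[of t t1 t2] b p by auto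
  have "0 < bracket (\<gamma>' t2) (\<gamma> t1 - \<gamma> t2)" using support_within(2)[of t1 t2] b p by auto
  moreover have "0 < in_length t t1 * bracket (\<gamma>' t1) (\<gamma>' t2)" using tangents_meet(3)[OF p(1)] w12 by simp
  moreover have "bracket (\<gamma>' t2) (\<gamma> t1 - \<gamma> t2) + in_length t t1 * bracket (\<gamma>' t1) (\<gamma>' t2) =
      bracket (\<gamma>' t2) ((\<gamma> t1 - in_length t t1 *\<^sub>R \<gamma>' t1) - \<gamma> t2)"
    by (simp add: bracket_eq algebra_simps)
  moreover have "\<gamma> t1 - in_length t t1 *\<^sub>R \<gamma>' t1 = \<gamma> t + out_length t t1 *\<^sub>R \<gamma>' t" using tangents_meet(1)[OF p(1)] by simp
  moreover have "\<gamma> t2 = \<gamma> t + out_length t t2 *\<^sub>R \<gamma>' t + in_length t t2 *\<^sub>R \<gamma>' t2"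
    using tangents_meet(1)[OF p(2)] by (simp add: algebra_simps)
  moreover have "bracket (\<gamma>' t2) ((\<gamma> t + out_length t t1 *\<^sub>R \<gamma>' t) - (\<gamma> t + out_length t t2 *\<^sub>R \<gamma>' t + in_length t t2 *\<^sub>R \<gamma>' t2)) =
      (out_length t t2 - out_length t t1) * bracket (\<gamma>' t) (\<gamma>' t2)"
    by (simp add: bracket_eq algebra_simps)
  ultimately have "0 < (out_length t t2 - out_length t t1) * bracket (\<gamma>' t) (\<gamma>' t2)" by simp
  then show ?thesis using b by (simp add: zero_less_mult_iff)
qed

lemma in_length_antimono:
  assumes p: "(t, t1) \<in> pairs" "(t', t1) \<in> pairs" "t < t'"
  shows "in_length t' t1 < in_length t t1"
proof -
  note b = pairsD[OF p(1)] pairsD[OF p(2)]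
  have w: "0 < bracket (\<gamma>' t) (\<gamma>' t')" using wedge_pos_shrink_right[of t t' t1] b p by auto
  have "0 < bracket (\<gamma>' t) (\<gamma> t' - \<gamma> t)" using support_within(1)[of t t'] b p by auto
  moreover have "0 < out_length t' t1 * bracket (\<gamma>' t) (\<gamma>' t')" using tangents_meet(2)[OF p(2)] w by simp
  moreover have "bracket (\<gamma>' t) (\<gamma> t' - \<gamma> t) + out_length t' t1 * bracket (\<gamma>' t) (\<gamma>' t') =
      bracket (\<gamma>' t) ((\<gamma> t' + out_length t' t1 *\<^sub>R \<gamma>' t') - \<gamma> t)"
    by (simp add: bracket_eq algebra_simps)
  moreover have "\<gamma> t' + out_length t' t1 *\<^sub>R \<gamma>' t' = \<gamma> t1 - in_length t' t1 *\<^sub>R \<gamma>' t1" by (rule tangents_meet(1)[OF p(2)])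
  moreover have "\<gamma> t1 = \<gamma> t + out_length t t1 *\<^sub>R \<gamma>' t + in_length t t1 *\<^sub>R \<gamma>' t1"
    using tangents_meet(1)[OF p(1)] by (simp add: algebra_simps)
  moreover have "bracket (\<gamma>' t) ((\<gamma> t + out_length t t1 *\<^sub>R \<gamma>' t + in_length t t1 *\<^sub>R \<gamma>' t1 - in_length t' t1 *\<^sub>R \<gamma>' t1) - \<gamma> t) =
      (in_length t t1 - in_length t' t1) * bracket (\<gamma>' t) (\<gamma>' t1)"
    by (simp add: bracket_eq algebra_simps)
  ultimately have "0 < (in_length t t1 - in_length t' t1) * bracket (\<gamma>' t) (\<gamma>' t1)" by simp
  then show ?thesis using b by (simp add: zero_less_mult_iff)
qed

text \<open>Seen from the point \<open>x\<close>, the slope \<open>e / height\<close> of the curve against the normal of the tangent at \<open>t\<close>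
  tends to \<open>- \<infinity>\<close> at both ends of the period. At an interior maximum the line from \<open>x\<close> to the curve
  is tangent, and by support at that point it is tangent in the required direction.\<close>

lemma right_tangent_exists:
  assumes l: "0 < l" obtains t1 where "(t, t1) \<in> pairs" "out_length t t1 = l"
proof -
  define a where "a = \<gamma>' t"
  define x where "x = \<gamma> t + l *\<^sub>R a"
  define e where "e s = a \<bullet> (\<gamma> s - x)" for s
  define q where "q s = e s / height t s" for s
  have a0: "0 < a \<bullet> a" using vel_nz by (simp add: a_def)
  have ec: "continuous_on A e" for A unfolding e_def[abs_def] by (intro continuous_intros cont)
  have e_deriv: "(e has_real_derivative a \<bullet> \<gamma>' s) (at s)" for s
  proof -
    have "(e has_vector_derivative a \<bullet> \<gamma>' s) (at s)"
      unfolding e_def[abs_def]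
      using bounded_linear.has_vector_derivative[OF bounded_linear_inner_right, of "\<lambda>s. \<gamma> s - x" "\<gamma>' s" "at s" a]
        vel[of s] by (auto simp: has_vector_derivative_diff_const)
    then show ?thesis by (simp add: has_real_derivative_iff_has_vector_derivative)
  qed
  define m0 where "m0 = t + P / 2"
  have m0: "t < m0" "m0 < t + P" using P by (auto simp: m0_def)
  define E where "E s = e s - q m0 * height t s" for s
  have Ec: "continuous_on A E" for A unfolding E_def[abs_def] by (intro continuous_intros ec height_cont)
  have "e t = - (l * (a \<bullet> a))" "e (t + P) = - (l * (a \<bullet> a))"
    by (simp_all add: e_def x_def periodic inner_diff_right inner_add_right)
  then have E0: "E t < 0" "E (t + P) < 0" using a0 l by (simp_all add: E_def height_ends)
  have Em: "E m0 = 0" using height_pos[OF m0] by (simp add: E_def q_def)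
  have isC: "isCont E s" for s using Ec[of UNIV] by (simp add: continuous_on_eq_continuous_at)
  have near: "\<exists>d>0. \<forall>s. \<bar>s - c\<bar> < d \<longrightarrow> E s < 0" if c: "E c < 0" for c
  proof -
    have "0 < - E c" using c by simp
    then obtain d where d: "0 < d" "\<And>s. \<bar>s - c\<bar> < d \<Longrightarrow> \<bar>E s - E c\<bar> < - E c"
      using isC[of c] unfolding continuous_at_eps_delta dist_real_def by blast
    have "E s < 0" if "\<bar>s - c\<bar> < d" for s using d(2)[OF that] by linarith
    then show ?thesis using d(1) by blast
  qed
  obtain d1 where d1: "0 < d1" "\<And>s. \<bar>s - t\<bar> < d1 \<Longrightarrow> E s < 0" using near[OF E0(1)] by blast
  obtain d2 where d2: "0 < d2" "\<And>s. \<bar>s - (t + P)\<bar> < d2 \<Longrightarrow> E s < 0" using near[OF E0(2)] by blast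
  define s1 where "s1 = t + min (d1 / 2) (P / 4)"
  define s2 where "s2 = t + P - min (d2 / 2) (P / 4)"
  have s1: "t < s1" "s1 < m0" "E s1 < 0" using d1 P by (auto simp: s1_def m0_def min_def)
  have s2: "m0 < s2" "s2 < t + P" "E s2 < 0" using d2 P by (auto simp: s2_def m0_def min_def)
  have hp: "0 < height t s" if "s1 \<le> s" "s \<le> s2" for s using height_pos that s1 s2 by auto
  have qlt: "q s < q m0" if "s1 \<le> s" "s \<le> s2" "E s < 0" for s
    using hp[OF that(1,2)] that(3) by (simp add: E_def q_def field_simps)
  have "continuous_on {s1..s2} q"
    unfolding q_def[abs_def] by (intro continuous_on_divide ec height_cont) (use hp in force)
  then obtain m where m: "m \<in> {s1..s2}" "\<And>s. s \<in> {s1..s2} \<Longrightarrow> q s \<le> q m"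
    using continuous_attains_sup[of "{s1..s2}" q] s1 s2 by auto
  have "q m0 \<le> q m" using m(2)[of m0] s1 s2 by auto
  then have m12: "s1 < m" "m < s2"
    using m(1) qlt[of s1] qlt[of s2] s1 s2 by (auto simp: less_le)
  have hm: "0 < height t m" using hp m12 by auto
  have "(q has_real_derivative ((a \<bullet> \<gamma>' m) * height t m - e m * bracket a (\<gamma>' m)) / (height t m * height t m)) (at m)"
    unfolding q_def[abs_def] using DERIV_divide[OF e_deriv height_deriv[of t m]] hm by (simp add: a_def)
  then have "((a \<bullet> \<gamma>' m) * height t m - e m * bracket a (\<gamma>' m)) / (height t m * height t m) = 0"
  proof (rule DERIV_local_max)
    show "0 < min (m - s1) (s2 - m)" using m12 by simp
    show "\<forall>y. \<bar>m - y\<bar> < min (m - s1) (s2 - m) \<longrightarrow> q y \<le> q m"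
    proof (intro allI impI)
      fix y assume "\<bar>m - y\<bar> < min (m - s1) (s2 - m)"
      then have "\<bar>m - y\<bar> < m - s1" "\<bar>m - y\<bar> < s2 - m" by simp_all
      then have "s1 \<le> y" "y \<le> s2" by linarith+
      then show "q y \<le> q m" using m(2) by simp
    qed
  qed
  then have z: "(a \<bullet> \<gamma>' m) * height t m - e m * bracket a (\<gamma>' m) = 0" using hm by auto
  have hx: "height t m = bracket a (\<gamma> m - x)"
    by (simp add: height_def x_def a_def bracket_eq algebra_simps)
  have "(a \<bullet> a) * bracket (\<gamma> m - x) (\<gamma>' m) = e m * bracket a (\<gamma>' m) - (a \<bullet> \<gamma>' m) * bracket a (\<gamma> m - x)"
    by (simp add: e_def bracket_eq inner_vec_def sum_2 algebra_simps)
  then have tang: "bracket (\<gamma>' m) (\<gamma> m - x) = 0"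
    using z hx a0 by (subst bracket_swap) simp
  obtain c where c: "\<gamma> m - x = c *\<^sub>R \<gamma>' m" using bracket_zero_parallel[OF tang vel_nz] by blast
  have tm: "t < m" "m < t + P" using m12 s1 s2 by auto
  have "0 < bracket (\<gamma>' m) (\<gamma> t - \<gamma> m)" by (rule support_within(2)[OF tm])
  moreover have "\<gamma> t - \<gamma> m = - (c *\<^sub>R \<gamma>' m) - l *\<^sub>R a" using c by (simp add: x_def algebra_simps)
  ultimately have "0 < l * bracket a (\<gamma>' m)"
    by (simp add: bracket_eq algebra_simps)
  then have w: "0 < bracket a (\<gamma>' m)" using l by (simp add: zero_less_mult_iff)
  have "\<gamma> m - \<gamma> t = c *\<^sub>R \<gamma>' m + l *\<^sub>R a" using c by (simp add: x_def algebra_simps)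
  then have "out_length t m = l" using w
    by (simp add: out_length_def a_def bracket.add_left bracket.scaleR_left)
  moreover have "(t, m) \<in> pairs" using tm w by (simp add: pairs_def a_def)
  ultimately show ?thesis by (rule that[rotated])
qed

text \<open>The partial derivatives are written in the form that exhibits the invariance of area: \<open>out_length\<^sub>2\<close> and
  \<open>in_length\<^sub>1\<close> are each the product of the other length and a curvature term, divided by the wedge.\<close>

definition "wedge z = bracket (\<gamma>' (fst z)) (\<gamma>' (snd z))" for z :: "real \<times> real"
definition "chord z = \<gamma> (snd z) - \<gamma> (fst z)" for z :: "real \<times> real"
definition "kappa t = bracket (\<gamma>' t) (\<gamma>'' t)"
definition "out_length\<^sub>1 z = - (bracket (chord z) (\<gamma>' (snd z)) * bracket (\<gamma>'' (fst z)) (\<gamma>' (snd z)) +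
   wedge z * wedge z) / (wedge z * wedge z)" for z :: "real \<times> real"
definition "in_length\<^sub>2 z = (wedge z * wedge z - bracket (\<gamma>' (fst z)) (chord z) * bracket (\<gamma>' (fst z)) (\<gamma>'' (snd z)))
   / (wedge z * wedge z)" for z :: "real \<times> real"
definition "out_length\<^sub>2 z = in_length (fst z) (snd z) * kappa (snd z) / wedge z" for z :: "real \<times> real"
definition "in_length\<^sub>1 z = - (out_length (fst z) (snd z) * kappa (fst z)) / wedge z" for z :: "real \<times> real"

lemma chord_deriv: "(chord has_derivative (\<lambda>h. snd h *\<^sub>R \<gamma>' (snd z) - fst h *\<^sub>R \<gamma>' (fst z))) (at z)"
  unfolding chord_def[abs_def] by (intro has_derivative_diff gamma_snd_deriv gamma_fst_deriv)

lemma wedge_deriv: "(wedge has_derivative (\<lambda>h. bracket (\<gamma>' (fst z)) (snd h *\<^sub>R \<gamma>'' (snd z)) +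
    bracket (fst h *\<^sub>R \<gamma>'' (fst z)) (\<gamma>' (snd z)))) (at z)"
  unfolding wedge_def[abs_def] by (rule bracket.FDERIV[OF vel_fst_deriv vel_snd_deriv])

lemma out_length_deriv:
  assumes "wedge z \<noteq> 0"
  shows "((\<lambda>z. out_length (fst z) (snd z)) has_derivative (\<lambda>h. out_length\<^sub>1 z * fst h + out_length\<^sub>2 z * snd h)) (at z)"
proof -
  let ?N = "\<lambda>z. bracket (chord z) (\<gamma>' (snd z))"
  let ?N' = "\<lambda>h. bracket (chord z) (snd h *\<^sub>R \<gamma>'' (snd z)) + bracket (snd h *\<^sub>R \<gamma>' (snd z) - fst h *\<^sub>R \<gamma>' (fst z)) (\<gamma>' (snd z))"
  let ?W' = "\<lambda>h. bracket (\<gamma>' (fst z)) (snd h *\<^sub>R \<gamma>'' (snd z)) + bracket (fst h *\<^sub>R \<gamma>'' (fst z)) (\<gamma>' (snd z))"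
  have "(?N has_derivative ?N') (at z)" by (rule bracket.FDERIV[OF chord_deriv vel_snd_deriv])
  from has_derivative_divide'[OF this wedge_deriv assms]
  have d: "((\<lambda>z. ?N z / wedge z) has_derivative (\<lambda>h. (?N' h * wedge z - ?N z * ?W' h) / (wedge z * wedge z))) (at z)" .
  have eq: "(\<lambda>z. out_length (fst z) (snd z)) = (\<lambda>z. ?N z / wedge z)"
    by (simp add: out_length_def chord_def wedge_def)
  \<comment> \<open>A Pluecker relation between the four plane vectors involved.\<close>
  have pl: "bracket (chord z) (\<gamma>'' (snd z)) * wedge z - ?N z * bracket (\<gamma>' (fst z)) (\<gamma>'' (snd z)) =
      bracket (\<gamma>' (fst z)) (chord z) * kappa (snd z)"
    by (simp add: bracket_eq wedge_def kappa_def algebra_simps)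
  show ?thesis unfolding eq
  proof (rule has_derivative_eq_rhs[OF d], rule ext)
    fix h :: "real \<times> real"
    have n: "?N' h = snd h * bracket (chord z) (\<gamma>'' (snd z)) - fst h * wedge z"
      by (simp add: bracket.scaleR_left bracket.scaleR_right bracket.diff_left wedge_def)
    have w: "?W' h = snd h * bracket (\<gamma>' (fst z)) (\<gamma>'' (snd z)) + fst h * bracket (\<gamma>'' (fst z)) (\<gamma>' (snd z))"
      by (simp add: bracket.scaleR_left bracket.scaleR_right)
    have "?N' h * wedge z - ?N z * ?W' h =
        snd h * (bracket (chord z) (\<gamma>'' (snd z)) * wedge z - ?N z * bracket (\<gamma>' (fst z)) (\<gamma>'' (snd z)))
        - fst h * (?N z * bracket (\<gamma>'' (fst z)) (\<gamma>' (snd z)) + wedge z * wedge z)"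
      unfolding n w by (simp add: algebra_simps)
    also have "\<dots> = snd h * (bracket (\<gamma>' (fst z)) (chord z) * kappa (snd z))
        - fst h * (?N z * bracket (\<gamma>'' (fst z)) (\<gamma>' (snd z)) + wedge z * wedge z)" unfolding pl ..
    finally have key: "?N' h * wedge z - ?N z * ?W' h = snd h * (bracket (\<gamma>' (fst z)) (chord z) * kappa (snd z))
        - fst h * (?N z * bracket (\<gamma>'' (fst z)) (\<gamma>' (snd z)) + wedge z * wedge z)" .
    have quotient: "(s * (B * K) - f * Y) / (w * w) = - Y / (w * w) * f + B / w * K / w * s" for s B K f Y w :: real
      by (simp add: diff_divide_distrib ac_simps)
    show "(?N' h * wedge z - ?N z * ?W' h) / (wedge z * wedge z) = out_length\<^sub>1 z * fst h + out_length\<^sub>2 z * snd h"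
      unfolding key out_length\<^sub>1_def out_length\<^sub>2_def in_length_def chord_def[symmetric] wedge_def[symmetric]
      by (rule quotient)
  qed
qed

lemma in_length_deriv:
  assumes "wedge z \<noteq> 0"
  shows "((\<lambda>z. in_length (fst z) (snd z)) has_derivative (\<lambda>h. in_length\<^sub>1 z * fst h + in_length\<^sub>2 z * snd h)) (at z)"
proof -
  let ?N = "\<lambda>z. bracket (\<gamma>' (fst z)) (chord z)"
  let ?N' = "\<lambda>h. bracket (\<gamma>' (fst z)) (snd h *\<^sub>R \<gamma>' (snd z) - fst h *\<^sub>R \<gamma>' (fst z)) + bracket (fst h *\<^sub>R \<gamma>'' (fst z)) (chord z)"
  let ?W' = "\<lambda>h. bracket (\<gamma>' (fst z)) (snd h *\<^sub>R \<gamma>'' (snd z)) + bracket (fst h *\<^sub>R \<gamma>'' (fst z)) (\<gamma>' (snd z))"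
  have "(?N has_derivative ?N') (at z)" by (rule bracket.FDERIV[OF vel_fst_deriv chord_deriv])
  from has_derivative_divide'[OF this wedge_deriv assms]
  have d: "((\<lambda>z. ?N z / wedge z) has_derivative (\<lambda>h. (?N' h * wedge z - ?N z * ?W' h) / (wedge z * wedge z))) (at z)" .
  have eq: "(\<lambda>z. in_length (fst z) (snd z)) = (\<lambda>z. ?N z / wedge z)"
    by (simp add: in_length_def chord_def wedge_def)
  have pl: "bracket (\<gamma>'' (fst z)) (chord z) * wedge z - ?N z * bracket (\<gamma>'' (fst z)) (\<gamma>' (snd z)) =
      - (bracket (chord z) (\<gamma>' (snd z)) * kappa (fst z))"
    by (simp add: bracket_eq wedge_def kappa_def algebra_simps)
  show ?thesis unfolding eq
  proof (rule has_derivative_eq_rhs[OF d], rule ext)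
    fix h :: "real \<times> real"
    have n: "?N' h = snd h * wedge z + fst h * bracket (\<gamma>'' (fst z)) (chord z)"
      by (simp add: bracket.scaleR_left bracket.scaleR_right bracket.diff_right wedge_def)
    have w: "?W' h = snd h * bracket (\<gamma>' (fst z)) (\<gamma>'' (snd z)) + fst h * bracket (\<gamma>'' (fst z)) (\<gamma>' (snd z))"
      by (simp add: bracket.scaleR_left bracket.scaleR_right)
    have "?N' h * wedge z - ?N z * ?W' h =
        fst h * (bracket (\<gamma>'' (fst z)) (chord z) * wedge z - ?N z * bracket (\<gamma>'' (fst z)) (\<gamma>' (snd z)))
        + snd h * (wedge z * wedge z - ?N z * bracket (\<gamma>' (fst z)) (\<gamma>'' (snd z)))"
      unfolding n w by (simp add: algebra_simps)
    also have "\<dots> = fst h * - (bracket (chord z) (\<gamma>' (snd z)) * kappa (fst z))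
        + snd h * (wedge z * wedge z - ?N z * bracket (\<gamma>' (fst z)) (\<gamma>'' (snd z)))" unfolding pl ..
    finally have key: "?N' h * wedge z - ?N z * ?W' h = fst h * - (bracket (chord z) (\<gamma>' (snd z)) * kappa (fst z))
        + snd h * (wedge z * wedge z - ?N z * bracket (\<gamma>' (fst z)) (\<gamma>'' (snd z)))" .
    have quotient: "(f * - (B * K) + s * Y) / (w * w) = - (B / w * K) / w * f + Y / (w * w) * s" for s B K f Y w :: real
      by (simp add: add_divide_distrib diff_divide_distrib ac_simps)
    show "(?N' h * wedge z - ?N z * ?W' h) / (wedge z * wedge z) = in_length\<^sub>1 z * fst h + in_length\<^sub>2 z * snd h"
      unfolding key in_length\<^sub>1_def in_length\<^sub>2_def out_length_def chord_def[symmetric] wedge_def[symmetric]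
      by (rule quotient)
  qed
qed

text \<open>Over a flat arc \<open>out_length t\<close> would have zero derivative, but it is strictly increasing.\<close>

lemma curvature_not_flat:
  assumes "a < b" shows "\<exists>t\<in>{a<..<b}. kappa t \<noteq> 0"
proof (rule ccontr)
  assume "\<not> ?thesis"
  then have flat: "kappa t = 0" if "a < t" "t < b" for t using that by auto
  define t where "t = (a + b) / 2"
  have t: "a < t" "t < b" using assms by (auto simp: t_def)
  obtain s where s: "t < s" "s < b" "s < t + P" "0 < bracket (\<gamma>' t) (\<gamma>' s)" using wedge_pos_near[OF t(2)] by blast
  have p: "(t, x) \<in> pairs" if "t < x" "x \<le> s" for x
    using wedge_pos_shrink_right[of t x s] that s by (cases "x = s") (auto simp: pairs_def)
  define u where "u = (t + s) / 2"
  have u: "t < u" "u < s" using s by (auto simp: u_def)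
  have "out_length t s = out_length t u"
  proof (rule DERIV_isconst_end[OF u(2)])
    have d: "((\<lambda>x. out_length t x) has_real_derivative 0) (at x)" if "u \<le> x" "x \<le> s" for x
    proof -
      have w: "wedge (t, x) \<noteq> 0" using pairsD[OF p[of x]] that u by (simp add: wedge_def)
      have "((\<lambda>x. (t, x)) has_derivative (\<lambda>h. (0, h))) (at x)" by (auto intro!: derivative_eq_intros)
      from has_derivative_compose[OF this, of "\<lambda>z. out_length (fst z) (snd z)" "\<lambda>h. out_length\<^sub>1 (t, x) * fst h + out_length\<^sub>2 (t, x) * snd h"]
      have "((\<lambda>x. out_length t x) has_derivative (\<lambda>h. out_length\<^sub>2 (t, x) * h)) (at x)"
        using out_length_deriv[OF w] by simp
      moreover have "out_length\<^sub>2 (t, x) = 0" using flat[of x] that u s t by (simp add: out_length\<^sub>2_def)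
      ultimately show ?thesis by (simp add: has_field_derivative_def lambda_zero)
    qed
    show "continuous_on {u..s} (out_length t)"
      by (intro continuous_at_imp_continuous_on ballI DERIV_isCont[OF d]) auto
    show "(out_length t has_real_derivative 0) (at x)" if "u < x" "x < s" for x using d that by simp
  qed
  moreover have "out_length t u < out_length t s" by (rule out_length_mono[OF p p]) (use u in auto)
  ultimately show False by simp
qed

lemma outer_twist:
  "twist_billiard P 1 pairs out_length in_length outer_phase (outer_billiard \<gamma> P) curvature_density
     out_length\<^sub>1 out_length\<^sub>2 in_length\<^sub>1 in_length\<^sub>2"
proof (unfold_locales)
  show "0 < P" "open pairs" by (fact P open_pairs)+
  show "\<And>t t1. (t, t1) \<in> pairs \<Longrightarrow> t < t1" by (simp add: pairs_def)
  show "\<And>t t1. (t, t1) \<in> pairs \<Longrightarrow> (t + P, t1 + P) \<in> pairs" by (rule pairs_period)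
  show "\<And>t t1. out_length (t + P) (t1 + P) = out_length t t1" "\<And>t t1. in_length (t + P) (t1 + P) = in_length t t1"
    by (simp_all add: out_length_def in_length_def periodic vel_periodic)
  show "1 * out_length t t1 < 1 * out_length t t2" if "(t, t1) \<in> pairs" "(t, t2) \<in> pairs" "t1 < t2" for t t1 t2
    using out_length_mono[OF that] by simp
  show "1 * in_length t' t1 < 1 * in_length t t1" if "(t, t1) \<in> pairs" "(t', t1) \<in> pairs" "t < t'" for t t' t1
    using in_length_antimono[OF that] by simp
  show "\<exists>t1. (t, t1) \<in> pairs \<and> y = out_length t t1" if "(t, y) \<in> outer_phase" for t y
    using right_tangent_exists[of y t] that by (auto simp: outer_phase_def)
  show "outer_billiard \<gamma> P (t, out_length t t1) = (t1, in_length t t1)" if p: "(t, t1) \<in> pairs" for t t1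
    unfolding outer_billiard_def split
  proof (rule the_equality)
    show "case (t1, in_length t t1) of (ta, l1) \<Rightarrow> t < ta \<and> ta < t + P \<and> 0 < l1 \<and>
        \<gamma> t + out_length t t1 *\<^sub>R \<gamma>' t = \<gamma> ta - l1 *\<^sub>R \<gamma>' ta"
      using pairsD[OF p] tangents_meet[OF p] by simp
    fix q :: "real \<times> real"
    assume "case q of (ta, l1) \<Rightarrow> t < ta \<and> ta < t + P \<and> 0 < l1 \<and>
        \<gamma> t + out_length t t1 *\<^sub>R \<gamma>' t = \<gamma> ta - l1 *\<^sub>R \<gamma>' ta"
    then obtain ta l1 where q: "q = (ta, l1)" "t < ta" "ta < t + P" "0 < l1"
      "\<gamma> t + out_length t t1 *\<^sub>R \<gamma>' t = \<gamma> ta - l1 *\<^sub>R \<gamma>' ta" by (cases q) auto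
    have "\<gamma> ta - \<gamma> t = out_length t t1 *\<^sub>R \<gamma>' t + l1 *\<^sub>R \<gamma>' ta" using q(5) by (simp add: algebra_simps)
    then have "0 < l1 * bracket (\<gamma>' t) (\<gamma>' ta)"
      using support_within(1)[OF q(2,3)] by (simp add: bracket.add_right bracket.scaleR_right)
    then have w: "0 < bracket (\<gamma>' t) (\<gamma>' ta)" using q(4) by (simp add: zero_less_mult_iff)
    then have pa: "(t, ta) \<in> pairs" using q by (simp add: pairs_def)
    have lm: "out_length t t1 = out_length t ta" "l1 = in_length t ta"
      using cramer[of "\<gamma>' t" "\<gamma>' ta"] q(5) w by (auto simp: out_length_def in_length_def)
    have "ta = t1" using out_length_mono[OF pa p] out_length_mono[OF p pa] lm(1) by force
    then show "q = (t1, in_length t t1)" using q(1) lm(2) by simp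
  qed
  have w0: "wedge z \<noteq> 0" if "z \<in> pairs" for z using pairsD[of "fst z" "snd z"] that by (simp add: wedge_def)
  show "((\<lambda>z. out_length (fst z) (snd z)) has_derivative (\<lambda>h. out_length\<^sub>1 z * fst h + out_length\<^sub>2 z * snd h)) (at z)"
    "((\<lambda>z. in_length (fst z) (snd z)) has_derivative (\<lambda>h. in_length\<^sub>1 z * fst h + in_length\<^sub>2 z * snd h)) (at z)"
    if "z \<in> pairs" for z by (rule out_length_deriv[OF w0[OF that]], rule in_length_deriv[OF w0[OF that]])
  have cw: "continuous_on pairs wedge" unfolding wedge_def[abs_def] by (intro bracket.continuous_on cont_parts)
  have ck: "continuous_on pairs (\<lambda>z. kappa (snd z))" "continuous_on pairs (\<lambda>z. kappa (fst z))"
    unfolding kappa_def by (intro bracket.continuous_on cont_parts)+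
  show "continuous_on pairs out_length\<^sub>2" "continuous_on pairs in_length\<^sub>1"
    unfolding out_length\<^sub>2_def[abs_def] in_length\<^sub>1_def[abs_def]
    by (intro continuous_on_divide continuous_on_mult continuous_on_minus cw ck continuous_at_imp_continuous_on ballI
        has_derivative_continuous[OF in_length_deriv] has_derivative_continuous[OF out_length_deriv]; simp add: w0)+
  show "continuous_on UNIV curvature_density"
    unfolding curvature_density_def[abs_def] by (intro continuous_intros bracket.continuous_on cont_parts)
  show "0 \<le> curvature_density z" for z by (simp add: curvature_density_def)
  show "curvature_density (z + (P, 0)) = curvature_density z" for z
    by (simp add: curvature_density_def vel_periodic acc_periodic)
  show "\<exists>t\<in>{a<..<b}. \<forall>y. (t, y) \<in> outer_phase \<longrightarrow> curvature_density (t, y) \<noteq> 0" if "a < b" for a b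
    using curvature_not_flat[OF that] by (auto simp: outer_phase_def curvature_density_def kappa_def)
  show "\<bar>out_length\<^sub>2 (t, t1)\<bar> * curvature_density (t, out_length t t1) =
      \<bar>in_length\<^sub>1 (t, t1)\<bar> * curvature_density (t1, in_length t t1)" if "(t, t1) \<in> pairs" for t t1
    by (simp add: out_length\<^sub>2_def in_length\<^sub>1_def curvature_density_def kappa_def abs_mult)
qed

end

section \<open>Symmetries of the curve\<close>

context convex_curve begin

text \<open>Three collinear points of the curve contradict support at the one between the other two.\<close>

lemma not_collinear:
  assumes t: "t < q" "q < w" "w < t + P" shows "bracket (\<gamma> q - \<gamma> t) (\<gamma> w - \<gamma> t) \<noteq> 0"
proof
  assume col: "bracket (\<gamma> q - \<gamma> t) (\<gamma> w - \<gamma> t) = 0"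
  define u where "u = \<gamma> q - \<gamma> t"
  have ne: "\<gamma> t \<noteq> \<gamma> q" "\<gamma> q \<noteq> \<gamma> w" "\<gamma> t \<noteq> \<gamma> w"
    by (rule distinct_within_period; use t in simp)+
  then have "u \<noteq> 0" by (simp add: u_def)
  then obtain l where l: "\<gamma> w - \<gamma> t = l *\<^sub>R u" using bracket_zero_parallel col unfolding u_def by blast
  have s: "0 < bracket (\<gamma>' t) u" "0 < l * bracket (\<gamma>' t) u"
    using support[OF ne(1)[symmetric]] support[OF ne(3)[symmetric]] by (simp_all add: l bracket.scaleR_right u_def[symmetric])
  then have l0: "0 < l" by (simp add: zero_less_mult_iff)
  have "\<gamma> t - \<gamma> w = - l *\<^sub>R u" "\<gamma> q - \<gamma> w = (1 - l) *\<^sub>R u" using l by (auto simp: u_def algebra_simps)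
  then have w: "0 < - l * bracket (\<gamma>' w) u" "0 < (1 - l) * bracket (\<gamma>' w) u"
    using support[OF ne(3)] support[OF ne(2)] by (simp_all only: bracket.scaleR_right real_scaleR_def)
  have "\<gamma> t - \<gamma> q = - 1 *\<^sub>R u" "\<gamma> w - \<gamma> q = (l - 1) *\<^sub>R u" using l by (auto simp: u_def algebra_simps)
  then have q: "0 < - 1 * bracket (\<gamma>' q) u" "0 < (l - 1) * bracket (\<gamma>' q) u"
    using support[OF ne(1)] support[OF ne(2)[symmetric]] by (simp_all only: bracket.scaleR_right real_scaleR_def)
  have "bracket (\<gamma>' w) u < 0" using w(1) l0 by (simp add: mult_less_0_iff)
  then have "1 < l" using w(2) by (simp add: zero_less_mult_iff)
  then have "0 < bracket (\<gamma>' q) u" using q(2) by (simp add: zero_less_mult_iff)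
  then show False using q(1) by simp
qed

text \<open>The chord does not meet the curve again, and near \<open>t\<close> the curve is on the side given by its tangent.\<close>

lemma positively_oriented:
  assumes t: "t < q" "q < w" "w < t + P" shows "0 < bracket (\<gamma> q - \<gamma> t) (\<gamma> w - \<gamma> t)"
proof (rule ccontr)
  assume neg: "\<not> ?thesis"
  define h where "h s = bracket (\<gamma> s - \<gamma> t) (\<gamma> w - \<gamma> t)" for s
  have hc: "continuous_on A h" for A unfolding h_def[abs_def] by (intro continuous_intros bracket.continuous_on cont)
  have "((\<lambda>s. bracket (\<gamma> s - \<gamma> t) (\<gamma> w - \<gamma> t)) has_vector_derivative bracket (\<gamma>' t) (\<gamma> w - \<gamma> t)) (at t)"
    using bounded_linear.has_vector_derivative[OF bracket.bounded_linear_left, of "\<lambda>s. \<gamma> s - \<gamma> t" "\<gamma>' t" "at t" "\<gamma> w - \<gamma> t"]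
      vel[of t] by (auto simp: has_vector_derivative_diff_const)
  then have "(h has_real_derivative bracket (\<gamma>' t) (\<gamma> w - \<gamma> t)) (at t)"
    by (simp add: h_def[abs_def] has_real_derivative_iff_has_vector_derivative)
  moreover have "0 < bracket (\<gamma>' t) (\<gamma> w - \<gamma> t)" using support_within(1)[of t w] t by simp
  ultimately obtain d where d: "0 < d" "\<And>x. 0 < x \<Longrightarrow> x < d \<Longrightarrow> h t < h (t + x)"
    using DERIV_pos_inc_right by blast
  define s where "s = t + min (d / 2) ((q - t) / 2)"
  have s: "t < s" "s < q" using d t by (auto simp: s_def min_def field_simps)
  have "h t < h s" unfolding s_def by (rule d(2)) (use d(1) t in \<open>auto simp: min_def\<close>)
  moreover have "h t = 0" by (simp add: h_def bracket.zero_left)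
  ultimately have "0 < h s" by simp
  have "\<exists>x\<ge>s. x \<le> q \<and> h x = 0"
    using IVT2'[of h q 0 s] neg s \<open>0 < h s\<close> hc by (auto simp: h_def[of q])
  then obtain x where "s \<le> x" "x \<le> q" "h x = 0" by blast
  then show False using not_collinear[of t x w] s t by (simp add: h_def)
qed

text \<open>A linear map with positive determinant preserves the orientation of triples of points of the curve, so it
  preserves their cyclic order and has an increasing lift.\<close>

lemma symmetry_lift:
  assumes d: "0 < det B" and inv: "(\<lambda>x. B *v x) ` range \<gamma> = range \<gamma>"
  obtains \<sigma> where "strict_mono \<sigma>" "\<And>t. \<sigma> (t + P) = \<sigma> t + P" "\<And>t. \<gamma> (\<sigma> t) = B *v \<gamma> t"
proof -
  have hit: "\<exists>s. \<gamma> s = B *v \<gamma> t" for t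
  proof -
    have "B *v \<gamma> t \<in> (\<lambda>x. B *v x) ` range \<gamma>" by blast
    then show ?thesis unfolding inv by (metis rangeE)
  qed
  have Binj: "B *v \<gamma> t = B *v \<gamma> s \<longleftrightarrow> \<gamma> t = \<gamma> s" for s t
  proof
    assume "B *v \<gamma> t = B *v \<gamma> s"
    moreover have "invertible B" using d by (simp add: invertible_det_nz)
    ultimately show "\<gamma> t = \<gamma> s" using inj_matrix_vector_mult by (metis injD)
  qed simp
  obtain s0 where s0: "\<gamma> s0 = B *v \<gamma> 0" using hit by blast
  have "\<exists>s. s0 \<le> s \<and> s < s0 + P \<and> \<gamma> s = B *v \<gamma> t" for t
  proof -
    obtain s where s: "\<gamma> s = B *v \<gamma> t" using hit by blast
    let ?n = "\<lfloor>(s - s0) / P\<rfloor>"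
    have "of_int ?n * P \<le> s - s0" "s - s0 < (of_int ?n + 1) * P"
      by (rule floor_divide_lower[OF P], rule floor_divide_upper[OF P])
    then have "s0 \<le> s + of_int (- ?n) * P" "s + of_int (- ?n) * P < s0 + P" by (auto simp: algebra_simps)
    then show ?thesis using s periodic_int by metis
  qed
  then obtain \<tau> where \<tau>: "\<And>t. s0 \<le> \<tau> t" "\<And>t. \<tau> t < s0 + P" "\<And>t. \<gamma> (\<tau> t) = B *v \<gamma> t" by metis
  have tau0: "\<tau> 0 = s0"
    using \<tau>[of 0] s0 distinct_within_period[of s0 "\<tau> 0"] by fastforce
  have tau_mono: "\<tau> p < \<tau> q" if pq: "0 \<le> p" "p < q" "q < P" for p q
  proof -
    have ne: "\<tau> p \<noteq> \<tau> q"
      using \<tau>(3)[of p] \<tau>(3)[of q] Binj distinct_within_period[of p q] pq by fastforce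
    show ?thesis
    proof (cases "p = 0")
      case True then show ?thesis using tau0 ne \<tau>(1)[of q] by simp
    next
      case False
      show ?thesis
      proof (rule ccontr)
        assume "\<not> \<tau> p < \<tau> q"
        then have qp: "\<tau> q < \<tau> p" using ne by simp
        have "\<tau> q \<noteq> s0"
          using \<tau>(3)[of q] s0 Binj[of q 0] distinct_within_period[of 0 q] pq by fastforce
        then have "s0 < \<tau> q" using \<tau>(1)[of q] by simp
        then have "0 < bracket (\<gamma> (\<tau> q) - \<gamma> s0) (\<gamma> (\<tau> p) - \<gamma> s0)"
          by (rule positively_oriented[OF _ qp \<tau>(2)])
        also have "\<dots> = det B * bracket (\<gamma> q - \<gamma> 0) (\<gamma> p - \<gamma> 0)"
          by (simp add: \<tau>(3) s0 bracket_matrix matrix_vector_mult_diff_distrib[symmetric])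
        finally have "0 < bracket (\<gamma> q - \<gamma> 0) (\<gamma> p - \<gamma> 0)" using d by (simp add: zero_less_mult_iff)
        moreover have "0 < bracket (\<gamma> p - \<gamma> 0) (\<gamma> q - \<gamma> 0)"
          by (rule positively_oriented) (use pq False in auto)
        ultimately show False using bracket_swap[of "\<gamma> p - \<gamma> 0" "\<gamma> q - \<gamma> 0"] by simp
      qed
    qed
  qed
  define red where "red t = t - of_int \<lfloor>t / P\<rfloor> * P" for t
  define \<sigma> where "\<sigma> t = \<tau> (red t) + of_int \<lfloor>t / P\<rfloor> * P" for t
  have red: "0 \<le> red t" "red t < P" for t
    using floor_divide_lower[OF P, of t] floor_divide_upper[OF P, of t] by (auto simp: red_def algebra_simps)
  have "strict_mono \<sigma>"
  proof (rule strict_monoI)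
    fix t t' :: real assume tt: "t < t'"
    have le: "\<lfloor>t / P\<rfloor> \<le> \<lfloor>t' / P\<rfloor>" using tt P by (intro floor_mono divide_right_mono) auto
    show "\<sigma> t < \<sigma> t'"
    proof (cases "\<lfloor>t / P\<rfloor> = \<lfloor>t' / P\<rfloor>")
      case True
      then have "red t < red t'" using tt by (simp add: red_def)
      then show ?thesis using tau_mono[OF red(1) _ red(2)] True by (simp add: \<sigma>_def)
    next
      case False
      then have "of_int \<lfloor>t / P\<rfloor> + 1 \<le> (of_int \<lfloor>t' / P\<rfloor> :: real)" using le by linarith
      then have "(of_int \<lfloor>t / P\<rfloor> + 1) * P \<le> of_int \<lfloor>t' / P\<rfloor> * P" using P by (intro mult_right_mono) auto
      then show ?thesis using \<tau>(2)[of "red t"] \<tau>(1)[of "red t'"] by (simp add: \<sigma>_def algebra_simps)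
    qed
  qed
  moreover have "\<sigma> (t + P) = \<sigma> t + P" for t
  proof -
    have "\<lfloor>(t + P) / P\<rfloor> = \<lfloor>t / P\<rfloor> + 1" using P by (simp add: add_divide_distrib)
    then show ?thesis by (simp add: \<sigma>_def red_def algebra_simps)
  qed
  moreover have "\<gamma> (\<sigma> t) = B *v \<gamma> t" for t
    using \<tau>(3)[of "red t"] periodic_int[of "red t" "\<lfloor>t / P\<rfloor>"] periodic_int[of "\<tau> (red t)" "\<lfloor>t / P\<rfloor>"]
    by (simp add: \<sigma>_def red_def)
  ultimately show ?thesis by (rule that)
qed

text \<open>The lift differs from the identity by an integral number of periods; by monotonicity the number does
  not depend on the point.\<close>

lemma lift_of_identity:
  assumes h: "strict_mono h" "\<And>t. h (t + P) = h t + P" "\<And>t. \<gamma> (h t) = \<gamma> t"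
  obtains m :: int where "\<And>t. h t = t + of_int m * P"
proof -
  have ex: "\<exists>n::int. h t = t + of_int n * P" for t using h(3) same_point_iff by blast
  obtain m :: int where m: "h 0 = of_int m * P" using ex[of 0] by auto
  have base: "h t = t + of_int m * P" if t: "0 \<le> t" "t < P" for t
  proof -
    obtain n :: int where n: "h t = t + of_int n * P" using ex by blast
    have "h 0 \<le> h t" using h(1) t by (simp add: strict_mono_less_eq)
    then have "- (1 * P) < of_int (n - m) * P" using n m t by (simp add: algebra_simps)
    then have "-1 < (of_int (n - m) :: real)" using P by (metis mult_less_cancel_right_pos mult_minus_left)
    moreover have "h t < h 0 + P" using h(1) t h(2)[of 0] by (metis add_0 strict_mono_less)
    then have "of_int (n - m) * P < 1 * P" using n m t by (simp add: algebra_simps)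
    then have "(of_int (n - m) :: real) < 1" using P by (metis mult_less_cancel_right_pos)
    ultimately have "n = m" by linarith
    then show ?thesis using n by simp
  qed
  have "h t = t + of_int m * P" for t
  proof -
    let ?r = "t - of_int \<lfloor>t / P\<rfloor> * P"
    have "0 \<le> ?r" "?r < P"
      using floor_divide_lower[OF P, of t] floor_divide_upper[OF P, of t] by (auto simp: algebra_simps)
    from base[OF this] show ?thesis using shift_commute[of h P ?r "\<lfloor>t / P\<rfloor>", OF h(2)] by simp
  qed
  then show ?thesis by (rule that)
qed

lemma fixes_curve_identity:
  assumes "\<And>t. B *v \<gamma> t = \<gamma> t" shows "B = mat 1"
proof -
  define u where "u = \<gamma> (P/3) - \<gamma> 0"
  define w where "w = \<gamma> (P/2) - \<gamma> 0"
  have b: "bracket u w \<noteq> 0" using positively_oriented[of 0 "P/3" "P/2"] P by (simp add: u_def w_def)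
  have fixed: "B *v u = u" "B *v w = w" using assms by (simp_all add: u_def w_def matrix_vector_mult_diff_distrib)
  have "B *v x = x" for x
  proof -
    have "bracket u w *\<^sub>R x = bracket x w *\<^sub>R u + bracket u x *\<^sub>R w"
      by (simp add: vec_eq_iff forall_2 bracket_eq algebra_simps)
    then have "B *v (bracket u w *\<^sub>R x) = bracket u w *\<^sub>R x"
      by (simp add: matrix_vector_right_distrib matrix_vector_mult_scaleR fixed)
    then show ?thesis using b by (simp add: matrix_vector_mult_scaleR)
  qed
  then show ?thesis by (simp add: matrix_eq)
qed

lemma power_image: "(\<lambda>x. A *v x) ` range \<gamma> = range \<gamma> \<Longrightarrow> (\<lambda>x. matrix_pow A n *v x) ` range \<gamma> = range \<gamma>"
proof (induction n)
  case (Suc n)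
  have "(\<lambda>x. matrix_pow A (Suc n) *v x) ` range \<gamma> = (\<lambda>x. A *v x) ` (\<lambda>x. matrix_pow A n *v x) ` range \<gamma>"
    by (simp add: matrix_pow_mult image_image)
  then show ?case using Suc by simp
qed (simp add: matrix_pow_mult)

text \<open>Let \<open>s\<close> be a lift of \<open>A\<close> whose \<open>k\<close>-th iterate makes \<open>m\<close> turns. A common divisor \<open>d\<close> of \<open>m\<close> and \<open>k\<close> would make
  the \<open>(k / d)\<close>-th iterate a translation by \<open>m / d\<close> periods, and \<open>A\<close> would have order less than \<open>k\<close>. So some power
  of \<open>s\<close>, corrected by full turns, has rotation number \<open>r / k\<close>.\<close>

lemma symmetry_with_rotation_number:
  fixes k :: nat and r :: int
  assumes k: "3 \<le> k" and ord: "has_matrix_order A k" and inv: "(\<lambda>x. A *v x) ` range \<gamma> = range \<gamma>"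
    and cop: "coprime r (int k)"
  obtains B \<sigma> where "det B = 1" "matrix_pow B k = mat 1" "(\<lambda>x. B *v x) ` range \<gamma> = range \<gamma>"
    "strict_mono \<sigma>" "\<And>t. \<sigma> (t + P) = \<sigma> t + P" "\<And>t. \<gamma> (\<sigma> t) = B *v \<gamma> t"
    "\<And>t. (\<sigma> ^^ k) t = t + of_int r * P"
proof -
  have detA: "det A = 1" by (rule finite_order_det_one[OF ord k])
  have Ak: "matrix_pow A k = mat 1" using ord by (simp add: has_matrix_order_def)
  obtain s where s: "strict_mono s" "\<And>t. s (t + P) = s t + P" "\<And>t. \<gamma> (s t) = A *v \<gamma> t"
    using symmetry_lift[OF _ inv] detA by auto
  have spow: "\<gamma> ((s ^^ n) t) = matrix_pow A n *v \<gamma> t" for n t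
    by (induction n) (auto simp: matrix_pow_mult s(3))
  obtain m :: int where m: "\<And>t. (s ^^ k) t = t + of_int m * P"
    using lift_of_identity[of "s ^^ k"] strict_mono_funpow[OF s(1)] funpow_shift[of s P, OF s(2)] spow Ak by auto
  have "coprime m (int k)"
  proof (rule ccontr)
    assume nc: "\<not> coprime m (int k)"
    define d where "d = nat (gcd m (int k))"
    have g0: "0 < gcd m (int k)" using k by simp
    have dg: "int d = gcd m (int k)" using g0 by (simp add: d_def)
    have "gcd m (int k) \<noteq> 1" using nc by (simp add: coprime_iff_gcd_eq_1)
    then have d1: "1 < d" using g0 dg by linarith
    obtain n where n: "m = int d * n" using dg by (metis dvd_def gcd_dvd1)
    obtain e where e: "k = d * e" using dg by (metis dvd_def gcd_dvd2 int_dvd_int_iff)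
    have e0: "0 < e" "e < k" using e k d1 by (auto intro: Nat.gr0I)
    define h where "h t = (s ^^ e) t - of_int n * P" for t
    have hm: "strict_mono h" using strict_mono_funpow[OF s(1), of e] by (simp add: h_def strict_mono_def)
    have hp: "(h ^^ i) t = (s ^^ (i * e)) t - of_nat i * of_int n * P" for i t
    proof (induction i)
      case (Suc i)
      have "(s ^^ e) ((s ^^ (i * e)) t - of_nat i * of_int n * P) = (s ^^ e) ((s ^^ (i * e)) t) - of_nat i * of_int n * P"
        using shift_commute[of "s ^^ e" P "(s ^^ (i * e)) t" "- (int i * n)"] funpow_shift[of s P, OF s(2)] by simp
      moreover have "(h ^^ Suc i) t = (s ^^ e) ((s ^^ (i * e)) t - of_nat i * of_int n * P) - of_int n * P"
        unfolding funpow.simps o_apply Suc by (simp only: h_def)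
      ultimately show ?case by (simp add: funpow_add algebra_simps)
    qed simp
    have "h t = t" for t
    proof (rule strict_mono_finite_order[OF hm])
      show "0 < d" using d1 by simp
      have "(h ^^ d) t = (s ^^ k) t - of_int m * P" by (simp add: hp e n)
      then show "(h ^^ d) t = t" by (simp add: m)
    qed
    then have "(s ^^ e) t = t + of_int n * P" for t by (simp add: h_def algebra_simps)
    then have "matrix_pow A e *v \<gamma> t = \<gamma> t" for t using spow[of e t] periodic_int by simp
    then have "matrix_pow A e = mat 1" by (rule fixes_curve_identity)
    then show False using ord e0 by (auto simp: has_matrix_order_def)
  qed
  then obtain x y where xy: "x * m + y * int k = 1"
    using bezout_int[of m "int k"] by auto
  define j where "j = nat ((r * x) mod int k)"
  define q where "q = (r * x) div int k"
  have "0 \<le> (r * x) mod int k" using k by simp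
  then have "int j = (r * x) mod int k" by (simp only: j_def int_nat_eq if_True)
  then have j: "int j = r * x - int k * q" by (simp add: q_def minus_mult_div_eq_mod)
  define l where "l = - (r * y + q * m)"
  have "r = r * (x * m + y * int k)" by (simp add: xy)
  then have jl: "int j * m - l * int k = r" by (simp add: j l_def algebra_simps)
  define B where "B = matrix_pow A j"
  define \<sigma> where "\<sigma> t = (s ^^ j) t - of_int l * P" for t
  show ?thesis
  proof (rule that[of B \<sigma>])
    show "det B = 1" by (simp add: B_def det_matrix_pow detA)
    show "(\<lambda>x. B *v x) ` range \<gamma> = range \<gamma>" unfolding B_def by (rule power_image[OF inv])
    have "matrix_pow B i *v x = (((*v) A) ^^ (i * j)) x" for i x
      by (induction i) (auto simp: matrix_pow_mult B_def funpow_add)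
    moreover have "(((*v) A) ^^ (i * k)) x = x" for i x
      using Ak matrix_pow_mult[of A k] by (induction i) (auto simp: funpow_add)
    ultimately have "matrix_pow B k *v x = mat 1 *v x" for x by (simp add: mult.commute)
    then show "matrix_pow B k = mat 1" by (simp add: matrix_eq)
    show "strict_mono \<sigma>" using strict_mono_funpow[OF s(1), of j] by (simp add: \<sigma>_def strict_mono_def)
    show "\<sigma> (t + P) = \<sigma> t + P" for t using funpow_shift[of s P, OF s(2)] by (simp add: \<sigma>_def)
    show "\<gamma> (\<sigma> t) = B *v \<gamma> t" for t
      using periodic_int[of "(s ^^ j) t" "-l"] by (simp add: \<sigma>_def spow B_def)
    have sp: "(\<sigma> ^^ i) t = (s ^^ (i * j)) t - of_nat i * of_int l * P" for i t
    proof (induction i)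
      case (Suc i)
      have "(s ^^ j) ((s ^^ (i * j)) t - of_nat i * of_int l * P) = (s ^^ j) ((s ^^ (i * j)) t) - of_nat i * of_int l * P"
        using shift_commute[of "s ^^ j" P "(s ^^ (i * j)) t" "- (int i * l)"] funpow_shift[of s P, OF s(2)] by simp
      moreover have "(\<sigma> ^^ Suc i) t = (s ^^ j) ((s ^^ (i * j)) t - of_nat i * of_int l * P) - of_int l * P"
        unfolding funpow.simps o_apply Suc by (simp only: \<sigma>_def)
      ultimately show ?case by (simp add: funpow_add algebra_simps)
    qed simp
    have sk: "(s ^^ (i * k)) t = t + of_nat i * of_int m * P" for i t
      by (induction i) (auto simp: funpow_add m algebra_simps)
    show "(\<sigma> ^^ k) t = t + of_int r * P" for t
    proof -
      have "(\<sigma> ^^ k) t = t + of_int (int j * m - l * int k) * P"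
        using sp[of k t] sk[of j t] by (simp add: mult.commute[of k j] algebra_simps)
      then show ?thesis by (simp add: jl)
    qed
  qed
qed

context
  fixes B :: "real^2^2" and \<sigma> :: "real \<Rightarrow> real"
  assumes B: "det B = 1" "(\<lambda>x. B *v x) ` range \<gamma> = range \<gamma>"
    and s: "strict_mono \<sigma>" "\<And>t. \<sigma> (t + P) = \<sigma> t + P" "\<And>t. \<gamma> (\<sigma> t) = B *v \<gamma> t"
begin

text \<open>The map \<open>B\<close> takes the supporting line at \<open>t\<close> to a supporting line at \<open>\<sigma> t\<close>, and the tangent is the only
  one. This avoids differentiating \<open>\<sigma>\<close>.\<close>

lemma tangent_image: "\<exists>c>0. \<gamma>' (\<sigma> t) = c *\<^sub>R (B *v \<gamma>' t)"
proof -
  let ?w = "B *v \<gamma>' t" and ?s = "\<sigma> t"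
  have side: "0 < bracket ?w (\<gamma> x - \<gamma> ?s)" if "\<gamma> x \<noteq> \<gamma> ?s" for x
  proof -
    obtain y where y: "\<gamma> x = B *v \<gamma> y" using B(2) by (metis (no_types, lifting) imageE rangeI)
    then have "\<gamma> y \<noteq> \<gamma> t" using that s(3) by auto
    then have "0 < bracket (\<gamma>' t) (\<gamma> y - \<gamma> t)" by (rule support)
    also have "\<dots> = bracket ?w (B *v (\<gamma> y - \<gamma> t))" by (simp add: bracket_matrix B(1))
    also have "\<dots> = bracket ?w (\<gamma> x - \<gamma> ?s)" by (simp add: y s(3) matrix_vector_mult_diff_distrib)
    finally show ?thesis .
  qed
  have nn: "0 \<le> bracket ?w (\<gamma> x - \<gamma> ?s)" for x using side[of x] by (cases "\<gamma> x = \<gamma> ?s") (auto simp: bracket.zero_right)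
  have "((\<lambda>x. bracket ?w (\<gamma> x - \<gamma> ?s)) has_vector_derivative bracket ?w (\<gamma>' ?s)) (at ?s)"
    using bounded_linear.has_vector_derivative[OF bracket.bounded_linear_right, of "\<lambda>x. \<gamma> x - \<gamma> ?s" "\<gamma>' ?s" "at ?s" ?w]
      vel[of ?s] by (auto simp: has_vector_derivative_diff_const)
  then have "((\<lambda>x. bracket ?w (\<gamma> x - \<gamma> ?s)) has_real_derivative bracket ?w (\<gamma>' ?s)) (at ?s)"
    by (simp add: has_real_derivative_iff_has_vector_derivative)
  then have z: "bracket ?w (\<gamma>' ?s) = 0"
    by (rule DERIV_local_min[of _ _ _ 1]) (use nn in \<open>auto simp: bracket.zero_right\<close>)
  have "?w \<noteq> 0"
  proof
    assume "?w = 0"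
    then have "bracket ?w (\<gamma> (\<sigma> t + P/2) - \<gamma> ?s) = 0" by (simp add: bracket.zero_left)
    moreover have "\<gamma> (\<sigma> t + P/2) \<noteq> \<gamma> ?s" using distinct_within_period[of ?s "?s + P/2"] P by simp
    ultimately show False using side by force
  qed
  then obtain c where c: "\<gamma>' ?s = c *\<^sub>R ?w" using bracket_zero_parallel[OF z] by blast
  have ne: "\<gamma> (\<sigma> t + P/2) \<noteq> \<gamma> ?s" using distinct_within_period[of ?s "?s + P/2"] P by simp
  have "0 < c * bracket ?w (\<gamma> (\<sigma> t + P/2) - \<gamma> ?s)" using support[OF ne] by (simp add: c bracket.scaleR_left)
  then have "0 < c" using side[OF ne] by (simp add: zero_less_mult_iff)
  then show ?thesis using c by blast
qed

lemma pairs_image: assumes "(t, t1) \<in> pairs" shows "(\<sigma> t, \<sigma> t1) \<in> pairs"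
proof -
  obtain c c1 where c: "0 < c" "\<gamma>' (\<sigma> t) = c *\<^sub>R (B *v \<gamma>' t)" "0 < c1" "\<gamma>' (\<sigma> t1) = c1 *\<^sub>R (B *v \<gamma>' t1)"
    using tangent_image by metis
  have "\<sigma> t < \<sigma> t1" "\<sigma> t1 < \<sigma> (t + P)" using pairsD[OF assms] s(1) by (auto simp: strict_mono_less)
  then show ?thesis using pairsD[OF assms] c
    by (simp add: pairs_def s(2) bracket.scaleR_left bracket.scaleR_right bracket_matrix B(1))
qed

lemma symplectic_orbit_image:
  assumes "twist_billiard.orbit pairs (\<lambda>t t1. - bracket (\<gamma>' t) (\<gamma> t1)) (\<lambda>t t1. bracket (\<gamma> t) (\<gamma>' t1)) a"
  shows "twist_billiard.orbit pairs (\<lambda>t t1. - bracket (\<gamma>' t) (\<gamma> t1)) (\<lambda>t t1. bracket (\<gamma> t) (\<gamma>' t1)) (\<lambda>i. \<sigma> (a i))"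
  unfolding twist_billiard.orbit_def[OF symplectic_twist]
proof (intro allI conjI)
  fix i
  have a: "(a i, a (Suc i)) \<in> pairs" "bracket (\<gamma> (a i)) (\<gamma>' (a (Suc i))) = - bracket (\<gamma>' (a (Suc i))) (\<gamma> (a (Suc (Suc i))))"
    using assms unfolding twist_billiard.orbit_def[OF symplectic_twist] by auto
  show "(\<sigma> (a i), \<sigma> (a (Suc i))) \<in> pairs" by (rule pairs_image[OF a(1)])
  obtain c where c: "\<gamma>' (\<sigma> (a (Suc i))) = c *\<^sub>R (B *v \<gamma>' (a (Suc i)))" using tangent_image by metis
  show "bracket (\<gamma> (\<sigma> (a i))) (\<gamma>' (\<sigma> (a (Suc i)))) = - bracket (\<gamma>' (\<sigma> (a (Suc i)))) (\<gamma> (\<sigma> (a (Suc (Suc i)))))"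
    using a(2) by (simp add: c s(3) bracket.scaleR_left bracket.scaleR_right bracket_matrix B(1))
qed

lemma lengths_image:
  assumes "\<gamma>' (\<sigma> t) = c *\<^sub>R (B *v \<gamma>' t)" "0 < c" "\<gamma>' (\<sigma> t1) = c1 *\<^sub>R (B *v \<gamma>' t1)" "0 < c1"
  shows "out_length (\<sigma> t) (\<sigma> t1) = out_length t t1 / c" "in_length (\<sigma> t) (\<sigma> t1) = in_length t t1 / c1"
  using assms(2,4) by (simp_all add: out_length_def in_length_def assms(1,3) s(3) bracket.scaleR_left bracket.scaleR_right
      bracket_matrix B(1) matrix_vector_mult_diff_distrib[symmetric])

lemma outer_orbit_image:
  assumes "twist_billiard.orbit pairs out_length in_length a"
  shows "twist_billiard.orbit pairs out_length in_length (\<lambda>i. \<sigma> (a i))"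
  unfolding twist_billiard.orbit_def[OF outer_twist]
proof (intro allI conjI)
  fix i
  have a: "(a i, a (Suc i)) \<in> pairs" "in_length (a i) (a (Suc i)) = out_length (a (Suc i)) (a (Suc (Suc i)))"
    using assms unfolding twist_billiard.orbit_def[OF outer_twist] by auto
  show "(\<sigma> (a i), \<sigma> (a (Suc i))) \<in> pairs" by (rule pairs_image[OF a(1)])
  obtain c where c: "\<And>t. 0 < c t" "\<And>t. \<gamma>' (\<sigma> t) = c t *\<^sub>R (B *v \<gamma>' t)" using tangent_image by metis
  show "in_length (\<sigma> (a i)) (\<sigma> (a (Suc i))) = out_length (\<sigma> (a (Suc i))) (\<sigma> (a (Suc (Suc i))))"
    using a(2) lengths_image[OF c(2) c(1) c(2) c(1)] by simp
qed

lemma symplectic_conserved: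
  assumes "twist_billiard.orbit pairs (\<lambda>t t1. - bracket (\<gamma>' t) (\<gamma> t1)) (\<lambda>t t1. bracket (\<gamma> t) (\<gamma>' t1)) (\<lambda>i. (\<sigma> ^^ i) t)"
  shows "bracket (\<gamma> t) (B *v \<gamma>' t) + bracket (\<gamma>' t) (B *v \<gamma> t) = 0"
proof -
  have e: "bracket (\<gamma> t) (\<gamma>' (\<sigma> t)) = - bracket (\<gamma>' (\<sigma> t)) (\<gamma> (\<sigma> (\<sigma> t)))"
    using assms unfolding twist_billiard.orbit_def[OF symplectic_twist] by (auto dest: spec[of _ 0])
  obtain c where c: "0 < c" "\<gamma>' (\<sigma> t) = c *\<^sub>R (B *v \<gamma>' t)" using tangent_image by metis
  have "c * bracket (\<gamma> t) (B *v \<gamma>' t) = - (c * bracket (\<gamma>' t) (B *v \<gamma> t))"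
    using e by (simp add: c s(3) bracket.scaleR_left bracket.scaleR_right bracket_matrix B(1))
  then have "c * (bracket (\<gamma> t) (B *v \<gamma>' t) + bracket (\<gamma>' t) (B *v \<gamma> t)) = 0" by (simp add: algebra_simps)
  then show ?thesis using c(1) by simp
qed

text \<open>By the symmetry, the tangent segments at \<open>\<gamma> t\<close> and \<open>B \<gamma> t\<close> are related by
  \<open>\<gamma> + l \<gamma>' = B \<gamma> - l B \<gamma>'\<close>. Thus \<open>B \<gamma> - \<gamma>\<close> is parallel to \<open>\<gamma>' + B \<gamma>'\<close>, and expanding the bracket of
  the two with \<open>det B = 1\<close> gives the claim.\<close>

lemma outer_conserved:
  assumes "twist_billiard.orbit pairs out_length in_length (\<lambda>i. (\<sigma> ^^ i) t)"
  shows "bracket (\<gamma> t) (B *v \<gamma>' t) + bracket (\<gamma>' t) (B *v \<gamma> t) = 0"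
proof -
  have p: "(t, \<sigma> t) \<in> pairs" and e: "in_length t (\<sigma> t) = out_length (\<sigma> t) (\<sigma> (\<sigma> t))"
    using assms unfolding twist_billiard.orbit_def[OF outer_twist] by (auto dest: spec[of _ 0])
  obtain c where c: "\<And>t. 0 < c t" "\<And>t. \<gamma>' (\<sigma> t) = c t *\<^sub>R (B *v \<gamma>' t)" using tangent_image by metis
  define l where "l = out_length t (\<sigma> t)"
  have l0: "0 < l" using tangents_meet(2)[OF p] by (simp add: l_def)
  have il: "in_length t (\<sigma> t) = l / c t" using e lengths_image(1)[OF c(2) c(1) c(2) c(1)] by (simp add: l_def)
  have "\<gamma> t + l *\<^sub>R \<gamma>' t = B *v \<gamma> t - l *\<^sub>R (B *v \<gamma>' t)"
    using tangents_meet(1)[OF p] c(1)[of t] by (simp add: il s(3) c(2) l_def[symmetric])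
  then have "B *v \<gamma> t - \<gamma> t = l *\<^sub>R (\<gamma>' t + B *v \<gamma>' t)" by (simp add: algebra_simps)
  then have "bracket (\<gamma>' t + B *v \<gamma>' t) (B *v \<gamma> t - \<gamma> t) = 0" by (simp add: bracket.scaleR_right)
  moreover have "bracket (B *v \<gamma>' t) (B *v \<gamma> t) = bracket (\<gamma>' t) (\<gamma> t)" by (simp add: bracket_matrix B(1))
  moreover have "bracket (B *v \<gamma>' t) (\<gamma> t) = - bracket (\<gamma> t) (B *v \<gamma>' t)" by (rule bracket_swap)
  ultimately show ?thesis by (simp add: bracket.add_left bracket.diff_right)
qed

lemma ellipse_if_conserved:
  assumes ev: "\<And>v l. v \<noteq> 0 \<Longrightarrow> B *v v \<noteq> l *\<^sub>R v"
    and cons: "\<And>t. bracket (\<gamma> t) (B *v \<gamma>' t) + bracket (\<gamma>' t) (B *v \<gamma> t) = 0"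
  shows "is_ellipse (range \<gamma>)"
proof -
  define Q where "Q x = bracket x (B *v x)" for x
  have Bd: "((\<lambda>t. B *v \<gamma> t) has_vector_derivative B *v \<gamma>' t) (at t)" for t
    by (rule bounded_linear.has_vector_derivative[OF matrix_vector_mul_bounded_linear vel])
  have "((\<lambda>t. Q (\<gamma> t)) has_vector_derivative 0) (at t)" for t
    unfolding Q_def using bracket.has_vector_derivative[OF vel Bd, of t] cons[of t] by simp
  then have "\<forall>t. ((\<lambda>t. Q (\<gamma> t)) has_real_derivative 0) (at t)" by (simp add: has_real_derivative_iff_has_vector_derivative)
  then have "Q (\<gamma> t) = Q (\<gamma> 0)" for t using DERIV_isconst_all[of "\<lambda>t. Q (\<gamma> t)" t 0] by blast
  then obtain C where C: "\<And>t. Q (\<gamma> t) = C" by blast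
  have Qnz: "Q x \<noteq> 0" if x: "x \<noteq> 0" for x
  proof
    assume "Q x = 0"
    then obtain l where "B *v x = l *\<^sub>R x" unfolding Q_def using bracket_zero_parallel[OF _ x] by blast
    then show False using ev x by blast
  qed
  have "\<gamma> 0 \<noteq> \<gamma> (P/2)" by (rule distinct_within_period) (use P in auto)
  then obtain t0 where t0: "\<gamma> t0 \<noteq> 0" by metis
  then have C0: "C \<noteq> 0" using Qnz[of "\<gamma> t0"] C by simp
  have Qexp: "Q x = B$2$1 * (x$1 * x$1) + (B$2$2 - B$1$1) * (x$1 * x$2) - B$1$2 * (x$2 * x$2)" for x
    by (simp add: Q_def bracket_eq matrix_vector_mult_def sum_2 algebra_simps)
  have Qpos: "0 < Q x / C" if x: "x \<noteq> 0" for x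
  proof (rule ccontr)
    assume "\<not> 0 < Q x / C"
    then have le: "Q x / C \<le> 0" by simp
    have "continuous_on (- {0}) (\<lambda>x. Q x / C)" unfolding Qexp by (intro continuous_intros ballI C0)
    moreover have "connected (- {0 :: real^2})" by (rule connected_punctured_universe) simp
    ultimately have con: "connected ((\<lambda>x. Q x / C) ` (- {0}))" by (rule connected_continuous_image)
    have "Q (\<gamma> t0) / C = 1" using C C0 by simp
    then have "1 \<in> (\<lambda>x. Q x / C) ` (- {0})" using t0 by (metis ComplI imageI singletonD)
    then have "0 \<in> (\<lambda>x. Q x / C) ` (- {0})"
      using connectedD_interval[OF con, of "Q x / C" 1 0] x le by auto
    then obtain y where "y \<in> - {0}" "0 = Q y / C" by (rule imageE)
    then show False using Qnz[of y] C0 by auto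
  qed
  obtain K where K: "compact K" "interior K \<noteq> {}" "strictly_convex K" "frontier K = range \<gamma>"
    using curve unfolding strictly_convex_C2_curve_def by blast
  have "convex K" unfolding convex_contains_open_segment
  proof (intro ballI)
    fix a b assume "a \<in> K" "b \<in> K"
    then show "open_segment a b \<subseteq> K"
      using K(3) interior_subset[of K] unfolding strictly_convex_def by (cases "a = b") auto
  qed
  have form: "B$2$1 / C * (x$1 * x$1) + 2 * ((B$2$2 - B$1$1) / (2 * C)) * (x$1 * x$2) + (- B$1$2 / C) * (x$2 * x$2) = Q x / C" for x
    using C0 by (simp add: Qexp field_simps)
  have "is_ellipse (frontier K)"
  proof (rule ellipse_of_definite_form[OF _ K(1) \<open>convex K\<close> K(2)])
    show "0 < B$2$1 / C * (x$1 * x$1) + 2 * ((B$2$2 - B$1$1) / (2 * C)) * (x$1 * x$2) + (- B$1$2 / C) * (x$2 * x$2)"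
      if "x \<noteq> 0" for x :: "real^2" using Qpos[OF that] unfolding form .
    show "B$2$1 / C * (x$1 * x$1) + 2 * ((B$2$2 - B$1$1) / (2 * C)) * (x$1 * x$2) + (- B$1$2 / C) * (x$2 * x$2) = 1"
      if "x \<in> frontier K" for x
    proof -
      obtain t where "x = \<gamma> t" using \<open>x \<in> frontier K\<close> K(4) by auto
      then show ?thesis unfolding form using C C0 by simp
    qed
  qed
  then show ?thesis by (simp add: K(4))
qed

text \<open>An eigenvector would make \<open>B\<close> an involution. Then \<open>\<sigma> \<circ> \<sigma>\<close> would be a translation by \<open>n\<close> periods, so
  \<open>k n = 2 r\<close> and \<open>k\<close> would divide \<open>2\<close>.\<close>

lemma no_eigenvector:
  fixes k :: nat and r :: int
  assumes k: "3 \<le> k" and Bk: "matrix_pow B k = mat 1" and sk: "\<And>t. (\<sigma> ^^ k) t = t + of_int r * P"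
    and cop: "coprime r (int k)" and v: "v \<noteq> 0"
  shows "B *v v \<noteq> l *\<^sub>R v"
proof
  assume eigen: "B *v v = l *\<^sub>R v"
  have invol: "B *v (B *v x) = x" for x
    using finite_order_eigenvector_involution[OF Bk _ v eigen] k by simp
  have "\<gamma> ((\<sigma> ^^ 2) t) = \<gamma> t" for t by (simp add: numeral_2_eq_2 s(3) invol)
  then obtain n :: int where n: "\<And>t. (\<sigma> ^^ 2) t = t + of_int n * P"
    using lift_of_identity[of "\<sigma> ^^ 2"] strict_mono_funpow[OF s(1)] funpow_shift[of \<sigma> P, OF s(2)] by auto
  have pn: "(\<sigma> ^^ (2 * i)) 0 = of_nat i * of_int n * P" for i
  proof (induction i)
    case (Suc i)
    have "(\<sigma> ^^ (2 * Suc i)) 0 = (\<sigma> ^^ 2) ((\<sigma> ^^ (2 * i)) 0)" by (simp add: numeral_2_eq_2)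
    then show ?case using Suc by (simp add: n algebra_simps)
  qed simp
  have "(\<sigma> ^^ (2 * k)) 0 = (\<sigma> ^^ k) ((\<sigma> ^^ k) 0)" by (simp add: mult_2 funpow_add)
  then have "of_nat k * of_int n * P = 2 * of_int r * P" using pn[of k] by (simp add: sk)
  then have "of_int (int k * n) = (of_int (2 * r) :: real)" using P by simp
  then have "int k * n = 2 * r" by (simp only: of_int_eq_iff)
  then have "int k dvd 2 * r" by (metis dvd_triv_left)
  then have "int k dvd 2" using cop by (metis coprime_commute coprime_dvd_mult_left_iff)
  then have "int k \<le> 2" by (rule zdvd_imp_le) simp
  then show False using k by simp
qed

end
end

theorem corollary3:
  fixes k :: nat and r :: int and \<gamma> :: "real \<Rightarrow> real^2" and P :: real
    and A :: "real^2^2" and M C U :: "(real \<times> real) set"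
    and T :: "real \<times> real \<Rightarrow> real \<times> real"
  assumes "k \<ge> 3"
    and "strictly_convex_C2_curve \<gamma> P"
    and "invertible A" and "has_matrix_order A k"
    and "(\<lambda>x. A *v x) ` range \<gamma> = range \<gamma>"
    and "M = outer_phase \<and> T = outer_billiard \<gamma> P \<or>
         M = symplectic_phase \<gamma> P \<and> T = symplectic_billiard \<gamma> P"
    and "rotational_invariant_curve P M T C"
    and "has_rotation_number P T C (of_int r / of_nat k)"
    and "coprime r (int k)"
    and "C \<subseteq> U"
    and "totally_integrable P M T U"
  shows "is_ellipse (range \<gamma>)"
proof -
  interpret convex_curve \<gamma> P by unfold_locales (rule assms(2))
  have k0: "0 < k" using assms(1) by simp
  obtain B \<sigma> where B: "det B = 1" "matrix_pow B k = mat 1" "(\<lambda>x. B *v x) ` range \<gamma> = range \<gamma>"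
    and s: "strict_mono \<sigma>" "\<And>t. \<sigma> (t + P) = \<sigma> t + P" "\<And>t. \<gamma> (\<sigma> t) = B *v \<gamma> t"
    "\<And>t. (\<sigma> ^^ k) t = t + of_int r * P"
    using symmetry_with_rotation_number[OF assms(1,4,5,9)] by blast
  note sym = B(1,3) s(1,2,3)
  have "bracket (\<gamma> t) (B *v velocity \<gamma> t) + bracket (velocity \<gamma> t) (B *v \<gamma> t) = 0" for t
    using assms(6)
  proof
    assume M: "M = outer_phase \<and> T = outer_billiard \<gamma> P"
    show ?thesis
      by (rule outer_conserved[OF sym], rule twist_billiard.symmetry_orbits[OF outer_twist k0])
         (use M assms(7,8,10,11) s outer_orbit_image[OF sym] in auto)
  next
    assume M: "M = symplectic_phase \<gamma> P \<and> T = symplectic_billiard \<gamma> P"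
    show ?thesis
      by (rule symplectic_conserved[OF sym], rule twist_billiard.symmetry_orbits[OF symplectic_twist k0])
         (use M assms(7,8,10,11) s symplectic_orbit_image[OF sym] in auto)
  qed
  then show ?thesis
    using ellipse_if_conserved[OF sym] no_eigenvector[OF sym assms(1) B(2) s(4) assms(9)] by blast
qed

end
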